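(* Let $\Bbbk$ be a unital commutative ring. The Koszul dual algebra $\mathsf{E}^!=H^0(\Omega(\mathsf{E}))$ of the exponential species is isomorphic, as an algebra in species, to the desuspension $\Sigma^{-1}\mathsf{E}^-$ of the signed exponential species $\mathsf{E}^-$.
   Context: A (linear) species is a functor from finite sets and bijections to (graded) $\Bbbk$-modules; the Cauchy product is $(\mathsf{X}\cdot\mathsf{Y})[I]=\bigoplus_{(S,T)}\mathsf{X}[S]\otimes\mathsf{Y}[T]$ over ordered pairs of disjoint, possibly empty, $S,T$ with $S\cup T=I$; algebras in species are associative unital algebras for this product. The cobar construction $\Omega(\mathsf{E})$ of the exponential species $\mathsf{E}$ ($\mathsf{E}[I]=\Bbbk e_I$, coproduct $e_I\mapsto e_S\otimes e_T$) has $\Omega(\mathsf{E})[I]$ free on the compositions $(F_1,\ldots,F_q)$ of $I$ (ordered tuples of nonempty disjoint sets with union $I$), product given by concatenation, and differential $d(F_1,\ldots,F_q)=\sum_{i}(-1)^i\sum_{(A,B)}(F_1,\ldots,A,B,\ldots,F_q)$ where $(A,B)$ runs over ordered pairs of disjoint nonempty sets with $A\cup B=F_i$. Placing $(F_1,\ldots,F_q)$ in degree $q-|I|$, $\mathsf{E}^!=H^0(\Omega(\mathsf{E}))$ is a quotient algebra of $\Omega(\mathsf{E})$: $\mathsf{E}^![I]$ is the quotient of the free module on compositions of $I$ into singletons by the image of $d$. As a graded algebra, $\mathsf{E}^![I]$ is regarded as concentrated in cohomological degree $|I|$ (number of blocks). The signed exponential species is $\mathsf{E}^-[I]=\bigwedge^{|I|}\Bbbk^I$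 (the top exterior power of the free module on $I$), an algebra under the exterior product $\mathsf{E}^-[S]\otimes\mathsf{E}^-[T]\to\mathsf{E}^-[I]$. The desuspension is $(\Sigma^{-1}\mathsf{X})[I]=s^{-|I|}\mathsf{X}[I]$, where $s^{-1}$ shifts to cohomological degree one higher; the product of $\Sigma^{-1}\mathsf{E}^-$ is the one induced by the product of $\mathsf{E}^-$. *)

theory Defs
  imports "HOL-Algebra.Module" "HOL-Algebra.AbelCoset"
begin

section \<open>Modules over a commutative ring\<close>

definition linear_map ::
  "('k, 'r) ring_scheme \<Rightarrow> ('k, 'm) module \<Rightarrow> ('k, 'n) module \<Rightarrow> ('m \<Rightarrow> 'n) \<Rightarrow> bool"
where
  "linear_map R M N f \<longleftrightarrow>
     f \<in> carrier M \<rightarrow> carrier N \<and>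
     (\<forall>x\<in>carrier M. \<forall>y\<in>carrier M. f (x \<oplus>\<^bsub>M\<^esub> y) = f x \<oplus>\<^bsub>N\<^esub> f y) \<and>
     (\<forall>r\<in>carrier R. \<forall>x\<in>carrier M. f (r \<odot>\<^bsub>M\<^esub> x) = r \<odot>\<^bsub>N\<^esub> f x)"

definition bilinear_map ::
  "('k, 'r) ring_scheme \<Rightarrow> ('k, 'm) module \<Rightarrow> ('k, 'n) module \<Rightarrow> ('k, 'p) module \<Rightarrow>
   ('m \<Rightarrow> 'n \<Rightarrow> 'p) \<Rightarrow> bool"
where
  "bilinear_map R M N P b \<longleftrightarrow>
     (\<forall>x\<in>carrier M. linear_map R N P (b x)) \<and>
     (\<forall>y\<in>carrier N. linear_map R M P (\<lambda>x. b x y))"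

definition submodule_span ::
  "('k, 'r) ring_scheme \<Rightarrow> ('k, 'm) module \<Rightarrow> 'm set \<Rightarrow> 'm set"
where
  "submodule_span R M G = \<Inter>{H. submodule H R M \<and> G \<subseteq> H}"

text \<open>
  Maps into a quotient \<open>P / H\<close> that are induced by maps on representatives. When the induced
  map is well defined, all the cosets in the union coincide.
\<close>

definition coset_map ::
  "('k, 'm) module \<Rightarrow> 'm set \<Rightarrow> ('x \<Rightarrow> 'm) \<Rightarrow> 'x set \<Rightarrow> 'm set"
where
  "coset_map P H f X = (\<Union>x\<in>X. H +>\<^bsub>P\<^esub> f x)"

definition coset_map2 ::
  "('k, 'm) module \<Rightarrow> 'm set \<Rightarrow> ('x \<Rightarrow> 'y \<Rightarrow> 'm) \<Rightarrow> 'x set \<Rightarrow> 'y set \<Rightarrow> 'm set"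
where
  "coset_map2 P H b X Y = (\<Union>x\<in>X. \<Union>y\<in>Y. H +>\<^bsub>P\<^esub> b x y)"

text \<open>
  The record type for modules extends the one for rings; its fields for a multiplication and
  its unit play no role for modules and are left unspecified.
\<close>

definition quot_module :: "('k, 'm) module \<Rightarrow> 'm set \<Rightarrow> ('k, 'm set) module" where
  "quot_module M H =
     \<lparr>carrier = a_rcosets\<^bsub>M\<^esub> H, mult = undefined, one = undefined,
      zero = H, add = set_add M, smult = (\<lambda>r. coset_map M H (\<lambda>x. r \<odot>\<^bsub>M\<^esub> x))\<rparr>"

definition free_module :: "('k, 'r) ring_scheme \<Rightarrow> 'b set \<Rightarrow> ('k, 'b \<Rightarrow> 'k) module" where
  "free_module R B =
     \<lparr>carrier = {f. (\<forall>b. f b \<in> carrier R) \<and> finite {b. f b \<noteq> \<zero>\<^bsub>R\<^esub>} \<and> {b. f b \<noteq> \<zero>\<^bsub>R\<^esub>} \<subseteq> B},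
      mult = undefined, one = undefined,
      zero = (\<lambda>b. \<zero>\<^bsub>R\<^esub>), add = (\<lambda>f g b. f b \<oplus>\<^bsub>R\<^esub> g b), smult = (\<lambda>r f b. r \<otimes>\<^bsub>R\<^esub> f b)\<rparr>"

definition basis_vec :: "('k, 'r) ring_scheme \<Rightarrow> 'b \<Rightarrow> 'b \<Rightarrow> 'k" where
  "basis_vec R b = (\<lambda>c. if c = b then \<one>\<^bsub>R\<^esub> else \<zero>\<^bsub>R\<^esub>)"

text \<open>The linear map from a free module to \<open>M\<close> with values \<open>v b\<close> on the basis elements.\<close>

definition lin_ext ::
  "('k, 'r) ring_scheme \<Rightarrow> ('k, 'm) module \<Rightarrow> ('b \<Rightarrow> 'm) \<Rightarrow> ('b \<Rightarrow> 'k) \<Rightarrow> 'm"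
where
  "lin_ext R M v f = (\<Oplus>\<^bsub>M\<^esub>b\<in>{b. f b \<noteq> \<zero>\<^bsub>R\<^esub>}. f b \<odot>\<^bsub>M\<^esub> v b)"

text \<open>Bilinear extension of concatenation of lists, with values in a free module \<open>P\<close> on lists.\<close>

definition concat_mult ::
  "('k, 'r) ring_scheme \<Rightarrow> ('k, 'b list \<Rightarrow> 'k) module \<Rightarrow>
   ('b list \<Rightarrow> 'k) \<Rightarrow> ('b list \<Rightarrow> 'k) \<Rightarrow> 'b list \<Rightarrow> 'k"
where
  "concat_mult R P f g = lin_ext R P (\<lambda>F. lin_ext R P (\<lambda>G. basis_vec R (F @ G)) g) f"

text \<open>The graded module that is \<open>M\<close> in degree \<open>d\<close> and zero in all other degrees.\<close>

definition concentrated :: "int \<Rightarrow> ('k, 'm) module \<Rightarrow> int \<Rightarrow> ('k, 'm) module" where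
  "concentrated d M n = (if n = d then M else M\<lparr>carrier := {\<zero>\<^bsub>M\<^esub>}\<rparr>)"


section \<open>Exterior powers\<close>

definition tuple_module ::
  "('k, 'r) ring_scheme \<Rightarrow> ('k, 'm) module \<Rightarrow> nat \<Rightarrow> ('k, 'm list \<Rightarrow> 'k) module"
where
  "tuple_module R M n = free_module R {xs. length xs = n \<and> set xs \<subseteq> carrier M}"

text \<open>
  Multilinearity, together with the degree-\<open>n\<close> part of the two-sided ideal of the tensor
  algebra generated by the squares \<open>x \<otimes> x\<close>.
\<close>

definition ext_relations ::
  "('k, 'r) ring_scheme \<Rightarrow> ('k, 'm) module \<Rightarrow> nat \<Rightarrow> ('m list \<Rightarrow> 'k) set"
where
  "ext_relations R M n = submodule_span R (tuple_module R M n)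
    ({basis_vec R (xs @ [x \<oplus>\<^bsub>M\<^esub> y] @ ys)
        \<ominus>\<^bsub>tuple_module R M n\<^esub> (basis_vec R (xs @ [x] @ ys)
           \<oplus>\<^bsub>tuple_module R M n\<^esub> basis_vec R (xs @ [y] @ ys)) | xs x y ys.
        length xs + 1 + length ys = n \<and>
        set xs \<union> {x, y} \<union> set ys \<subseteq> carrier M} \<union>
     {basis_vec R (xs @ [r \<odot>\<^bsub>M\<^esub> x] @ ys)
        \<ominus>\<^bsub>tuple_module R M n\<^esub> (r \<odot>\<^bsub>tuple_module R M n\<^esub> basis_vec R (xs @ [x] @ ys)) | xs r x ys.
        length xs + 1 + length ys = n \<and>
        r \<in> carrier R \<and> set xs \<union> {x} \<union> set ys \<subseteq> carrier M} \<union>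
     {basis_vec R (xs @ [x, x] @ ys) | xs x ys.
        length xs + 2 + length ys = n \<and>
        set xs \<union> {x} \<union> set ys \<subseteq> carrier M})"

definition ext_power ::
  "('k, 'r) ring_scheme \<Rightarrow> ('k, 'm) module \<Rightarrow> nat \<Rightarrow> ('k, ('m list \<Rightarrow> 'k) set) module"
where
  "ext_power R M n = quot_module (tuple_module R M n) (ext_relations R M n)"

definition ext_map ::
  "('k, 'r) ring_scheme \<Rightarrow> ('k, 'n) module \<Rightarrow> nat \<Rightarrow> ('m \<Rightarrow> 'n) \<Rightarrow>
   ('m list \<Rightarrow> 'k) set \<Rightarrow> ('n list \<Rightarrow> 'k) set"
where
  "ext_map R N n f = coset_map (tuple_module R N n) (ext_relations R N n)
     (lin_ext R (tuple_module R N n) (\<lambda>xs. basis_vec R (map f xs)))"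

definition ext_product ::
  "('k, 'r) ring_scheme \<Rightarrow> ('k, 'm) module \<Rightarrow> nat \<Rightarrow> nat \<Rightarrow>
   ('m list \<Rightarrow> 'k) set \<Rightarrow> ('m list \<Rightarrow> 'k) set \<Rightarrow> ('m list \<Rightarrow> 'k) set"
where
  "ext_product R M p q =
     coset_map2 (tuple_module R M (p + q)) (ext_relations R M (p + q))
       (concat_mult R (tuple_module R M (p + q)))"


section \<open>Species and algebras in species\<close>

text \<open>
  The finite sets are the finite subsets of an arbitrary type \<open>'a\<close>. The component of
  degree \<open>n\<close> of the graded module on \<open>I\<close> is \<open>obj X I n\<close>, and \<open>act X I n \<sigma>\<close> is its map to the
  component on \<open>\<sigma> ` I\<close> induced by the bijection \<open>I \<rightarrow> \<sigma> ` I\<close> that is the restriction of \<open>\<sigma>\<close>.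
\<close>

record ('k, 'a, 'x) species =
  obj :: "'a set \<Rightarrow> int \<Rightarrow> ('k, 'x) module"
  act :: "'a set \<Rightarrow> int \<Rightarrow> ('a \<Rightarrow> 'a) \<Rightarrow> 'x \<Rightarrow> 'x"

locale species =
  fixes R :: "('k, 'r) ring_scheme" and X :: "('k, 'a, 'x, 'z) species_scheme"
  assumes obj_module: "finite I \<Longrightarrow> module R (obj X I n)"
    and act_linear: "\<lbrakk>finite I; inj_on \<sigma> I\<rbrakk> \<Longrightarrow>
      linear_map R (obj X I n) (obj X (\<sigma> ` I) n) (act X I n \<sigma>)"
    and act_cong: "\<lbrakk>finite I; inj_on \<sigma> I; \<And>i. i \<in> I \<Longrightarrow> \<sigma> i = \<tau> i; x \<in> carrier (obj X I n)\<rbrakk> \<Longrightarrow>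
      act X I n \<sigma> x = act X I n \<tau> x"
    and act_id: "\<lbrakk>finite I; x \<in> carrier (obj X I n)\<rbrakk> \<Longrightarrow> act X I n id x = x"
    and act_comp: "\<lbrakk>finite I; inj_on \<sigma> I; inj_on \<tau> (\<sigma> ` I); x \<in> carrier (obj X I n)\<rbrakk> \<Longrightarrow>
      act X I n (\<tau> \<circ> \<sigma>) x = act X (\<sigma> ` I) n \<tau> (act X I n \<sigma> x)"

text \<open>
  A morphism from the Cauchy product of \<open>X\<close> with itself to \<open>X\<close> is given by its components, the
  linear maps from \<open>X[S] \<otimes> X[T]\<close> to \<open>X[S \<union> T]\<close> for disjoint \<open>S\<close> and \<open>T\<close>, written as bilinear
  maps; \<open>mul X S T m n\<close> is the component on degrees \<open>m\<close> and \<open>n\<close>. A morphism from the unit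
  species, which is the base ring on the empty set in degree zero, amounts to an
  element of degree zero on the empty set.
\<close>

record ('k, 'a, 'x) species_algebra = "('k, 'a, 'x) species" +
  mul :: "'a set \<Rightarrow> 'a set \<Rightarrow> int \<Rightarrow> int \<Rightarrow> 'x \<Rightarrow> 'x \<Rightarrow> 'x"
  unit :: 'x

locale species_algebra = species R X
  for R :: "('k, 'r) ring_scheme" and X :: "('k, 'a, 'x, 'z) species_algebra_scheme" +
  assumes mul_bilinear: "\<lbrakk>finite S; finite T; S \<inter> T = {}\<rbrakk> \<Longrightarrow>
      bilinear_map R (obj X S m) (obj X T n) (obj X (S \<union> T) (m + n)) (mul X S T m n)"
    and mul_natural: "\<lbrakk>finite S; finite T; S \<inter> T = {}; inj_on \<sigma> (S \<union> T);
        x \<in> carrier (obj X S m); y \<in> carrier (obj X T n)\<rbrakk> \<Longrightarrow>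
      act X (S \<union> T) (m + n) \<sigma> (mul X S T m n x y) =
      mul X (\<sigma> ` S) (\<sigma> ` T) m n (act X S m \<sigma> x) (act X T n \<sigma> y)"
    and mul_assoc: "\<lbrakk>finite S; finite T; finite U; S \<inter> T = {}; S \<inter> U = {}; T \<inter> U = {};
        x \<in> carrier (obj X S m); y \<in> carrier (obj X T n); z \<in> carrier (obj X U p)\<rbrakk> \<Longrightarrow>
      mul X (S \<union> T) U (m + n) p (mul X S T m n x y) z =
      mul X S (T \<union> U) m (n + p) x (mul X T U n p y z)"
    and unit_closed: "unit X \<in> carrier (obj X {} 0)"
    and unit_left: "\<lbrakk>finite S; x \<in> carrier (obj X S n)\<rbrakk> \<Longrightarrow> mul X {} S 0 n (unit X) x = x"
    and unit_right: "\<lbrakk>finite S; x \<in> carrier (obj X S n)\<rbrakk> \<Longrightarrow> mul X S {} n 0 x (unit X) = x"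

definition species_algebra_iso ::
  "('k, 'r) ring_scheme \<Rightarrow> ('k, 'a, 'x, 'u) species_algebra_scheme \<Rightarrow>
   ('k, 'a, 'y, 'v) species_algebra_scheme \<Rightarrow> ('a set \<Rightarrow> int \<Rightarrow> 'x \<Rightarrow> 'y) \<Rightarrow> bool"
where
  "species_algebra_iso R X Y \<phi> \<longleftrightarrow>
     (\<forall>I n. finite I \<longrightarrow>
        linear_map R (obj X I n) (obj Y I n) (\<phi> I n) \<and>
        bij_betw (\<phi> I n) (carrier (obj X I n)) (carrier (obj Y I n))) \<and>
     (\<forall>I n \<sigma>. finite I \<longrightarrow> inj_on \<sigma> I \<longrightarrow>
        (\<forall>x\<in>carrier (obj X I n). \<phi> (\<sigma> ` I) n (act X I n \<sigma> x) = act Y I n \<sigma> (\<phi> I n x))) \<and>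
     (\<forall>S T m n. finite S \<longrightarrow> finite T \<longrightarrow> S \<inter> T = {} \<longrightarrow>
        (\<forall>x\<in>carrier (obj X S m). \<forall>y\<in>carrier (obj X T n).
           \<phi> (S \<union> T) (m + n) (mul X S T m n x y) = mul Y S T m n (\<phi> S m x) (\<phi> T n y))) \<and>
     \<phi> {} 0 (unit X) = unit Y"

definition isomorphic_species_algebras ::
  "('k, 'r) ring_scheme \<Rightarrow> ('k, 'a, 'x, 'u) species_algebra_scheme \<Rightarrow>
   ('k, 'a, 'y, 'v) species_algebra_scheme \<Rightarrow> bool"
where
  "isomorphic_species_algebras R X Y \<longleftrightarrow>
     species_algebra R X \<and> species_algebra R Y \<and> (\<exists>\<phi>. species_algebra_iso R X Y \<phi>)"

text \<open>
  \<open>s\<^sup>-\<^sup>1\<close> raises the cohomological degree by one, so degree \<open>n\<close> of the desuspension on \<open>I\<close> is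
  degree \<open>n - |I|\<close> of the original module. The sign is the one of the Koszul rule for moving
  \<open>s\<close> to the power \<open>-|T|\<close> past an element of degree \<open>m - |S|\<close> of the original algebra; it is
  trivial for algebras concentrated in degree zero.
\<close>

definition desuspension :: "('k, 'a, 'x) species_algebra \<Rightarrow> ('k, 'a, 'x) species_algebra" where
  "desuspension X =
     \<lparr>obj = (\<lambda>I n. obj X I (n - int (card I))),
      act = (\<lambda>I n. act X I (n - int (card I))),
      mul = (\<lambda>S T m n x y.
        let m' = m - int (card S); n' = n - int (card T); z = mul X S T m' n' x y
        in if even (m' * int (card T)) then z else \<ominus>\<^bsub>obj X (S \<union> T) (m' + n')\<^esub> z),
      unit = unit X\<rparr>"


section \<open>Differential graded algebras in species and their cohomology\<close>

text \<open>\<open>diff X I n\<close> is the differential from degree \<open>n\<close> to degree \<open>n + 1\<close>.\<close>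

record ('k, 'a, 'x) dg_species_algebra = "('k, 'a, 'x) species_algebra" +
  diff :: "'a set \<Rightarrow> int \<Rightarrow> 'x \<Rightarrow> 'x"

definition cocycles :: "('k, 'a, 'x) dg_species_algebra \<Rightarrow> 'a set \<Rightarrow> int \<Rightarrow> 'x set" where
  "cocycles X I n = {x \<in> carrier (obj X I n). diff X I n x = \<zero>\<^bsub>obj X I (n + 1)\<^esub>}"

definition coboundaries :: "('k, 'a, 'x) dg_species_algebra \<Rightarrow> 'a set \<Rightarrow> int \<Rightarrow> 'x set" where
  "coboundaries X I n = diff X I (n - 1) ` carrier (obj X I (n - 1))"

definition cohomology ::
  "('k, 'a, 'x) dg_species_algebra \<Rightarrow> ('k, 'a, 'x set) species_algebra"
where
  "cohomology X =
     \<lparr>obj = (\<lambda>I n. quot_module ((obj X I n)\<lparr>carrier := cocycles X I n\<rparr>) (coboundaries X I n)),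
      act = (\<lambda>I n \<sigma>. coset_map (obj X (\<sigma> ` I) n) (coboundaries X (\<sigma> ` I) n) (act X I n \<sigma>)),
      mul = (\<lambda>S T m n. coset_map2 (obj X (S \<union> T) (m + n)) (coboundaries X (S \<union> T) (m + n))
                          (mul X S T m n)),
      unit = coboundaries X {} 0 +>\<^bsub>obj X {} 0\<^esub> unit X\<rparr>"


section \<open>The Koszul dual of the exponential species\<close>

definition compositions :: "'a set \<Rightarrow> 'a set list set" where
  "compositions I =
     {F. (\<forall>A\<in>set F. A \<noteq> {}) \<and>
         (\<forall>i<length F. \<forall>j<length F. i \<noteq> j \<longrightarrow> F ! i \<inter> F ! j = {}) \<and> \<Union>(set F) = I}"

definition splittings :: "'a set \<Rightarrow> ('a set \<times> 'a set) set" where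
  "splittings C = {(A, B). A \<noteq> {} \<and> B \<noteq> {} \<and> A \<inter> B = {} \<and> A \<union> B = C}"

definition cobar_obj ::
  "('k, 'r) ring_scheme \<Rightarrow> 'a set \<Rightarrow> int \<Rightarrow> ('k, 'a set list \<Rightarrow> 'k) module"
where
  "cobar_obj R I n =
     free_module R {F \<in> compositions I. int (length F) - int (card I) = n}"

text \<open>The blocks of \<open>F\<close> are counted from \<open>1\<close>: block number \<open>i\<close> is \<open>F ! (i - 1)\<close>.\<close>

definition cobar_exp ::
  "('k, 'r) ring_scheme \<Rightarrow> ('k, 'a, 'a set list \<Rightarrow> 'k) dg_species_algebra"
where
  "cobar_exp R =
     \<lparr>obj = cobar_obj R,
      act = (\<lambda>I n \<sigma>. lin_ext R (cobar_obj R (\<sigma> ` I) n) (\<lambda>F. basis_vec R (map ((`) \<sigma>) F))),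
      mul = (\<lambda>S T m n. concat_mult R (cobar_obj R (S \<union> T) (m + n))),
      unit = basis_vec R [],
      diff = (\<lambda>I n. lin_ext R (cobar_obj R I (n + 1))
        (\<lambda>F. \<Oplus>\<^bsub>cobar_obj R I (n + 1)\<^esub>i\<in>{1..length F}.
           ((\<ominus>\<^bsub>R\<^esub> \<one>\<^bsub>R\<^esub>) [^]\<^bsub>R\<^esub> i) \<odot>\<^bsub>cobar_obj R I (n + 1)\<^esub>
             (\<Oplus>\<^bsub>cobar_obj R I (n + 1)\<^esub>p\<in>splittings (F ! (i - 1)).
                basis_vec R (take (i - 1) F @ [fst p, snd p] @ drop i F))))\<rparr>"

definition koszul_dual_exp ::
  "('k, 'r) ring_scheme \<Rightarrow> ('k, 'a, ('a set list \<Rightarrow> 'k) set) species_algebra"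
where
  "koszul_dual_exp R =
     (let H = cohomology (cobar_exp R) in
      \<lparr>obj = (\<lambda>I. concentrated (int (card I)) (obj H I 0)),
       act = (\<lambda>I n. act H I 0),
       mul = (\<lambda>S T m n. mul H S T 0 0),
       unit = unit H\<rparr>)"


section \<open>The signed exponential species\<close>

text \<open>
  The free module on \<open>I\<close> consists of functions on the whole type \<open>'a\<close> vanishing outside \<open>I\<close>.
  For \<open>S \<subseteq> I\<close>, extension by zero from \<open>S\<close> to \<open>I\<close> is therefore the identity on functions, and
  the product on \<open>S\<close> and \<open>T\<close> is formed directly in the exterior algebra over \<open>S \<union> T\<close>.
\<close>

definition signed_exp ::
  "('k, 'r) ring_scheme \<Rightarrow> ('k, 'a, (('a \<Rightarrow> 'k) list \<Rightarrow> 'k) set) species_algebra"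
where
  "signed_exp R =
     \<lparr>obj = (\<lambda>I. concentrated 0 (ext_power R (free_module R I) (card I))),
      act = (\<lambda>I n \<sigma>. ext_map R (free_module R (\<sigma> ` I)) (card I)
               (lin_ext R (free_module R (\<sigma> ` I)) (\<lambda>i. basis_vec R (\<sigma> i)))),
      mul = (\<lambda>S T m n. ext_product R (free_module R (S \<union> T)) (card S) (card T)),
      unit = ext_relations R (free_module R {}) 0
               +>\<^bsub>tuple_module R (free_module R {}) 0\<^esub> basis_vec R []\<rparr>"

end

theory Submission
  imports Defs
begin

text \<open>
  On a finite set \<open>I\<close> with \<open>n\<close> elements, both algebras are a free module on words of length \<open>n\<close>
  modulo relations, placed in degree \<open>n\<close>. In both, the product is induced by concatenation of
  words and a bijection acts letter by letter.

  For \<open>E\<^sup>!\<close> the letters are singletons. A composition of \<open>I\<close> has at most \<open>n\<close> blocks, so in degree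
  zero every cochain is a cocycle, and the words are the compositions into singletons, that is,
  the total orders of \<open>I\<close>. A composition with \<open>n - 1\<close> blocks has exactly one block \<open>{a, b}\<close> with
  two elements. Its differential is, up to sign, the sum of the two orders in which \<open>a, b\<close> and
  \<open>b, a\<close> replace this block. Hence \<open>E\<^sup>![I]\<close> is the module of orders in which exchanging two
  neighbours changes the sign (\<open>koszul_relations_eq\<close>).

  For \<open>\<Sigma>\<^sup>-\<^sup>1 E\<^sup>-\<close> the letters are vectors of the free module on \<open>I\<close>, and the relations are
  multilinearity and the vanishing of words with two equal neighbours. The desuspension supplies
  the degree \<open>n\<close>; a negative Koszul sign only ever meets zero elements, because \<open>E\<^sup>-\<close> is
  concentrated in degree zero.

  The isomorphism replaces each letter \<open>{i}\<close> by the basis vector \<open>e\<^sub>i\<close>. Being defined on letters,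
  it is compatible with products, units and bijections; only bijectivity modulo the relations
  has to be shown (\<open>presented_algebras_isomorphic\<close>).

  \<^item> It is well defined because \<open>x \<and> y + y \<and> x = 0\<close> follows from \<open>(x + y) \<and> (x + y) = 0\<close>.
  \<^item> It is surjective because multilinear expansion leaves words of basis vectors, and such a word
    either has a repeated letter, hence vanishes, or comes from an order
    (\<open>wedge_generates\<close>).
  \<^item> It is injective because it has a left inverse. Send \<open>v\<^sub>1 \<dots> v\<^sub>n\<close> to the combination of
    orders in which \<open>i\<^sub>1 \<dots> i\<^sub>n\<close> has the coefficient \<open>v\<^sub>1(i\<^sub>1) \<cdots> v\<^sub>n(i\<^sub>n)\<close>. Before any relation is
    imposed, this undoes the replacement of letters exactly (\<open>order_coeffs_wedge\<close>). It is
    multilinear, and a word with two equal neighbours goes to a combination that is invariant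
    under exchanging the corresponding two places, which is a combination of relations
    (\<open>order_coeffs_alternating\<close>).

  No step divides by two or inverts a determinant, so the argument works over every commutative
  ring.
\<close>

section \<open>Linear maps and submodules\<close>

lemma linear_mapD:
  assumes "linear_map R M N f"
  shows "x \<in> carrier M \<Longrightarrow> f x \<in> carrier N"
    and "x \<in> carrier M \<Longrightarrow> y \<in> carrier M \<Longrightarrow> f (x \<oplus>\<^bsub>M\<^esub> y) = f x \<oplus>\<^bsub>N\<^esub> f y"
    and "r \<in> carrier R \<Longrightarrow> x \<in> carrier M \<Longrightarrow> f (r \<odot>\<^bsub>M\<^esub> x) = r \<odot>\<^bsub>N\<^esub> f x"
  using assms unfolding linear_map_def by auto

lemma linear_mapI:
  assumes "\<And>x. x \<in> carrier M \<Longrightarrow> f x \<in> carrier N"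
    and "\<And>x y. x \<in> carrier M \<Longrightarrow> y \<in> carrier M \<Longrightarrow> f (x \<oplus>\<^bsub>M\<^esub> y) = f x \<oplus>\<^bsub>N\<^esub> f y"
    and "\<And>r x. r \<in> carrier R \<Longrightarrow> x \<in> carrier M \<Longrightarrow> f (r \<odot>\<^bsub>M\<^esub> x) = r \<odot>\<^bsub>N\<^esub> f x"
  shows "linear_map R M N f"
  using assms unfolding linear_map_def by auto

lemma linear_map_cong:
  assumes "linear_map R M N f" "module R M" "\<And>x. x \<in> carrier M \<Longrightarrow> g x = f x"
  shows "linear_map R M N g"
proof -
  interpret M: module R M by fact
  show ?thesis
    using linear_mapD[OF assms(1)] assms(3) by (intro linear_mapI) auto
qed

lemma linear_map_comp:
  assumes "linear_map R M N f" "linear_map R N P g"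
  shows "linear_map R M P (\<lambda>x. g (f x))"
  using assms unfolding linear_map_def by (auto simp: Pi_iff)

lemma linear_map_zero:
  assumes "linear_map R M N f" "module R M" "module R N"
  shows "f \<zero>\<^bsub>M\<^esub> = \<zero>\<^bsub>N\<^esub>"
proof -
  interpret M: module R M by fact
  interpret N: module R N by fact
  have "f (\<zero>\<^bsub>R\<^esub> \<odot>\<^bsub>M\<^esub> \<zero>\<^bsub>M\<^esub>) = \<zero>\<^bsub>R\<^esub> \<odot>\<^bsub>N\<^esub> f \<zero>\<^bsub>M\<^esub>"
    using linear_mapD[OF assms(1)] by blast
  then show ?thesis using linear_mapD(1)[OF assms(1)] by simp
qed

lemma linear_map_a_inv:
  assumes "linear_map R M N f" "module R M" "module R N" "x \<in> carrier M"
  shows "f (\<ominus>\<^bsub>M\<^esub> x) = \<ominus>\<^bsub>N\<^esub> f x"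
proof -
  interpret M: module R M by fact
  interpret N: module R N by fact
  have "f (\<ominus>\<^bsub>M\<^esub> x) \<oplus>\<^bsub>N\<^esub> f x = \<zero>\<^bsub>N\<^esub>"
    using linear_mapD(2)[OF assms(1), of "\<ominus>\<^bsub>M\<^esub> x" x] linear_map_zero[OF assms(1-3)] assms(4)
    by (simp add: M.l_neg)
  then show ?thesis
    using linear_mapD(1)[OF assms(1)] assms(4) by (simp add: N.minus_equality)
qed

lemma linear_map_minus:
  assumes "linear_map R M N f" "module R M" "module R N" "x \<in> carrier M" "y \<in> carrier M"
  shows "f (x \<ominus>\<^bsub>M\<^esub> y) = f x \<ominus>\<^bsub>N\<^esub> f y"
proof -
  interpret M: module R M by fact
  show ?thesis
    using linear_mapD(2)[OF assms(1)] linear_map_a_inv[OF assms(1-3)] assms(4,5)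
    by (simp add: a_minus_def)
qed

lemma submoduleD:
  assumes "submodule H R M" "module R M"
  shows "x \<in> H \<Longrightarrow> x \<in> carrier M"
    and "\<zero>\<^bsub>M\<^esub> \<in> H"
    and "x \<in> H \<Longrightarrow> \<ominus>\<^bsub>M\<^esub> x \<in> H"
    and "x \<in> H \<Longrightarrow> y \<in> H \<Longrightarrow> x \<oplus>\<^bsub>M\<^esub> y \<in> H"
    and "x \<in> H \<Longrightarrow> y \<in> H \<Longrightarrow> x \<ominus>\<^bsub>M\<^esub> y \<in> H"
    and "r \<in> carrier R \<Longrightarrow> x \<in> H \<Longrightarrow> r \<odot>\<^bsub>M\<^esub> x \<in> H"
  using module.submoduleE[OF assms(2,1)] subgroup.one_closed[OF submodule.axioms(1)[OF assms(1)]]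
  by (auto simp: a_minus_def)

lemma linear_map_vimage_submodule:
  assumes "linear_map R M N f" "module R M" "module R N" "submodule H R N"
  shows "submodule {x \<in> carrier M. f x \<in> H} R M"
proof -
  interpret M: module R M by fact
  interpret N: module R N by fact
  note H = submoduleD[OF assms(4,3)] and f = linear_mapD[OF assms(1)]
  show ?thesis
  proof (rule M.submoduleI)
    show "\<zero>\<^bsub>M\<^esub> \<in> {x \<in> carrier M. f x \<in> H}"
      using linear_map_zero[OF assms(1-3)] H by simp
    fix x assume "x \<in> {x \<in> carrier M. f x \<in> H}"
    then show "\<ominus>\<^bsub>M\<^esub> x \<in> {x \<in> carrier M. f x \<in> H}"
      using H by (auto simp: linear_map_a_inv[OF assms(1-3)])
  qed (use H f in auto)
qed

lemma linear_map_image_submodule: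
  assumes "linear_map R M N f" "module R M" "module R N"
  shows "submodule (f ` carrier M) R N"
proof -
  interpret M: module R M by fact
  interpret N: module R N by fact
  note f = linear_mapD[OF assms(1)]
  show ?thesis
  proof (rule N.submoduleI)
    show "\<zero>\<^bsub>N\<^esub> \<in> f ` carrier M"
      using linear_map_zero[OF assms] by (metis M.zero_closed imageI)
    fix y assume "y \<in> f ` carrier M"
    then show "\<ominus>\<^bsub>N\<^esub> y \<in> f ` carrier M"
      by (auto simp: linear_map_a_inv[OF assms(1-3), symmetric])
  next
    fix r y assume "r \<in> carrier R" "y \<in> f ` carrier M"
    then show "r \<odot>\<^bsub>N\<^esub> y \<in> f ` carrier M"
      by (auto simp: f(3)[symmetric])
  next
    fix y z assume "y \<in> f ` carrier M" "z \<in> f ` carrier M"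
    then show "y \<oplus>\<^bsub>N\<^esub> z \<in> f ` carrier M"
      by (auto simp: f(2)[symmetric])
  qed (use f in auto)
qed

lemma equalizer_submodule:
  assumes "linear_map R M N f" "linear_map R M N g" "module R M" "module R N"
  shows "submodule {x \<in> carrier M. f x = g x} R M"
proof -
  interpret M: module R M by fact
  interpret N: module R N by fact
  note f = linear_mapD[OF assms(1)] linear_map_zero[OF assms(1,3,4)] linear_map_a_inv[OF assms(1,3,4)]
  note g = linear_mapD[OF assms(2)] linear_map_zero[OF assms(2,3,4)] linear_map_a_inv[OF assms(2,3,4)]
  show ?thesis by (rule M.submoduleI) (use f g in auto)
qed

lemma submodule_span_submodule:
  assumes "module R M" "G \<subseteq> carrier M"
  shows "submodule (submodule_span R M G) R M"
proof -
  interpret M: module R M by fact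
  note sub = submoduleD[OF _ assms(1)]
  show ?thesis
    unfolding submodule_span_def
  proof (rule M.submoduleI)
    show "\<Inter> {H. submodule H R M \<and> G \<subseteq> H} \<subseteq> carrier M"
      using M.carrier_is_submodule assms(2) by (intro Inter_lower) simp
  qed (auto intro: sub)
qed

lemma submodule_span_superset: "G \<subseteq> submodule_span R M G"
  unfolding submodule_span_def by blast

lemma submodule_span_least: "submodule H R M \<Longrightarrow> G \<subseteq> H \<Longrightarrow> submodule_span R M G \<subseteq> H"
  unfolding submodule_span_def by blast

lemma linear_map_span:
  assumes "linear_map R M N f" "module R M" "module R N" "submodule H R N"
    and "G \<subseteq> carrier M" "\<And>g. g \<in> G \<Longrightarrow> f g \<in> H" "x \<in> submodule_span R M G"
  shows "f x \<in> H"
  using submodule_span_least[OF linear_map_vimage_submodule[OF assms(1-4)], of G] assms(5-7)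
  by blast


section \<open>Free modules\<close>

lemma free_module_simps:
  "zero (free_module R B) = (\<lambda>b. \<zero>\<^bsub>R\<^esub>)"
  "f \<oplus>\<^bsub>free_module R B\<^esub> g = (\<lambda>b. f b \<oplus>\<^bsub>R\<^esub> g b)"
  "r \<odot>\<^bsub>free_module R B\<^esub> f = (\<lambda>b. r \<otimes>\<^bsub>R\<^esub> f b)"
  by (simp_all add: free_module_def)

lemma free_module_carrier:
  "f \<in> carrier (free_module R B) \<longleftrightarrow>
     (\<forall>b. f b \<in> carrier R) \<and> finite {b. f b \<noteq> \<zero>\<^bsub>R\<^esub>} \<and> {b. f b \<noteq> \<zero>\<^bsub>R\<^esub>} \<subseteq> B"
  by (simp add: free_module_def)

lemma free_moduleI:
  assumes "finite A" "A \<subseteq> B" "\<And>b. f b \<in> carrier R" "\<And>b. b \<notin> A \<Longrightarrow> f b = \<zero>\<^bsub>R\<^esub>"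
  shows "f \<in> carrier (free_module R B)"
proof -
  have "{b. f b \<noteq> \<zero>\<^bsub>R\<^esub>} \<subseteq> A" using assms by auto
  then show ?thesis using assms finite_subset unfolding free_module_carrier by blast
qed

context cring begin

lemma free_module_module: "module R (free_module R B)"
proof (intro moduleI abelian_groupI is_cring)
  let ?M = "free_module R B"
  note [simp] = free_module_simps
  fix f g h assume f: "f \<in> carrier ?M"
  have "(\<lambda>b. \<ominus> f b) \<in> carrier ?M"
    using f by (intro free_moduleI[of "{b. f b \<noteq> \<zero>}"]) (auto simp: free_module_carrier)
  moreover have "(\<lambda>b. \<ominus> f b) \<oplus>\<^bsub>?M\<^esub> f = \<zero>\<^bsub>?M\<^esub>"
    using f by (auto simp: free_module_carrier l_neg)
  ultimately show "\<exists>y\<in>carrier ?M. y \<oplus>\<^bsub>?M\<^esub> f = \<zero>\<^bsub>?M\<^esub>" by blast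
  { fix r assume "r \<in> carrier R"
    then show "r \<odot>\<^bsub>?M\<^esub> f \<in> carrier ?M"
      using f by (intro free_moduleI[of "{b. f b \<noteq> \<zero>}"]) (auto simp: free_module_carrier) }
  assume g: "g \<in> carrier ?M"
  show "f \<oplus>\<^bsub>?M\<^esub> g \<in> carrier ?M"
    using f g by (intro free_moduleI[of "{b. f b \<noteq> \<zero>} \<union> {b. g b \<noteq> \<zero>}"])
      (auto simp: free_module_carrier)
  show "f \<oplus>\<^bsub>?M\<^esub> g = g \<oplus>\<^bsub>?M\<^esub> f"
    using f g by (auto simp: free_module_carrier a_comm)
qed (auto simp: free_module_simps free_module_carrier a_assoc l_distr r_distr m_assoc)

lemma basis_vec_closed: "b \<in> B \<Longrightarrow> basis_vec R b \<in> carrier (free_module R B)"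
  by (intro free_moduleI[of "{b}"]) (auto simp: basis_vec_def)

lemma free_module_induct:
  assumes H: "submodule H R (free_module R B)"
    and basis: "\<And>b. b \<in> B \<Longrightarrow> basis_vec R b \<in> H"
    and f: "f \<in> carrier (free_module R B)"
  shows "f \<in> H"
proof -
  note sub = submoduleD[OF H free_module_module, unfolded free_module_simps]
  have "\<forall>f\<in>carrier (free_module R B). {b. f b \<noteq> \<zero>} \<subseteq> A \<longrightarrow> f \<in> H" if "finite A" "A \<subseteq> B" for A
    using that
  proof (induction A rule: finite_induct)
    case empty
    show ?case
    proof (intro ballI impI)
      fix f assume "f \<in> carrier (free_module R B)" "{b. f b \<noteq> \<zero>} \<subseteq> {}"
      then have "f = (\<lambda>b. \<zero>)" by auto
      then show "f \<in> H" using sub(2) by simp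
    qed
  next
    case (insert a A)
    show ?case
    proof (intro ballI impI)
      fix f assume f: "f \<in> carrier (free_module R B)" and s: "{b. f b \<noteq> \<zero>} \<subseteq> insert a A"
      have fa: "f a \<in> carrier R" and fb: "\<And>b. f b \<in> carrier R"
        using f by (auto simp: free_module_carrier)
      let ?g = "\<lambda>b. if b = a then \<zero> else f b"
      have sg: "{b. ?g b \<noteq> \<zero>} \<subseteq> A" using s by auto
      have "?g \<in> carrier (free_module R B)"
        using s insert by (intro free_moduleI[of A]) (auto simp: fb)
      then have "?g \<in> H" using insert sg by auto
      moreover have "(\<lambda>b. f a \<otimes> basis_vec R a b) \<in> H"
        using sub(6)[OF fa basis] insert by simp
      moreover have "f = (\<lambda>b. ?g b \<oplus> (f a \<otimes> basis_vec R a b))"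
        by (auto simp: basis_vec_def fa fb)
      ultimately show "f \<in> H" using sub(4) by metis
    qed
  qed
  then show ?thesis using f by (auto simp: free_module_carrier)
qed

text \<open>
  The defining sum runs over the support of the argument, which varies with the argument. Summing
  over a common larger set makes the additivity of \<open>lin_ext\<close> visible.
\<close>

lemma lin_ext_finsum:
  assumes "module R M" "v \<in> B \<rightarrow> carrier M" "finite A" "A \<subseteq> B"
    and "f \<in> carrier (free_module R B)" "{b. f b \<noteq> \<zero>} \<subseteq> A"
  shows "lin_ext R M v f = (\<Oplus>\<^bsub>M\<^esub>b\<in>A. f b \<odot>\<^bsub>M\<^esub> v b)"
proof -
  interpret M: module R M by fact
  have fb: "\<And>b. f b \<in> carrier R" using assms by (auto simp: free_module_carrier)
  show ?thesis
    unfolding lin_ext_def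
    by (rule M.add.finprod_mono_neutral_cong_left) (use assms fb in \<open>auto simp: Pi_iff\<close>)
qed

lemma lin_ext_linear:
  assumes M: "module R M" and v: "v \<in> B \<rightarrow> carrier M"
  shows "linear_map R (free_module R B) M (lin_ext R M v)"
proof -
  interpret M: module R M by fact
  interpret F: module R "free_module R B" by (rule free_module_module)
  have vb: "\<And>b. b \<in> B \<Longrightarrow> v b \<in> carrier M" using v by auto
  show ?thesis
  proof (rule linear_mapI)
    fix f assume f: "f \<in> carrier (free_module R B)"
    let ?A = "{b. f b \<noteq> \<zero>}"
    have A: "finite ?A" "?A \<subseteq> B" and fb: "\<And>b. f b \<in> carrier R"
      using f by (auto simp: free_module_carrier)
    have mem: "(\<lambda>b. f b \<odot>\<^bsub>M\<^esub> v b) \<in> ?A \<rightarrow> carrier M" using A fb vb by auto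
    then show "lin_ext R M v f \<in> carrier M"
      unfolding lin_ext_def by (rule M.finsum_closed)
    fix r assume r: "r \<in> carrier R"
    have "lin_ext R M v (r \<odot>\<^bsub>free_module R B\<^esub> f)
        = (\<Oplus>\<^bsub>M\<^esub>b\<in>?A. (r \<odot>\<^bsub>free_module R B\<^esub> f) b \<odot>\<^bsub>M\<^esub> v b)"
      using r by (intro lin_ext_finsum[OF M v A F.smult_closed[OF r f]]) (auto simp: free_module_simps)
    also have "\<dots> = (\<Oplus>\<^bsub>M\<^esub>b\<in>?A. r \<odot>\<^bsub>M\<^esub> (f b \<odot>\<^bsub>M\<^esub> v b))"
      using A fb vb r by (intro M.finsum_cong') (auto simp: M.smult_assoc1 subset_iff free_module_simps)
    also have "\<dots> = r \<odot>\<^bsub>M\<^esub> lin_ext R M v f"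
      unfolding lin_ext_def by (rule M.finsum_smult_ldistr[OF A(1) r mem, symmetric])
    finally show "lin_ext R M v (r \<odot>\<^bsub>free_module R B\<^esub> f) = r \<odot>\<^bsub>M\<^esub> lin_ext R M v f" .
  next
    fix f g assume f: "f \<in> carrier (free_module R B)" and g: "g \<in> carrier (free_module R B)"
    let ?A = "{b. f b \<noteq> \<zero>} \<union> {b. g b \<noteq> \<zero>}"
    have A: "finite ?A" "?A \<subseteq> B" and fb: "\<And>b. f b \<in> carrier R" and gb: "\<And>b. g b \<in> carrier R"
      using f g by (auto simp: free_module_carrier)
    have "lin_ext R M v (f \<oplus>\<^bsub>free_module R B\<^esub> g)
        = (\<Oplus>\<^bsub>M\<^esub>b\<in>?A. (f \<oplus>\<^bsub>free_module R B\<^esub> g) b \<odot>\<^bsub>M\<^esub> v b)"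
      by (intro lin_ext_finsum[OF M v A F.a_closed[OF f g]]) (auto simp: free_module_simps)
    also have "\<dots> = (\<Oplus>\<^bsub>M\<^esub>b\<in>?A. f b \<odot>\<^bsub>M\<^esub> v b \<oplus>\<^bsub>M\<^esub> g b \<odot>\<^bsub>M\<^esub> v b)"
      using A fb gb vb by (intro M.finsum_cong') (auto simp: M.smult_l_distr subset_iff free_module_simps)
    also have "\<dots> = (\<Oplus>\<^bsub>M\<^esub>b\<in>?A. f b \<odot>\<^bsub>M\<^esub> v b) \<oplus>\<^bsub>M\<^esub> (\<Oplus>\<^bsub>M\<^esub>b\<in>?A. g b \<odot>\<^bsub>M\<^esub> v b)"
      using A fb gb vb by (intro M.finsum_addf) (auto simp: subset_iff)
    also have "\<dots> = lin_ext R M v f \<oplus>\<^bsub>M\<^esub> lin_ext R M v g"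
      using lin_ext_finsum[OF M v A f] lin_ext_finsum[OF M v A g] by auto
    finally show "lin_ext R M v (f \<oplus>\<^bsub>free_module R B\<^esub> g)
        = lin_ext R M v f \<oplus>\<^bsub>M\<^esub> lin_ext R M v g" .
  qed
qed

lemma lin_ext_basis:
  assumes M: "module R M" and v: "v b \<in> carrier M"
  shows "lin_ext R M v (basis_vec R b) = v b"
proof -
  interpret M: module R M by fact
  \<comment> \<open>Over the zero ring the support of the basis vector is empty, so the sum is taken over \<open>{b}\<close>.\<close>
  have "lin_ext R M v (basis_vec R b) = (\<Oplus>\<^bsub>M\<^esub>c\<in>{b}. basis_vec R b c \<odot>\<^bsub>M\<^esub> v c)"
    using v by (intro lin_ext_finsum[OF M, of _ "{b}"] basis_vec_closed) (auto simp: basis_vec_def)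
  then show ?thesis using v by (simp add: basis_vec_def)
qed

lemma linear_map_eq_on_basis:
  assumes f: "linear_map R (free_module R B) M f" and g: "linear_map R (free_module R B) M g"
    and M: "module R M" and eq: "\<And>b. b \<in> B \<Longrightarrow> f (basis_vec R b) = g (basis_vec R b)"
    and x: "x \<in> carrier (free_module R B)"
  shows "f x = g x"
proof -
  have "x \<in> {x \<in> carrier (free_module R B). f x = g x}"
    by (rule free_module_induct[OF equalizer_submodule[OF f g free_module_module M] _ x])
      (simp add: eq basis_vec_closed)
  then show ?thesis by simp
qed

text \<open>This gives the linearity of \<open>concat_mult\<close> in its second argument.\<close>

lemma lin_ext_values_linear:
  assumes M: "module R M" and N: "module R N" and v: "\<And>b. b \<in> B \<Longrightarrow> linear_map R N M (v b)"
    and f: "f \<in> carrier (free_module R B)"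
  shows "linear_map R N M (\<lambda>y. lin_ext R M (\<lambda>b. v b y) f)"
proof -
  interpret M: module R M by fact
  interpret N: module R N by fact
  let ?A = "{b. f b \<noteq> \<zero>}"
  have A: "finite ?A" "?A \<subseteq> B" and fb: "\<And>b. f b \<in> carrier R"
    using f by (auto simp: free_module_carrier)
  have vA: "linear_map R N M (v b)" if "f b \<noteq> \<zero>" for b using v A that by auto
  note v' = linear_mapD[OF vA]
  show ?thesis
  proof (rule linear_mapI)
    fix y assume y: "y \<in> carrier N"
    have mem: "(\<lambda>b. f b \<odot>\<^bsub>M\<^esub> v b y) \<in> ?A \<rightarrow> carrier M" using v' fb y by auto
    then show "lin_ext R M (\<lambda>b. v b y) f \<in> carrier M"
      unfolding lin_ext_def by (rule M.finsum_closed)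
    { fix z assume z: "z \<in> carrier N"
      have "(\<Oplus>\<^bsub>M\<^esub>b\<in>?A. f b \<odot>\<^bsub>M\<^esub> v b (y \<oplus>\<^bsub>N\<^esub> z))
          = (\<Oplus>\<^bsub>M\<^esub>b\<in>?A. f b \<odot>\<^bsub>M\<^esub> v b y \<oplus>\<^bsub>M\<^esub> f b \<odot>\<^bsub>M\<^esub> v b z)"
        using v' fb y z by (intro M.finsum_cong') (auto simp: M.smult_r_distr)
      also have "\<dots> = (\<Oplus>\<^bsub>M\<^esub>b\<in>?A. f b \<odot>\<^bsub>M\<^esub> v b y) \<oplus>\<^bsub>M\<^esub> (\<Oplus>\<^bsub>M\<^esub>b\<in>?A. f b \<odot>\<^bsub>M\<^esub> v b z)"
        using v' fb y z by (intro M.finsum_addf) auto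
      finally show "lin_ext R M (\<lambda>b. v b (y \<oplus>\<^bsub>N\<^esub> z)) f
          = lin_ext R M (\<lambda>b. v b y) f \<oplus>\<^bsub>M\<^esub> lin_ext R M (\<lambda>b. v b z) f"
        unfolding lin_ext_def . }
    fix r assume r: "r \<in> carrier R"
    have "(\<Oplus>\<^bsub>M\<^esub>b\<in>?A. f b \<odot>\<^bsub>M\<^esub> v b (r \<odot>\<^bsub>N\<^esub> y)) = (\<Oplus>\<^bsub>M\<^esub>b\<in>?A. r \<odot>\<^bsub>M\<^esub> (f b \<odot>\<^bsub>M\<^esub> v b y))"
      using v' fb y r
      by (intro M.finsum_cong') (auto simp: M.smult_assoc1[symmetric] m_comm)
    also have "\<dots> = r \<odot>\<^bsub>M\<^esub> (\<Oplus>\<^bsub>M\<^esub>b\<in>?A. f b \<odot>\<^bsub>M\<^esub> v b y)"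
      by (rule M.finsum_smult_ldistr[OF A(1) r mem, symmetric])
    finally show "lin_ext R M (\<lambda>b. v b (r \<odot>\<^bsub>N\<^esub> y)) f = r \<odot>\<^bsub>M\<^esub> lin_ext R M (\<lambda>b. v b y) f"
      unfolding lin_ext_def .
  qed
qed

end


section \<open>Bilinear maps and concatenation\<close>

lemma bilinear_mapD:
  assumes "bilinear_map R M N P b"
  shows "x \<in> carrier M \<Longrightarrow> linear_map R N P (b x)"
    and "y \<in> carrier N \<Longrightarrow> linear_map R M P (\<lambda>x. b x y)"
    and "x \<in> carrier M \<Longrightarrow> y \<in> carrier N \<Longrightarrow> b x y \<in> carrier P"
  using assms unfolding bilinear_map_def linear_map_def by auto

lemma bilinear_mapI:
  assumes "\<And>x. x \<in> carrier M \<Longrightarrow> linear_map R N P (b x)"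
    and "\<And>y. y \<in> carrier N \<Longrightarrow> linear_map R M P (\<lambda>x. b x y)"
  shows "bilinear_map R M N P b"
  using assms unfolding bilinear_map_def by auto

lemma bilinear_map_cong:
  assumes b: "bilinear_map R M N P b" and M: "module R M" and N: "module R N"
    and eq: "\<And>x y. x \<in> carrier M \<Longrightarrow> y \<in> carrier N \<Longrightarrow> c x y = b x y"
  shows "bilinear_map R M N P c"
  using linear_map_cong[OF bilinear_mapD(1)[OF b] N] linear_map_cong[OF bilinear_mapD(2)[OF b] M] eq
  by (intro bilinear_mapI) auto

lemma bilinear_map_comp_inner:
  assumes "bilinear_map R M' N' P b" "linear_map R M M' f" "linear_map R N N' g"
  shows "bilinear_map R M N P (\<lambda>x y. b (f x) (g y))"
  using bilinear_mapD[OF assms(1)] linear_mapD(1)[OF assms(2)] linear_mapD(1)[OF assms(3)]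
  by (intro bilinear_mapI linear_map_comp[OF assms(3)]
      linear_map_comp[OF assms(2), where g = "\<lambda>x. b x z" for z]) auto

lemma bilinear_map_comp_outer:
  assumes "bilinear_map R M N P b" "linear_map R P Q f"
  shows "bilinear_map R M N Q (\<lambda>x y. f (b x y))"
  using bilinear_mapD[OF assms(1)]
  by (intro bilinear_mapI linear_map_comp[OF _ assms(2)]) auto

lemma bilinear_map_zero:
  assumes b: "bilinear_map R M N P b" and M: "module R M" and N: "module R N" and P: "module R P"
  shows "x \<in> carrier M \<Longrightarrow> b x \<zero>\<^bsub>N\<^esub> = \<zero>\<^bsub>P\<^esub>" "y \<in> carrier N \<Longrightarrow> b \<zero>\<^bsub>M\<^esub> y = \<zero>\<^bsub>P\<^esub>"
  using linear_map_zero[OF bilinear_mapD(1)[OF b] N P] linear_map_zero[OF bilinear_mapD(2)[OF b] M P]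
  by auto

lemma (in cring) bilinear_map_eq_on_basis:
  assumes b: "bilinear_map R (free_module R B) (free_module R C) M b"
    and c: "bilinear_map R (free_module R B) (free_module R C) M c" and M: "module R M"
    and eq: "\<And>F G. F \<in> B \<Longrightarrow> G \<in> C \<Longrightarrow> b (basis_vec R F) (basis_vec R G) = c (basis_vec R F) (basis_vec R G)"
    and x: "x \<in> carrier (free_module R B)" and y: "y \<in> carrier (free_module R C)"
  shows "b x y = c x y"
proof (rule linear_map_eq_on_basis[OF bilinear_mapD(2)[OF b y] bilinear_mapD(2)[OF c y] M _ x])
  fix F assume F: "F \<in> B"
  show "b (basis_vec R F) y = c (basis_vec R F) y"
    by (rule linear_map_eq_on_basis[OF bilinear_mapD(1)[OF b] bilinear_mapD(1)[OF c] M _ y])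
      (auto intro: basis_vec_closed F eq)
qed

context cring begin

lemma concat_mult_bilinear:
  assumes "\<And>F G. F \<in> B \<Longrightarrow> G \<in> C \<Longrightarrow> F @ G \<in> D"
  shows "bilinear_map R (free_module R B) (free_module R C) (free_module R D)
    (concat_mult R (free_module R D))"
proof -
  have lin: "linear_map R (free_module R C) (free_module R D)
      (lin_ext R (free_module R D) (\<lambda>G. basis_vec R (F @ G)))" if "F \<in> B" for F
    using that assms by (intro lin_ext_linear free_module_module) (auto intro: basis_vec_closed)
  show ?thesis
    unfolding concat_mult_def
  proof (rule bilinear_mapI)
    show "linear_map R (free_module R B) (free_module R D) (\<lambda>f. lin_ext R (free_module R D)
        (\<lambda>F. lin_ext R (free_module R D) (\<lambda>G. basis_vec R (F @ G)) g) f)"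
      if "g \<in> carrier (free_module R C)" for g
      using linear_mapD(1)[OF lin] that by (intro lin_ext_linear free_module_module) auto
    show "linear_map R (free_module R C) (free_module R D) (\<lambda>g. lin_ext R (free_module R D)
        (\<lambda>F. lin_ext R (free_module R D) (\<lambda>G. basis_vec R (F @ G)) g) f)"
      if "f \<in> carrier (free_module R B)" for f
      using that by (intro lin_ext_values_linear[OF free_module_module free_module_module lin])
  qed
qed

lemma concat_mult_basis:
  assumes "F @ G \<in> D"
  shows "concat_mult R (free_module R D) (basis_vec R F) (basis_vec R G) = basis_vec R (F @ G)"
proof -
  have "lin_ext R (free_module R D) (\<lambda>G. basis_vec R (F @ G)) (basis_vec R G) = basis_vec R (F @ G)"
    using assms by (intro lin_ext_basis free_module_module basis_vec_closed)
  moreover from this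
  have "concat_mult R (free_module R D) (basis_vec R F) (basis_vec R G)
      = lin_ext R (free_module R D) (\<lambda>G. basis_vec R (F @ G)) (basis_vec R G)"
    unfolding concat_mult_def
    using assms by (intro lin_ext_basis free_module_module) (simp add: basis_vec_closed)
  ultimately show ?thesis by simp
qed

lemma concat_mult_assoc:
  assumes BC: "\<And>F G. F \<in> B \<Longrightarrow> G \<in> C \<Longrightarrow> F @ G \<in> BC"
    and CD: "\<And>F G. F \<in> C \<Longrightarrow> G \<in> D \<Longrightarrow> F @ G \<in> CD"
    and left: "\<And>F G. F \<in> BC \<Longrightarrow> G \<in> D \<Longrightarrow> F @ G \<in> BCD"
    and right: "\<And>F G. F \<in> B \<Longrightarrow> G \<in> CD \<Longrightarrow> F @ G \<in> BCD"
    and x: "x \<in> carrier (free_module R B)" and y: "y \<in> carrier (free_module R C)"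
    and z: "z \<in> carrier (free_module R D)"
  shows "concat_mult R (free_module R BCD) (concat_mult R (free_module R BC) x y) z
       = concat_mult R (free_module R BCD) x (concat_mult R (free_module R CD) y z)"
proof -
  note b = concat_mult_bilinear[OF BC] concat_mult_bilinear[OF CD]
    concat_mult_bilinear[OF left] concat_mult_bilinear[OF right]
  have id: "linear_map R M M (\<lambda>x. x)" for M :: "('a, 'd) module"
    by (simp add: linear_map_def)
  have l: "bilinear_map R (free_module R B) (free_module R C) (free_module R BCD)
      (\<lambda>x y. concat_mult R (free_module R BCD) (concat_mult R (free_module R BC) x y) z)"
    if "z \<in> carrier (free_module R D)" for z
    by (rule bilinear_map_comp_outer[OF b(1) bilinear_mapD(2)[OF b(3) that]])
  have r: "bilinear_map R (free_module R B) (free_module R C) (free_module R BCD)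
      (\<lambda>x y. concat_mult R (free_module R BCD) x (concat_mult R (free_module R CD) y z))"
    if "z \<in> carrier (free_module R D)" for z
    by (rule bilinear_map_comp_inner[OF b(4) id bilinear_mapD(2)[OF b(2) that]])
  show ?thesis
  proof (rule bilinear_map_eq_on_basis[OF l[OF z] r[OF z] free_module_module _ x y])
    fix F G assume F: "F \<in> B" and G: "G \<in> C"
    note bF = basis_vec_closed[OF F] and bG = basis_vec_closed[OF G]
    show "concat_mult R (free_module R BCD) (concat_mult R (free_module R BC) (basis_vec R F) (basis_vec R G)) z
       = concat_mult R (free_module R BCD) (basis_vec R F) (concat_mult R (free_module R CD) (basis_vec R G) z)"
    proof (rule linear_map_eq_on_basis[OF _ _ free_module_module _ z])
      show "linear_map R (free_module R D) (free_module R BCD)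
        (concat_mult R (free_module R BCD) (concat_mult R (free_module R BC) (basis_vec R F) (basis_vec R G)))"
        by (rule bilinear_mapD(1)[OF b(3) bilinear_mapD(3)[OF b(1) bF bG]])
      show "linear_map R (free_module R D) (free_module R BCD)
        (\<lambda>z. concat_mult R (free_module R BCD) (basis_vec R F) (concat_mult R (free_module R CD) (basis_vec R G) z))"
        by (rule linear_map_comp[OF bilinear_mapD(1)[OF b(2) bG] bilinear_mapD(1)[OF b(4) bF]])
    qed (simp add: concat_mult_basis F G BC CD left right[OF F CD[OF G], simplified])
  qed
qed

end


section \<open>Quotient modules\<close>

lemma submodule_abelian_subgroup:
  assumes "submodule N R M" "module R M"
  shows "abelian_subgroup N M"
  using assms
  by (intro abelian_subgroupI3 additive_subgroupI) (auto simp: submodule_def module_def)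

lemma coset_eq_iff:
  assumes N: "submodule N R M" and M: "module R M" and x: "x \<in> carrier M" and y: "y \<in> carrier M"
  shows "N +>\<^bsub>M\<^esub> x = N +>\<^bsub>M\<^esub> y \<longleftrightarrow> x \<ominus>\<^bsub>M\<^esub> y \<in> N"
proof -
  interpret abelian_subgroup N M by (rule submodule_abelian_subgroup[OF N M])
  show ?thesis
    using a_repr_independence'[OF _ y] a_repr_independenceD[OF x] a_rcos_module[OF y x]
    unfolding a_minus_def by metis
qed

lemma coset_zero:
  assumes N: "submodule N R M" and M: "module R M" and x: "x \<in> N"
  shows "N +>\<^bsub>M\<^esub> x = N"
  by (rule abelian_subgroup.a_rcos_const[OF submodule_abelian_subgroup[OF N M] x])

lemma coset_self:
  assumes N: "submodule N R M" and M: "module R M" and x: "x \<in> carrier M"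
  shows "x \<in> N +>\<^bsub>M\<^esub> x"
  by (rule abelian_subgroup.a_rcos_self[OF submodule_abelian_subgroup[OF N M] x])

lemma coset_mem:
  assumes N: "submodule N R M" and M: "module R M" and x: "x \<in> carrier M"
    and y: "y \<in> N +>\<^bsub>M\<^esub> x"
  shows "y \<in> carrier M" "y \<ominus>\<^bsub>M\<^esub> x \<in> N"
proof -
  interpret abelian_subgroup N M by (rule submodule_abelian_subgroup[OF N M])
  show "y \<in> carrier M" by (rule a_elemrcos_carrier[OF x y])
  show "y \<ominus>\<^bsub>M\<^esub> x \<in> N" using a_rcos_module_imp[OF x y] unfolding a_minus_def .
qed

lemma quot_module_carrier: "carrier (quot_module M N) = (\<lambda>x. N +>\<^bsub>M\<^esub> x) ` carrier M"
  by (auto simp: quot_module_def A_RCOSETS_def')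

lemma quot_module_zero: "\<zero>\<^bsub>quot_module M N\<^esub> = N"
  by (simp add: quot_module_def)

lemma quot_module_add:
  assumes N: "submodule N R M" and M: "module R M" and x: "x \<in> carrier M" and y: "y \<in> carrier M"
  shows "(N +>\<^bsub>M\<^esub> x) \<oplus>\<^bsub>quot_module M N\<^esub> (N +>\<^bsub>M\<^esub> y) = N +>\<^bsub>M\<^esub> (x \<oplus>\<^bsub>M\<^esub> y)"
  using abelian_subgroup.a_rcos_sum[OF submodule_abelian_subgroup[OF N M] x y]
  by (simp add: quot_module_def)

text \<open>Two representatives differ by a relation, whose image is a relation, so the union has one member.\<close>

lemma coset_map_coset:
  assumes M: "module R M" and N: "submodule N R M" and M': "module R M'" and N': "submodule N' R M'"
    and f: "linear_map R M M' f" and fN: "\<And>n. n \<in> N \<Longrightarrow> f n \<in> N'" and x: "x \<in> carrier M"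
  shows "coset_map M' N' f (N +>\<^bsub>M\<^esub> x) = N' +>\<^bsub>M'\<^esub> f x"
proof -
  have "N' +>\<^bsub>M'\<^esub> f y = N' +>\<^bsub>M'\<^esub> f x" if "y \<in> N +>\<^bsub>M\<^esub> x" for y
    using coset_mem[OF N M x that] linear_map_minus[OF f M M' coset_mem(1)[OF N M x that] x]
      fN[OF coset_mem(2)[OF N M x that]] x linear_mapD(1)[OF f]
    by (subst coset_eq_iff[OF N' M']) auto
  then show ?thesis
    using coset_self[OF N M x] unfolding coset_map_def by blast
qed

text \<open>
  The two representatives are changed one after the other; each change moves the value by an
  element of \<open>K\<close>.
\<close>

lemma coset_map2_coset:
  assumes M: "module R M" and N: "submodule N R M" and M': "module R M'" and N': "submodule N' R M'"
    and P: "module R P" and K: "submodule K R P" and b: "bilinear_map R M M' P b"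
    and bl: "\<And>n y. n \<in> N \<Longrightarrow> y \<in> carrier M' \<Longrightarrow> b n y \<in> K"
    and br: "\<And>x n. x \<in> carrier M \<Longrightarrow> n \<in> N' \<Longrightarrow> b x n \<in> K"
    and x: "x \<in> carrier M" and y: "y \<in> carrier M'"
  shows "coset_map2 P K b (N +>\<^bsub>M\<^esub> x) (N' +>\<^bsub>M'\<^esub> y) = K +>\<^bsub>P\<^esub> b x y"
proof -
  have "K +>\<^bsub>P\<^esub> b x' y' = K +>\<^bsub>P\<^esub> b x y" if "x' \<in> N +>\<^bsub>M\<^esub> x" "y' \<in> N' +>\<^bsub>M'\<^esub> y" for x' y'
  proof -
    note x' = coset_mem[OF N M x that(1)] and y' = coset_mem[OF N' M' y that(2)]
    have "b x' y' \<ominus>\<^bsub>P\<^esub> b x y' \<in> K"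
      using linear_map_minus[OF bilinear_mapD(2)[OF b y'(1)] M P x'(1) x] bl[OF x'(2) y'(1)] by simp
    then have "K +>\<^bsub>P\<^esub> b x' y' = K +>\<^bsub>P\<^esub> b x y'"
      using x x' y' by (subst coset_eq_iff[OF K P]) (auto intro: bilinear_mapD(3)[OF b])
    moreover have "b x y' \<ominus>\<^bsub>P\<^esub> b x y \<in> K"
      using linear_map_minus[OF bilinear_mapD(1)[OF b x] M' P y'(1) y] br[OF x y'(2)] by simp
    then have "K +>\<^bsub>P\<^esub> b x y' = K +>\<^bsub>P\<^esub> b x y"
      using x y y' by (subst coset_eq_iff[OF K P]) (auto intro: bilinear_mapD(3)[OF b])
    ultimately show ?thesis by simp
  qed
  then show ?thesis
    using coset_self[OF N M x] coset_self[OF N' M' y] unfolding coset_map2_def by blast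
qed

lemma smult_linear:
  assumes M: "module R M" and r: "r \<in> carrier R"
  shows "linear_map R M M (\<lambda>x. r \<odot>\<^bsub>M\<^esub> x)"
proof -
  interpret M: module R M by fact
  show ?thesis
    using r by (intro linear_mapI)
      (auto simp: M.smult_r_distr M.smult_assoc1[symmetric] M.m_comm)
qed

lemma quot_module_smult:
  assumes N: "submodule N R M" and M: "module R M" and x: "x \<in> carrier M" and r: "r \<in> carrier R"
  shows "r \<odot>\<^bsub>quot_module M N\<^esub> (N +>\<^bsub>M\<^esub> x) = N +>\<^bsub>M\<^esub> (r \<odot>\<^bsub>M\<^esub> x)"
  using coset_map_coset[OF M N M N smult_linear[OF M r] _ x] submoduleD(6)[OF N M r]
  by (simp add: quot_module_def)

lemma quot_module_module:
  assumes N: "submodule N R M" and M: "module R M"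
  shows "module R (quot_module M N)"
proof -
  interpret M: module R M by fact
  note simps = quot_module_carrier quot_module_add[OF N M] quot_module_smult[OF N M]
  have zero: "\<zero>\<^bsub>quot_module M N\<^esub> = N +>\<^bsub>M\<^esub> \<zero>\<^bsub>M\<^esub>"
    using coset_zero[OF N M submoduleD(2)[OF N M]] by (simp add: quot_module_zero)
  show ?thesis
  proof (intro moduleI abelian_groupI)
    fix X assume "X \<in> carrier (quot_module M N)"
    then obtain x where x: "x \<in> carrier M" "X = N +>\<^bsub>M\<^esub> x" by (auto simp: simps)
    then show "\<exists>Y\<in>carrier (quot_module M N). Y \<oplus>\<^bsub>quot_module M N\<^esub> X = \<zero>\<^bsub>quot_module M N\<^esub>"
      by (intro bexI[of _ "N +>\<^bsub>M\<^esub> (\<ominus>\<^bsub>M\<^esub> x)"]) (auto simp: simps zero M.l_neg)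
    show "\<zero>\<^bsub>quot_module M N\<^esub> \<oplus>\<^bsub>quot_module M N\<^esub> X = X"
      unfolding zero using x by (simp add: simps)
  next
    show "\<zero>\<^bsub>quot_module M N\<^esub> \<in> carrier (quot_module M N)" by (auto simp: simps zero)
  next
    fix X Y assume "X \<in> carrier (quot_module M N)" "Y \<in> carrier (quot_module M N)"
    then show "X \<oplus>\<^bsub>quot_module M N\<^esub> Y = Y \<oplus>\<^bsub>quot_module M N\<^esub> X"
      using M.a_comm by (auto simp: simps)
  qed (auto simp: simps M.a_assoc M.smult_l_distr M.smult_r_distr M.smult_assoc1 M.R.is_cring)
qed

lemma coset_map_linear:
  assumes M: "module R M" and N: "submodule N R M" and M': "module R M'" and N': "submodule N' R M'"
    and f: "linear_map R M M' f" and fN: "\<And>n. n \<in> N \<Longrightarrow> f n \<in> N'"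
  shows "linear_map R (quot_module M N) (quot_module M' N') (coset_map M' N' f)"
proof -
  interpret M: module R M by fact
  show ?thesis
    using linear_mapD[OF f]
    by (intro linear_mapI)
      (auto simp: quot_module_carrier quot_module_add[OF N M] quot_module_smult[OF N M]
        quot_module_add[OF N' M'] quot_module_smult[OF N' M'] coset_map_coset[OF assms])
qed

lemma coset_map2_bilinear:
  assumes M: "module R M" and N: "submodule N R M" and M': "module R M'" and N': "submodule N' R M'"
    and P: "module R P" and K: "submodule K R P" and b: "bilinear_map R M M' P b"
    and bl: "\<And>n y. n \<in> N \<Longrightarrow> y \<in> carrier M' \<Longrightarrow> b n y \<in> K"
    and br: "\<And>x n. x \<in> carrier M \<Longrightarrow> n \<in> N' \<Longrightarrow> b x n \<in> K"
  shows "bilinear_map R (quot_module M N) (quot_module M' N') (quot_module P K) (coset_map2 P K b)"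
proof -
  interpret M: module R M by fact
  interpret M': module R M' by fact
  note simps = quot_module_carrier quot_module_add[OF N M] quot_module_smult[OF N M]
    quot_module_add[OF N' M'] quot_module_smult[OF N' M'] quot_module_add[OF K P]
    quot_module_smult[OF K P] coset_map2_coset[OF assms] bilinear_mapD(3)[OF b]
    linear_mapD(2,3)[OF bilinear_mapD(1)[OF b]] linear_mapD(2,3)[OF bilinear_mapD(2)[OF b]]
  show ?thesis
    by (intro bilinear_mapI linear_mapI) (auto simp: simps)
qed


section \<open>Modules concentrated in one degree\<close>

lemma concentrated_module:
  assumes M: "module R M"
  shows "module R (concentrated d M n)"
proof -
  interpret M: module R M by fact
  have "submodule {\<zero>\<^bsub>M\<^esub>} R M" by (rule M.submoduleI) auto
  then show ?thesis
    using submodule.submodule_is_module M unfolding concentrated_def by auto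
qed

lemma concentrated_subset:
  assumes "module R M"
  shows "carrier (concentrated d M n) \<subseteq> carrier M"
proof -
  interpret M: module R M by fact
  show ?thesis by (simp add: concentrated_def)
qed

lemma concentrated_simps:
  "\<zero>\<^bsub>concentrated d M n\<^esub> = \<zero>\<^bsub>M\<^esub>"
  "x \<oplus>\<^bsub>concentrated d M n\<^esub> y = x \<oplus>\<^bsub>M\<^esub> y"
  "r \<odot>\<^bsub>concentrated d M n\<^esub> x = r \<odot>\<^bsub>M\<^esub> x"
  by (simp_all add: concentrated_def)

lemma concentrated_linear:
  assumes M: "module R M" and N: "module R N" and f: "linear_map R M N f"
  shows "linear_map R (concentrated d M n) (concentrated d N n) f"
proof (rule linear_mapI)
  fix x assume x: "x \<in> carrier (concentrated d M n)"
  then show "f x \<in> carrier (concentrated d N n)"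
    using linear_map_zero[OF f M N] linear_mapD(1)[OF f]
    by (auto simp: concentrated_def split: if_splits)
qed (use concentrated_subset[OF M, of d n] linear_mapD[OF f] in \<open>auto simp: concentrated_simps subset_iff\<close>)

text \<open>
  Unless \<open>m = d\<close> and \<open>n = e\<close>, one of the factors is zero, hence so is the product. This is needed
  because the target is the zero module for \<open>m + n \<noteq> d + e\<close>.
\<close>

lemma concentrated_bilinear:
  assumes M: "module R M" and N: "module R N" and P: "module R P" and b: "bilinear_map R M N P b"
  shows "bilinear_map R (concentrated d M m) (concentrated e N n) (concentrated (d + e) P (m + n)) b"
proof -
  have mem: "b x y \<in> carrier (concentrated (d + e) P (m + n))"
    if "x \<in> carrier (concentrated d M m)" "y \<in> carrier (concentrated e N n)" for x y
  proof (cases "m = d \<and> n = e")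
    case True
    then show ?thesis using that bilinear_mapD(3)[OF b] by (simp add: concentrated_def)
  next
    case False
    then have "x = \<zero>\<^bsub>M\<^esub> \<or> y = \<zero>\<^bsub>N\<^esub>"
      using that by (auto simp: concentrated_def split: if_splits)
    then have "b x y = \<zero>\<^bsub>concentrated (d + e) P (m + n)\<^esub>"
      using that concentrated_subset[OF M] concentrated_subset[OF N] bilinear_map_zero[OF b M N P]
      by (auto simp: concentrated_simps subset_iff)
    then show ?thesis
      using module.axioms(2)[OF concentrated_module[OF P]] abelian_group.axioms(1)
        abelian_monoid.zero_closed by metis
  qed
  show ?thesis
    using mem concentrated_subset[OF M, of d m] concentrated_subset[OF N, of e n]
      linear_mapD(2,3)[OF bilinear_mapD(1)[OF b]] linear_mapD(2,3)[OF bilinear_mapD(2)[OF b]]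
    by (intro bilinear_mapI linear_mapI) (auto simp: concentrated_simps subset_iff)
qed


section \<open>Algebras in species presented by words\<close>

text \<open>
  The words on \<open>I\<close> are \<open>B I\<close>, the relations among them are \<open>N I\<close>, and a bijection \<open>\<sigma>\<close> of \<open>I\<close> onto
  its image acts on letters by \<open>h I \<sigma>\<close>. The set \<open>I\<close> is an argument of \<open>h\<close> because letters may be
  vectors, and the linear map that \<open>\<sigma>\<close> induces on them is formed in the free module on \<open>\<sigma> ` I\<close>;
  \<open>h_restrict\<close> says that this choice has no effect. The relations need to absorb only single
  words, from either side: the closure under arbitrary products follows by linearity.
\<close>

locale word_presentation = cring R
  for R :: "('k, 'r) ring_scheme" (structure) +
  fixes B :: "'a set \<Rightarrow> 'b list set"
    and N :: "'a set \<Rightarrow> ('b list \<Rightarrow> 'k) set"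
    and h :: "'a set \<Rightarrow> ('a \<Rightarrow> 'a) \<Rightarrow> 'b \<Rightarrow> 'b"
  assumes B_Nil: "[] \<in> B {}"
    and B_append: "\<lbrakk>finite S; finite T; S \<inter> T = {}; F \<in> B S; G \<in> B T\<rbrakk> \<Longrightarrow> F @ G \<in> B (S \<union> T)"
    and B_map: "\<lbrakk>finite I; inj_on \<sigma> I; F \<in> B I\<rbrakk> \<Longrightarrow> map (h I \<sigma>) F \<in> B (\<sigma> ` I)"
    and h_cong: "\<lbrakk>finite I; inj_on \<sigma> I; \<And>i. i \<in> I \<Longrightarrow> \<sigma> i = \<tau> i; F \<in> B I; b \<in> set F\<rbrakk> \<Longrightarrow>
      h I \<sigma> b = h I \<tau> b"
    and h_id: "\<lbrakk>finite I; F \<in> B I; b \<in> set F\<rbrakk> \<Longrightarrow> h I id b = b"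
    and h_comp: "\<lbrakk>finite I; inj_on \<sigma> I; inj_on \<tau> (\<sigma> ` I); F \<in> B I; b \<in> set F\<rbrakk> \<Longrightarrow>
      h I (\<tau> \<circ> \<sigma>) b = h (\<sigma> ` I) \<tau> (h I \<sigma> b)"
    and h_restrict: "\<lbrakk>finite I; inj_on \<sigma> I; S \<subseteq> I; F \<in> B S; b \<in> set F\<rbrakk> \<Longrightarrow>
      h I \<sigma> b = h S \<sigma> b"
    and N_submodule: "finite I \<Longrightarrow> submodule (N I) R (free_module R (B I))"
    and N_append_left: "\<lbrakk>finite S; finite T; S \<inter> T = {}; x \<in> N S; G \<in> B T\<rbrakk> \<Longrightarrow>
      concat_mult R (free_module R (B (S \<union> T))) x (basis_vec R G) \<in> N (S \<union> T)"
    and N_append_right: "\<lbrakk>finite S; finite T; S \<inter> T = {}; F \<in> B S; y \<in> N T\<rbrakk> \<Longrightarrow>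
      concat_mult R (free_module R (B (S \<union> T))) (basis_vec R F) y \<in> N (S \<union> T)"
    and N_map: "\<lbrakk>finite I; inj_on \<sigma> I; x \<in> N I\<rbrakk> \<Longrightarrow>
      lin_ext R (free_module R (B (\<sigma> ` I))) (\<lambda>F. basis_vec R (map (h I \<sigma>) F)) x \<in> N (\<sigma> ` I)"
begin

abbreviation P :: "'a set \<Rightarrow> ('k, 'b list \<Rightarrow> 'k) module" where
  "P I \<equiv> free_module R (B I)"

abbreviation Q :: "'a set \<Rightarrow> ('k, ('b list \<Rightarrow> 'k) set) module" where
  "Q I \<equiv> quot_module (P I) (N I)"

abbreviation relabel :: "'a set \<Rightarrow> ('a \<Rightarrow> 'a) \<Rightarrow> ('b list \<Rightarrow> 'k) \<Rightarrow> 'b list \<Rightarrow> 'k" where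
  "relabel I \<sigma> \<equiv> lin_ext R (P (\<sigma> ` I)) (\<lambda>F. basis_vec R (map (h I \<sigma>) F))"

abbreviation qrelabel where
  "qrelabel I \<sigma> \<equiv> coset_map (P (\<sigma> ` I)) (N (\<sigma> ` I)) (relabel I \<sigma>)"

abbreviation qmult where
  "qmult S T \<equiv> coset_map2 (P (S \<union> T)) (N (S \<union> T)) (concat_mult R (P (S \<union> T)))"

lemma Q_module: "finite I \<Longrightarrow> module R (Q I)"
  by (intro quot_module_module N_submodule free_module_module)

lemma relabel_linear:
  assumes "finite I" "inj_on \<sigma> I"
  shows "linear_map R (P I) (P (\<sigma> ` I)) (relabel I \<sigma>)"
  using assms by (intro lin_ext_linear free_module_module) (auto intro: basis_vec_closed B_map)

lemma relabel_basis:
  assumes "finite I" "inj_on \<sigma> I" "F \<in> B I"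
  shows "relabel I \<sigma> (basis_vec R F) = basis_vec R (map (h I \<sigma>) F)"
  using assms by (intro lin_ext_basis free_module_module basis_vec_closed B_map)

lemma concat_bilinear:
  assumes "finite S" "finite T" "S \<inter> T = {}"
  shows "bilinear_map R (P S) (P T) (P (S \<union> T)) (concat_mult R (P (S \<union> T)))"
  using assms by (intro concat_mult_bilinear B_append)

lemma concat_N_left:
  assumes fin: "finite S" "finite T" "S \<inter> T = {}" and x: "x \<in> N S" and y: "y \<in> carrier (P T)"
  shows "concat_mult R (P (S \<union> T)) x y \<in> N (S \<union> T)"
proof -
  have x': "x \<in> carrier (P S)" using submoduleD(1)[OF N_submodule free_module_module] fin x by blast
  have "y \<in> {y \<in> carrier (P T). concat_mult R (P (S \<union> T)) x y \<in> N (S \<union> T)}"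
    by (rule free_module_induct[OF linear_map_vimage_submodule[OF
          bilinear_mapD(1)[OF concat_bilinear[OF fin] x'] free_module_module free_module_module N_submodule] _ y])
      (use fin x in \<open>auto intro: basis_vec_closed N_append_left\<close>)
  then show ?thesis by simp
qed

lemma concat_N_right:
  assumes fin: "finite S" "finite T" "S \<inter> T = {}" and x: "x \<in> carrier (P S)" and y: "y \<in> N T"
  shows "concat_mult R (P (S \<union> T)) x y \<in> N (S \<union> T)"
proof -
  have y': "y \<in> carrier (P T)" using submoduleD(1)[OF N_submodule free_module_module] fin y by blast
  have "x \<in> {x \<in> carrier (P S). concat_mult R (P (S \<union> T)) x y \<in> N (S \<union> T)}"
    by (rule free_module_induct[OF linear_map_vimage_submodule[OF
          bilinear_mapD(2)[OF concat_bilinear[OF fin] y'] free_module_module free_module_module N_submodule] _ x])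
      (use fin y in \<open>auto intro: basis_vec_closed N_append_right\<close>)
  then show ?thesis by simp
qed

lemma qmult_coset:
  assumes "finite S" "finite T" "S \<inter> T = {}" "x \<in> carrier (P S)" "y \<in> carrier (P T)"
  shows "qmult S T (N S +>\<^bsub>P S\<^esub> x) (N T +>\<^bsub>P T\<^esub> y)
    = N (S \<union> T) +>\<^bsub>P (S \<union> T)\<^esub> concat_mult R (P (S \<union> T)) x y"
  using assms
  by (intro coset_map2_coset[OF free_module_module N_submodule free_module_module N_submodule
        free_module_module N_submodule concat_bilinear concat_N_left concat_N_right]) auto

lemma qmult_bilinear:
  assumes "finite S" "finite T" "S \<inter> T = {}"
  shows "bilinear_map R (Q S) (Q T) (Q (S \<union> T)) (qmult S T)"
  using assms
  by (intro coset_map2_bilinear[OF free_module_module N_submodule free_module_module N_submodule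
        free_module_module N_submodule concat_bilinear concat_N_left concat_N_right]) auto

lemma qrelabel_coset:
  assumes "finite I" "inj_on \<sigma> I" "x \<in> carrier (P I)"
  shows "qrelabel I \<sigma> (N I +>\<^bsub>P I\<^esub> x) = N (\<sigma> ` I) +>\<^bsub>P (\<sigma> ` I)\<^esub> relabel I \<sigma> x"
  using assms
  by (intro coset_map_coset[OF free_module_module N_submodule free_module_module N_submodule
        relabel_linear N_map]) auto

lemma qrelabel_linear:
  assumes "finite I" "inj_on \<sigma> I"
  shows "linear_map R (Q I) (Q (\<sigma> ` I)) (qrelabel I \<sigma>)"
  using assms
  by (intro coset_map_linear[OF free_module_module N_submodule free_module_module N_submodule
        relabel_linear N_map]) auto

lemma Q_cases:
  assumes "X \<in> carrier (Q I)"
  obtains x where "x \<in> carrier (P I)" "X = N I +>\<^bsub>P I\<^esub> x"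
  using assms by (auto simp: quot_module_carrier)

lemma relabel_cong:
  assumes "finite I" "inj_on \<sigma> I" "\<And>i. i \<in> I \<Longrightarrow> \<sigma> i = \<tau> i" "x \<in> carrier (P I)"
  shows "relabel I \<sigma> x = relabel I \<tau> x"
proof -
  have im: "\<sigma> ` I = \<tau> ` I" and inj: "inj_on \<tau> I"
    using assms(2,3) by (auto simp: inj_on_def cong: image_cong)
  have "map (h I \<sigma>) F = map (h I \<tau>) F" if "F \<in> B I" for F
    using assms(1-3) that by (auto intro: h_cong)
  then have basis: "relabel I \<sigma> (basis_vec R F) = relabel I \<tau> (basis_vec R F)" if "F \<in> B I" for F
    using relabel_basis[OF assms(1,2) that] relabel_basis[OF assms(1) inj that] that by (simp only:)
  have "linear_map R (P I) (P (\<sigma> ` I)) (relabel I \<tau>)"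
    using relabel_linear[OF assms(1) inj] by (simp add: im)
  then show ?thesis
    by (rule linear_map_eq_on_basis[OF relabel_linear[OF assms(1,2)] _ free_module_module basis assms(4)])
qed

lemma relabel_id:
  assumes "finite I" "x \<in> carrier (P I)"
  shows "relabel I id x = x"
proof (rule linear_map_eq_on_basis[OF _ _ free_module_module _ assms(2)])
  show "linear_map R (P I) (P I) (relabel I id)" using relabel_linear[of I id] assms by simp
  show "linear_map R (P I) (P I) (\<lambda>x. x)" by (simp add: linear_map_def)
  fix F assume F: "F \<in> B I"
  then have "map (h I id) F = F" using assms by (auto intro!: map_idI h_id)
  then show "relabel I id (basis_vec R F) = basis_vec R F"
    using relabel_basis[of I id F] assms F by simp
qed

lemma relabel_comp:
  assumes "finite I" "inj_on \<sigma> I" "inj_on \<tau> (\<sigma> ` I)" "x \<in> carrier (P I)"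
  shows "relabel I (\<tau> \<circ> \<sigma>) x = relabel (\<sigma> ` I) \<tau> (relabel I \<sigma> x)"
proof (rule linear_map_eq_on_basis[OF _ _ free_module_module _ assms(4)])
  have inj: "inj_on (\<tau> \<circ> \<sigma>) I" using assms comp_inj_on by blast
  show "linear_map R (P I) (P (\<tau> ` \<sigma> ` I)) (relabel I (\<tau> \<circ> \<sigma>))"
    using relabel_linear[OF assms(1) inj] by (simp add: image_comp)
  show "linear_map R (P I) (P (\<tau> ` \<sigma> ` I)) (\<lambda>x. relabel (\<sigma> ` I) \<tau> (relabel I \<sigma> x))"
    using assms by (intro linear_map_comp[OF relabel_linear relabel_linear]) auto
  fix F assume F: "F \<in> B I"
  have "map (h I (\<tau> \<circ> \<sigma>)) F = map (h (\<sigma> ` I) \<tau>) (map (h I \<sigma>) F)"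
    using assms F by (auto intro: h_comp)
  then show "relabel I (\<tau> \<circ> \<sigma>) (basis_vec R F) = relabel (\<sigma> ` I) \<tau> (relabel I \<sigma> (basis_vec R F))"
    using relabel_basis[OF assms(1) inj F] relabel_basis[OF assms(1,2) F]
      relabel_basis[OF finite_imageI[OF assms(1)] assms(3) B_map[OF assms(1,2) F]]
    by (simp only:)
qed

lemma relabel_concat:
  assumes fin: "finite S" "finite T" "S \<inter> T = {}" and inj: "inj_on \<sigma> (S \<union> T)"
    and x: "x \<in> carrier (P S)" and y: "y \<in> carrier (P T)"
  shows "relabel (S \<union> T) \<sigma> (concat_mult R (P (S \<union> T)) x y)
    = concat_mult R (P (\<sigma> ` S \<union> \<sigma> ` T)) (relabel S \<sigma> x) (relabel T \<sigma> y)"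
proof (rule bilinear_map_eq_on_basis[OF _ _ free_module_module _ x y])
  have injS: "inj_on \<sigma> S" and injT: "inj_on \<sigma> T" using inj by (auto intro: inj_on_subset)
  have disj: "\<sigma> ` S \<inter> \<sigma> ` T = {}" using inj fin(3) by (auto simp: inj_on_def)
  have finI: "finite (S \<union> T)" using fin by simp
  show "bilinear_map R (P S) (P T) (P (\<sigma> ` (S \<union> T)))
      (\<lambda>x y. relabel (S \<union> T) \<sigma> (concat_mult R (P (S \<union> T)) x y))"
    by (rule bilinear_map_comp_outer[OF concat_bilinear[OF fin] relabel_linear[OF finI inj]])
  show "bilinear_map R (P S) (P T) (P (\<sigma> ` (S \<union> T)))
      (\<lambda>x y. concat_mult R (P (\<sigma> ` S \<union> \<sigma> ` T)) (relabel S \<sigma> x) (relabel T \<sigma> y))"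
    unfolding image_Un using fin disj injS injT
    by (intro bilinear_map_comp_inner[OF concat_bilinear relabel_linear relabel_linear]) auto
  fix F G assume F: "F \<in> B S" and G: "G \<in> B T"
  have FG: "F @ G \<in> B (S \<union> T)" using B_append fin F G by blast
  have eq: "map (h (S \<union> T) \<sigma>) (F @ G) = map (h S \<sigma>) F @ map (h T \<sigma>) G"
    using h_restrict[OF finI inj _ F] h_restrict[OF finI inj _ G] by auto
  have "map (h S \<sigma>) F @ map (h T \<sigma>) G \<in> B (\<sigma> ` S \<union> \<sigma> ` T)"
    using fin disj F G injS injT by (intro B_append B_map) auto
  then have "concat_mult R (P (\<sigma> ` S \<union> \<sigma> ` T)) (basis_vec R (map (h S \<sigma>) F))
      (basis_vec R (map (h T \<sigma>) G)) = basis_vec R (map (h S \<sigma>) F @ map (h T \<sigma>) G)"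
    by (rule concat_mult_basis)
  then show "relabel (S \<union> T) \<sigma> (concat_mult R (P (S \<union> T)) (basis_vec R F) (basis_vec R G))
    = concat_mult R (P (\<sigma> ` S \<union> \<sigma> ` T)) (relabel S \<sigma> (basis_vec R F)) (relabel T \<sigma> (basis_vec R G))"
    using concat_mult_basis[OF FG] relabel_basis[OF finI inj FG] relabel_basis[OF fin(1) injS F]
      relabel_basis[OF fin(2) injT G] eq by (simp only:)
qed

lemma concat_Nil:
  assumes "finite S" "x \<in> carrier (P S)"
  shows "concat_mult R (P S) (basis_vec R []) x = x" "concat_mult R (P S) x (basis_vec R []) = x"
proof -
  have id: "linear_map R (P S) (P S) (\<lambda>x. x)" by (simp add: linear_map_def)
  have bN: "basis_vec R [] \<in> carrier (P {})" by (intro basis_vec_closed B_Nil)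
  have l: "linear_map R (P S) (P S) (concat_mult R (P S) (basis_vec R []))"
    using bilinear_mapD(1)[OF concat_bilinear[of "{}" S] bN] assms by simp
  have r: "linear_map R (P S) (P S) (\<lambda>x. concat_mult R (P S) x (basis_vec R []))"
    using bilinear_mapD(2)[OF concat_bilinear[of S "{}"] bN] assms by simp
  show "concat_mult R (P S) (basis_vec R []) x = x"
    by (rule linear_map_eq_on_basis[OF l id free_module_module _ assms(2)])
      (simp add: concat_mult_basis)
  show "concat_mult R (P S) x (basis_vec R []) = x"
    by (rule linear_map_eq_on_basis[OF r id free_module_module _ assms(2)])
      (simp add: concat_mult_basis)
qed

end

text \<open>
  The equations are required only on elements of the components. The operations of a concrete
  algebra may be given by other formulas elsewhere, as for the desuspension, whose product
  carries a sign.
\<close>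

locale presented_algebra = word_presentation R B N h
  for R :: "('k, 'r) ring_scheme" (structure)
    and B :: "'a set \<Rightarrow> 'b list set" and N h +
  fixes X :: "('k, 'a, ('b list \<Rightarrow> 'k) set) species_algebra"
  assumes obj_eq: "finite I \<Longrightarrow> obj X I n = concentrated (int (card I)) (Q I) n"
    and act_eq: "\<lbrakk>finite I; inj_on \<sigma> I; x \<in> carrier (obj X I n)\<rbrakk> \<Longrightarrow> act X I n \<sigma> x = qrelabel I \<sigma> x"
    and mul_eq: "\<lbrakk>finite S; finite T; S \<inter> T = {}; x \<in> carrier (obj X S m); y \<in> carrier (obj X T n)\<rbrakk> \<Longrightarrow>
      mul X S T m n x y = qmult S T x y"
    and unit_eq: "unit X = N {} +>\<^bsub>P {}\<^esub> basis_vec R []"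
begin

lemma obj_subset: "finite I \<Longrightarrow> x \<in> carrier (obj X I n) \<Longrightarrow> x \<in> carrier (Q I)"
  using concentrated_subset[OF Q_module] by (auto simp: obj_eq)

lemma obj_cases:
  assumes "finite I" "x \<in> carrier (obj X I n)"
  obtains x' where "x' \<in> carrier (P I)" "x = N I +>\<^bsub>P I\<^esub> x'"
  using Q_cases[OF obj_subset[OF assms]] by blast

lemma act_linear:
  assumes "finite I" "inj_on \<sigma> I"
  shows "linear_map R (obj X I n) (obj X (\<sigma> ` I) n) (act X I n \<sigma>)"
proof (rule linear_map_cong)
  show "linear_map R (obj X I n) (obj X (\<sigma> ` I) n) (qrelabel I \<sigma>)"
    using concentrated_linear[OF Q_module Q_module qrelabel_linear] assms
    by (simp add: obj_eq card_image)
qed (use assms in \<open>simp_all add: act_eq obj_eq concentrated_module Q_module\<close>)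

lemma mul_bilinear:
  assumes "finite S" "finite T" "S \<inter> T = {}"
  shows "bilinear_map R (obj X S m) (obj X T n) (obj X (S \<union> T) (m + n)) (mul X S T m n)"
proof (rule bilinear_map_cong)
  show "bilinear_map R (obj X S m) (obj X T n) (obj X (S \<union> T) (m + n)) (qmult S T)"
    using concentrated_bilinear[OF Q_module Q_module Q_module qmult_bilinear] assms
    by (simp add: obj_eq card_Un_disjoint)
qed (use assms in \<open>simp_all add: mul_eq obj_eq concentrated_module Q_module\<close>)

lemma act_closed:
  "\<lbrakk>finite I; inj_on \<sigma> I; x \<in> carrier (obj X I n)\<rbrakk> \<Longrightarrow> act X I n \<sigma> x \<in> carrier (obj X (\<sigma> ` I) n)"
  by (rule linear_mapD(1)[OF act_linear])

lemma mul_closed: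
  "\<lbrakk>finite S; finite T; S \<inter> T = {}; x \<in> carrier (obj X S m); y \<in> carrier (obj X T n)\<rbrakk> \<Longrightarrow>
    mul X S T m n x y \<in> carrier (obj X (S \<union> T) (m + n))"
  by (rule bilinear_mapD(3)[OF mul_bilinear])

lemma unit_closed: "unit X \<in> carrier (obj X {} 0)"
  using basis_vec_closed[OF B_Nil]
  by (auto simp: obj_eq concentrated_def quot_module_carrier unit_eq)

lemma is_species: "species R X"
proof (rule species.intro)
  fix I :: "'a set" and n and \<sigma> \<tau> :: "'a \<Rightarrow> 'a" and x
  assume I: "finite I"
  show "module R (obj X I n)" by (simp add: obj_eq I concentrated_module Q_module)
  { assume x: "x \<in> carrier (obj X I n)"
    obtain x' where x': "x' \<in> carrier (P I)" "x = N I +>\<^bsub>P I\<^esub> x'"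
      by (rule obj_cases[OF I x])
    show "act X I n id x = x"
      using act_eq[OF I inj_on_id x] qrelabel_coset[OF I inj_on_id x'(1)] relabel_id[OF I x'(1)] x'
      by simp
    assume \<sigma>: "inj_on \<sigma> I"
    { assume \<tau>: "inj_on \<tau> (\<sigma> ` I)"
      then have c: "inj_on (\<tau> \<circ> \<sigma>) I" using \<sigma> comp_inj_on by blast
      show "act X I n (\<tau> \<circ> \<sigma>) x = act X (\<sigma> ` I) n \<tau> (act X I n \<sigma> x)"
        using act_eq[OF I c x] act_eq[OF _ \<tau> act_closed[OF I \<sigma> x]] act_eq[OF I \<sigma> x] I
          qrelabel_coset[OF I c x'(1)] qrelabel_coset[OF I \<sigma> x'(1)]
          qrelabel_coset[OF _ \<tau> linear_mapD(1)[OF relabel_linear[OF I \<sigma>] x'(1)]]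
          relabel_comp[OF I \<sigma> \<tau> x'(1)] x'
        by (simp add: image_comp) }
    assume eq: "\<And>i. i \<in> I \<Longrightarrow> \<sigma> i = \<tau> i"
    then have \<tau>: "inj_on \<tau> I" and im: "\<sigma> ` I = \<tau> ` I"
      using \<sigma> by (auto simp: inj_on_def cong: image_cong)
    show "act X I n \<sigma> x = act X I n \<tau> x"
      using act_eq[OF I \<sigma> x] act_eq[OF I \<tau> x] qrelabel_coset[OF I \<sigma> x'(1)]
        qrelabel_coset[OF I \<tau> x'(1)] relabel_cong[OF I \<sigma> eq x'(1)] x' im by simp }
qed (rule act_linear)

text \<open>
  Each law is an identity between linear maps of the free modules, which holds because it holds
  for words; it then passes to the cosets.
\<close>

lemma is_species_algebra: "species_algebra R X"
proof (intro species_algebra.intro is_species species_algebra_axioms.intro)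
  fix S T U :: "'a set" and \<sigma> :: "'a \<Rightarrow> 'a" and m n p x y z
  assume S: "finite S"
  { assume x: "x \<in> carrier (obj X S n)"
    obtain x' where x': "x' \<in> carrier (P S)" "x = N S +>\<^bsub>P S\<^esub> x'" by (rule obj_cases[OF S x])
    have bN: "basis_vec R [] \<in> carrier (P {})" by (intro basis_vec_closed B_Nil)
    show "mul X {} S 0 n (unit X) x = x"
      using mul_eq[OF _ S _ unit_closed x] qmult_coset[OF _ S _ bN x'(1)] concat_Nil[OF S x'(1)] x'
      by (simp add: unit_eq)
    show "mul X S {} n 0 x (unit X) = x"
      using mul_eq[OF S _ _ x unit_closed] qmult_coset[OF S _ _ x'(1) bN] concat_Nil[OF S x'(1)] x'
      by (simp add: unit_eq) }
  assume T: "finite T"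
  assume ST: "S \<inter> T = {}"
  show "bilinear_map R (obj X S m) (obj X T n) (obj X (S \<union> T) (m + n)) (mul X S T m n)"
    by (rule mul_bilinear[OF S T ST])
  assume x: "x \<in> carrier (obj X S m)" and y: "y \<in> carrier (obj X T n)"
  obtain x' where x': "x' \<in> carrier (P S)" "x = N S +>\<^bsub>P S\<^esub> x'" by (rule obj_cases[OF S x])
  obtain y' where y': "y' \<in> carrier (P T)" "y = N T +>\<^bsub>P T\<^esub> y'" by (rule obj_cases[OF T y])
  note xy = mul_eq[OF S T ST x y] qmult_coset[OF S T ST x'(1) y'(1)]
    bilinear_mapD(3)[OF concat_bilinear[OF S T ST] x'(1) y'(1)] mul_closed[OF S T ST x y]
  have fST: "finite (S \<union> T)" using S T by simp
  { assume \<sigma>: "inj_on \<sigma> (S \<union> T)"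
    then have \<sigma>S: "inj_on \<sigma> S" and \<sigma>T: "inj_on \<sigma> T" and d: "\<sigma> ` S \<inter> \<sigma> ` T = {}"
      using ST by (auto simp: inj_on_def)
    show "act X (S \<union> T) (m + n) \<sigma> (mul X S T m n x y) =
        mul X (\<sigma> ` S) (\<sigma> ` T) m n (act X S m \<sigma> x) (act X T n \<sigma> y)"
      using xy x' y' act_eq[OF S \<sigma>S x] act_eq[OF T \<sigma>T y] act_eq[OF fST \<sigma> xy(4)]
        qrelabel_coset[OF fST \<sigma> xy(3)] qrelabel_coset[OF S \<sigma>S x'(1)] qrelabel_coset[OF T \<sigma>T y'(1)]
        mul_eq[OF _ _ d act_closed[OF S \<sigma>S x] act_closed[OF T \<sigma>T y]]
        qmult_coset[OF _ _ d linear_mapD(1)[OF relabel_linear[OF S \<sigma>S] x'(1)]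
            linear_mapD(1)[OF relabel_linear[OF T \<sigma>T] y'(1)]]
        relabel_concat[OF S T ST \<sigma> x'(1) y'(1)] S T
      by (simp add: image_Un) }
  assume U: "finite U" and SU: "S \<inter> U = {}" and TU: "T \<inter> U = {}" and z: "z \<in> carrier (obj X U p)"
  obtain z' where z': "z' \<in> carrier (P U)" "z = N U +>\<^bsub>P U\<^esub> z'" by (rule obj_cases[OF U z])
  have fTU: "finite (T \<union> U)" and d1: "(S \<union> T) \<inter> U = {}" and d2: "S \<inter> (T \<union> U) = {}"
    using T U ST SU TU by auto
  note yz = mul_eq[OF T U TU y z] qmult_coset[OF T U TU y'(1) z'(1)]
    bilinear_mapD(3)[OF concat_bilinear[OF T U TU] y'(1) z'(1)] mul_closed[OF T U TU y z]
  have "concat_mult R (P (S \<union> T \<union> U)) (concat_mult R (P (S \<union> T)) x' y') z'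
      = concat_mult R (P (S \<union> T \<union> U)) x' (concat_mult R (P (T \<union> U)) y' z')"
    by (rule concat_mult_assoc[OF _ _ _ _ x'(1) y'(1) z'(1)])
      (use S T U ST SU TU fST fTU d1 d2 B_append[of "S \<union> T" U] B_append[of S "T \<union> U"]
        in \<open>auto intro: B_append simp: Un_assoc\<close>)
  then show "mul X (S \<union> T) U (m + n) p (mul X S T m n x y) z =
      mul X S (T \<union> U) m (n + p) x (mul X T U n p y z)"
    using xy yz x' y' z' mul_eq[OF fST U d1 xy(4) z] mul_eq[OF S fTU d2 x yz(4)]
      qmult_coset[OF fST U d1 xy(3) z'(1)] qmult_coset[OF S fTU d2 x'(1) yz(3)]
    by (simp add: Un_assoc)
qed (rule unit_closed)

end


text \<open>
  A map of letters induces linear maps of the free modules on words that respect concatenation and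
  relabelling. What remains is a statement about each \<open>I\<close> separately: the relations of \<open>X\<close> are
  exactly the elements sent to relations of \<open>Y\<close>, and the image meets every coset.
\<close>

theorem presented_algebras_isomorphic:
  fixes R (structure)
  assumes "presented_algebra R B N h X" and "presented_algebra R B' N' h' Y"
    and letters_B: "\<And>I F. finite I \<Longrightarrow> F \<in> B I \<Longrightarrow> map b F \<in> B' I"
    and letters_h: "\<And>I \<sigma> F c. finite I \<Longrightarrow> inj_on \<sigma> I \<Longrightarrow> F \<in> B I \<Longrightarrow> c \<in> set F \<Longrightarrow>
      b (h I \<sigma> c) = h' I \<sigma> (b c)"
    and relations: "\<And>I x. finite I \<Longrightarrow> x \<in> carrier (free_module R (B I)) \<Longrightarrow>
      lin_ext R (free_module R (B' I)) (\<lambda>F. basis_vec R (map b F)) x \<in> N' I \<longleftrightarrow> x \<in> N I"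
    and generators: "\<And>I y. finite I \<Longrightarrow> y \<in> carrier (free_module R (B' I)) \<Longrightarrow>
      \<exists>x\<in>carrier (free_module R (B I)). y \<ominus>\<^bsub>free_module R (B' I)\<^esub>
        lin_ext R (free_module R (B' I)) (\<lambda>F. basis_vec R (map b F)) x \<in> N' I"
  shows "isomorphic_species_algebras R X Y"
proof -
  interpret X: presented_algebra R B N h X by fact
  interpret Y: presented_algebra R B' N' h' Y by fact
  let ?w = "\<lambda>I. lin_ext R (Y.P I) (\<lambda>F. basis_vec R (map b F))"
  let ?\<phi> = "\<lambda>I. coset_map (Y.P I) (N' I) (?w I)"
  note Pmod = X.free_module_module
  have w: "linear_map R (X.P I) (Y.P I) (?w I)" if "finite I" for I
    using that by (intro X.lin_ext_linear Pmod) (auto intro: X.basis_vec_closed letters_B)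
  have w_basis: "?w I (basis_vec R F) = basis_vec R (map b F)" if "finite I" "F \<in> B I" for I F
    using that by (intro X.lin_ext_basis Pmod X.basis_vec_closed letters_B)
  have w_N: "?w I x \<in> N' I" if "finite I" "x \<in> N I" for I x
    using relations[of I x] that submoduleD(1)[OF X.N_submodule Pmod] by blast
  have \<phi>_coset: "?\<phi> I (N I +>\<^bsub>X.P I\<^esub> x) = N' I +>\<^bsub>Y.P I\<^esub> ?w I x"
    if "finite I" "x \<in> carrier (X.P I)" for I x
    using that by (intro coset_map_coset[OF Pmod X.N_submodule Pmod Y.N_submodule w w_N]) auto
  have \<phi>: "linear_map R (X.Q I) (Y.Q I) (?\<phi> I)" if "finite I" for I
    using that by (intro coset_map_linear[OF Pmod X.N_submodule Pmod Y.N_submodule w w_N]) auto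
  have w_closed: "?w I x \<in> carrier (Y.P I)" if "finite I" "x \<in> carrier (X.P I)" for I x
    using linear_mapD(1)[OF w] that by blast

  have bij_Q: "bij_betw (?\<phi> I) (carrier (X.Q I)) (carrier (Y.Q I))" if I: "finite I" for I
    unfolding bij_betw_def
  proof
    show "inj_on (?\<phi> I) (carrier (X.Q I))"
    proof (rule inj_onI)
      fix A C assume "A \<in> carrier (X.Q I)" "C \<in> carrier (X.Q I)" and eq: "?\<phi> I A = ?\<phi> I C"
      then obtain x y where x: "x \<in> carrier (X.P I)" "A = N I +>\<^bsub>X.P I\<^esub> x"
        and y: "y \<in> carrier (X.P I)" "C = N I +>\<^bsub>X.P I\<^esub> y"
        by (auto simp: quot_module_carrier)
      have "?w I x \<ominus>\<^bsub>Y.P I\<^esub> ?w I y \<in> N' I"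
        using eq x y \<phi>_coset[OF I] w_closed[OF I] coset_eq_iff[OF Y.N_submodule[OF I] Pmod]
        by simp
      then have "?w I (x \<ominus>\<^bsub>X.P I\<^esub> y) \<in> N' I"
        using linear_map_minus[OF w[OF I] Pmod Pmod x(1) y(1)] by simp
      moreover have "x \<ominus>\<^bsub>X.P I\<^esub> y \<in> carrier (X.P I)"
        using abelian_group.minus_closed[OF module.axioms(2)[OF Pmod] x(1) y(1)] .
      ultimately have "x \<ominus>\<^bsub>X.P I\<^esub> y \<in> N I" using relations[OF I] by blast
      then show "A = C"
        using coset_eq_iff[OF X.N_submodule[OF I] Pmod x(1) y(1)] x y by simp
    qed
    show "?\<phi> I ` carrier (X.Q I) = carrier (Y.Q I)"
    proof
      show "?\<phi> I ` carrier (X.Q I) \<subseteq> carrier (Y.Q I)" using linear_mapD(1)[OF \<phi>[OF I]] by blast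
      show "carrier (Y.Q I) \<subseteq> ?\<phi> I ` carrier (X.Q I)"
      proof
        fix C assume "C \<in> carrier (Y.Q I)"
        then obtain y where y: "y \<in> carrier (Y.P I)" "C = N' I +>\<^bsub>Y.P I\<^esub> y"
          by (auto simp: quot_module_carrier)
        obtain x where x: "x \<in> carrier (X.P I)" "y \<ominus>\<^bsub>Y.P I\<^esub> ?w I x \<in> N' I"
          using generators[OF I y(1)] by blast
        have "C = ?\<phi> I (N I +>\<^bsub>X.P I\<^esub> x)"
          using coset_eq_iff[OF Y.N_submodule[OF I] Pmod y(1) w_closed[OF I x(1)]]
            \<phi>_coset[OF I x(1)] x y by simp
        then show "C \<in> ?\<phi> I ` carrier (X.Q I)" using x by (auto simp: quot_module_carrier)
      qed
    qed
  qed
  have \<phi>_zero: "?\<phi> I \<zero>\<^bsub>X.Q I\<^esub> = \<zero>\<^bsub>Y.Q I\<^esub>" if "finite I" for I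
    by (rule linear_map_zero[OF \<phi> X.Q_module Y.Q_module]) (rule that)+
  have lin: "linear_map R (obj X I n) (obj Y I n) (?\<phi> I)"
    and bij: "bij_betw (?\<phi> I) (carrier (obj X I n)) (carrier (obj Y I n))" if I: "finite I" for I n
  proof -
    show "linear_map R (obj X I n) (obj Y I n) (?\<phi> I)"
      using concentrated_linear[OF X.Q_module[OF I] Y.Q_module[OF I] \<phi>[OF I]]
      by (simp add: X.obj_eq[OF I] Y.obj_eq[OF I])
    show "bij_betw (?\<phi> I) (carrier (obj X I n)) (carrier (obj Y I n))"
      using bij_Q[OF I] \<phi>_zero[OF I]
      by (simp add: X.obj_eq[OF I] Y.obj_eq[OF I] concentrated_def bij_betw_def)
  qed

  have natural: "?\<phi> (\<sigma> ` I) (act X I n \<sigma> x) = act Y I n \<sigma> (?\<phi> I x)"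
    if I: "finite I" and \<sigma>: "inj_on \<sigma> I" and x: "x \<in> carrier (obj X I n)" for I n \<sigma> x
  proof -
    obtain x' where x': "x' \<in> carrier (X.P I)" "x = N I +>\<^bsub>X.P I\<^esub> x'" by (rule X.obj_cases[OF I x])
    have I': "finite (\<sigma> ` I)" using I by simp
    have "?w (\<sigma> ` I) (X.relabel I \<sigma> x') = Y.relabel I \<sigma> (?w I x')"
    proof (rule X.linear_map_eq_on_basis[OF _ _ Pmod _ x'(1)])
      show "linear_map R (X.P I) (Y.P (\<sigma> ` I)) (\<lambda>x. ?w (\<sigma> ` I) (X.relabel I \<sigma> x))"
        by (rule linear_map_comp[OF X.relabel_linear[OF I \<sigma>] w[OF I']])
      show "linear_map R (X.P I) (Y.P (\<sigma> ` I)) (\<lambda>x. Y.relabel I \<sigma> (?w I x))"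
        by (rule linear_map_comp[OF w[OF I] Y.relabel_linear[OF I \<sigma>]])
      fix F assume F: "F \<in> B I"
      have "map b (map (h I \<sigma>) F) = map (h' I \<sigma>) (map b F)"
        using letters_h[OF I \<sigma> F] by simp
      then show "?w (\<sigma> ` I) (X.relabel I \<sigma> (basis_vec R F)) = Y.relabel I \<sigma> (?w I (basis_vec R F))"
        using X.relabel_basis[OF I \<sigma> F] Y.relabel_basis[OF I \<sigma> letters_B[OF I F]]
          w_basis[OF I F] w_basis[OF I' X.B_map[OF I \<sigma> F]] by (simp only:)
    qed
    then show ?thesis
      using X.act_eq[OF I \<sigma> x] Y.act_eq[OF I \<sigma> linear_mapD(1)[OF lin[OF I] x]] x'
        X.qrelabel_coset[OF I \<sigma> x'(1)] Y.qrelabel_coset[OF I \<sigma> w_closed[OF I x'(1)]]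
        \<phi>_coset[OF I x'(1)] \<phi>_coset[OF I' linear_mapD(1)[OF X.relabel_linear[OF I \<sigma>] x'(1)]]
      by simp
  qed

  have multiplicative: "?\<phi> (S \<union> T) (mul X S T m n x y) = mul Y S T m n (?\<phi> S x) (?\<phi> T y)"
    if S: "finite S" and T: "finite T" and d: "S \<inter> T = {}"
      and x: "x \<in> carrier (obj X S m)" and y: "y \<in> carrier (obj X T n)" for S T m n x y
  proof -
    obtain x' where x': "x' \<in> carrier (X.P S)" "x = N S +>\<^bsub>X.P S\<^esub> x'" by (rule X.obj_cases[OF S x])
    obtain y' where y': "y' \<in> carrier (X.P T)" "y = N T +>\<^bsub>X.P T\<^esub> y'" by (rule X.obj_cases[OF T y])
    have U: "finite (S \<union> T)" using S T by simp
    have "?w (S \<union> T) (concat_mult R (X.P (S \<union> T)) x' y')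
        = concat_mult R (Y.P (S \<union> T)) (?w S x') (?w T y')"
    proof (rule X.bilinear_map_eq_on_basis[OF _ _ Pmod _ x'(1) y'(1)])
      show "bilinear_map R (X.P S) (X.P T) (Y.P (S \<union> T))
          (\<lambda>x y. ?w (S \<union> T) (concat_mult R (X.P (S \<union> T)) x y))"
        by (rule bilinear_map_comp_outer[OF X.concat_bilinear[OF S T d] w[OF U]])
      show "bilinear_map R (X.P S) (X.P T) (Y.P (S \<union> T))
          (\<lambda>x y. concat_mult R (Y.P (S \<union> T)) (?w S x) (?w T y))"
        by (rule bilinear_map_comp_inner[OF Y.concat_bilinear[OF S T d] w[OF S] w[OF T]])
      fix F G assume F: "F \<in> B S" and G: "G \<in> B T"
      note FG = X.B_append[OF S T d F G] Y.B_append[OF S T d letters_B[OF S F] letters_B[OF T G]]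
      show "?w (S \<union> T) (concat_mult R (X.P (S \<union> T)) (basis_vec R F) (basis_vec R G))
          = concat_mult R (Y.P (S \<union> T)) (?w S (basis_vec R F)) (?w T (basis_vec R G))"
        using X.concat_mult_basis[OF FG(1)] X.concat_mult_basis[OF FG(2)]
          w_basis[OF S F] w_basis[OF T G] w_basis[OF U FG(1)] by (simp only: map_append)
    qed
    then show ?thesis
      using X.mul_eq[OF S T d x y] x' y' X.qmult_coset[OF S T d x'(1) y'(1)]
        Y.mul_eq[OF S T d linear_mapD(1)[OF lin[OF S] x] linear_mapD(1)[OF lin[OF T] y]]
        Y.qmult_coset[OF S T d w_closed[OF S x'(1)] w_closed[OF T y'(1)]]
        \<phi>_coset[OF S x'(1)] \<phi>_coset[OF T y'(1)]
        \<phi>_coset[OF U bilinear_mapD(3)[OF X.concat_bilinear[OF S T d] x'(1) y'(1)]]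
      by simp
  qed

  have unital: "?\<phi> {} (unit X) = unit Y"
    using \<phi>_coset[of "{}"] w_basis[of "{}", OF _ X.B_Nil] X.basis_vec_closed[OF X.B_Nil]
    by (simp add: X.unit_eq Y.unit_eq)
  have "species_algebra_iso R X Y (\<lambda>I n. ?\<phi> I)"
    unfolding species_algebra_iso_def
    by (intro conjI allI impI ballI lin bij natural multiplicative unital)
  then show ?thesis
    unfolding isomorphic_species_algebras_def
    using X.is_species_algebra Y.is_species_algebra by blast
qed


section \<open>Exterior powers\<close>

lemma free_module_mono: "S \<subseteq> I \<Longrightarrow> x \<in> carrier (free_module R S) \<Longrightarrow> x \<in> carrier (free_module R I)"
  by (auto simp: free_module_carrier)

text \<open>
  The generators in the definition of \<open>ext_relations\<close>: additivity in a slot, homogeneity in a slot,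
  and the squares.
\<close>

definition ext_generators ::
  "('k, 'r) ring_scheme \<Rightarrow> ('k, 'm) module \<Rightarrow> nat \<Rightarrow> ('m list \<Rightarrow> 'k) set"
where
  "ext_generators R M n =
    {basis_vec R (xs @ [x \<oplus>\<^bsub>M\<^esub> y] @ ys)
        \<ominus>\<^bsub>tuple_module R M n\<^esub> (basis_vec R (xs @ [x] @ ys)
           \<oplus>\<^bsub>tuple_module R M n\<^esub> basis_vec R (xs @ [y] @ ys)) | xs x y ys.
        length xs + 1 + length ys = n \<and>
        set xs \<union> {x, y} \<union> set ys \<subseteq> carrier M} \<union>
     {basis_vec R (xs @ [r \<odot>\<^bsub>M\<^esub> x] @ ys)
        \<ominus>\<^bsub>tuple_module R M n\<^esub> (r \<odot>\<^bsub>tuple_module R M n\<^esub> basis_vec R (xs @ [x] @ ys)) | xs r x ys.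
        length xs + 1 + length ys = n \<and>
        r \<in> carrier R \<and> set xs \<union> {x} \<union> set ys \<subseteq> carrier M} \<union>
     {basis_vec R (xs @ [x, x] @ ys) | xs x ys.
        length xs + 2 + length ys = n \<and>
        set xs \<union> {x} \<union> set ys \<subseteq> carrier M}"

lemma ext_relations_eq:
  "ext_relations R M n = submodule_span R (tuple_module R M n) (ext_generators R M n)"
  unfolding ext_relations_def ext_generators_def by (rule refl)

context cring begin

lemma tuple_module_module: "module R (tuple_module R M n)"
  unfolding tuple_module_def by (rule free_module_module)

lemma tuple_basis_closed:
  "length xs = n \<Longrightarrow> set xs \<subseteq> carrier M \<Longrightarrow> basis_vec R xs \<in> carrier (tuple_module R M n)"
  unfolding tuple_module_def by (rule basis_vec_closed) simp

lemma ext_generators_closed: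
  assumes "module R M"
  shows "ext_generators R M n \<subseteq> carrier (tuple_module R M n)"
proof -
  interpret M: module R M by fact
  interpret T: module R "tuple_module R M n" for n by (rule tuple_module_module)
  show ?thesis
    unfolding ext_generators_def
    by (auto intro!: T.minus_closed T.a_closed T.smult_closed tuple_basis_closed)
qed

lemma ext_relations_submodule:
  "module R M \<Longrightarrow> submodule (ext_relations R M n) R (tuple_module R M n)"
  unfolding ext_relations_eq
  by (intro submodule_span_submodule tuple_module_module ext_generators_closed)

lemma ext_relations_add:
  assumes "length xs + 1 + length ys = n" "set xs \<union> {x, y} \<union> set ys \<subseteq> carrier M"
  shows "basis_vec R (xs @ [x \<oplus>\<^bsub>M\<^esub> y] @ ys)
        \<ominus>\<^bsub>tuple_module R M n\<^esub> (basis_vec R (xs @ [x] @ ys)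
           \<oplus>\<^bsub>tuple_module R M n\<^esub> basis_vec R (xs @ [y] @ ys)) \<in> ext_relations R M n"
  unfolding ext_relations_eq ext_generators_def
  by (rule subsetD[OF submodule_span_superset]) (use assms in blast)

lemma ext_relations_smult:
  assumes "length xs + 1 + length ys = n" "r \<in> carrier R" "set xs \<union> {x} \<union> set ys \<subseteq> carrier M"
  shows "basis_vec R (xs @ [r \<odot>\<^bsub>M\<^esub> x] @ ys)
        \<ominus>\<^bsub>tuple_module R M n\<^esub> (r \<odot>\<^bsub>tuple_module R M n\<^esub> basis_vec R (xs @ [x] @ ys))
      \<in> ext_relations R M n"
  unfolding ext_relations_eq ext_generators_def
  by (rule subsetD[OF submodule_span_superset]) (use assms in blast)

lemma ext_relations_alt:
  assumes "length xs + 2 + length ys = n" "set xs \<union> {x} \<union> set ys \<subseteq> carrier M"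
  shows "basis_vec R (xs @ [x, x] @ ys) \<in> ext_relations R M n"
  unfolding ext_relations_eq ext_generators_def
  by (rule subsetD[OF submodule_span_superset]) (use assms in blast)

text \<open>
  The universal property of the exterior power in the form used below: a function of tuples that
  is multilinear and alternating modulo \<open>K\<close> sends all relations into \<open>K\<close>.
\<close>

lemma ext_relations_induced:
  assumes M: "module R M" and P: "module R P" and K: "submodule K R P"
    and f: "linear_map R (tuple_module R M n) P f"
    and v: "\<And>xs. length xs = n \<Longrightarrow> set xs \<subseteq> carrier M \<Longrightarrow> f (basis_vec R xs) = v xs"
    and add: "\<And>xs x y ys. length xs + 1 + length ys = n \<Longrightarrow> set xs \<union> {x, y} \<union> set ys \<subseteq> carrier M \<Longrightarrow>
      v (xs @ [x \<oplus>\<^bsub>M\<^esub> y] @ ys) \<ominus>\<^bsub>P\<^esub> (v (xs @ [x] @ ys) \<oplus>\<^bsub>P\<^esub> v (xs @ [y] @ ys)) \<in> K"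
    and smult: "\<And>xs r x ys. length xs + 1 + length ys = n \<Longrightarrow> r \<in> carrier R \<Longrightarrow>
      set xs \<union> {x} \<union> set ys \<subseteq> carrier M \<Longrightarrow>
      v (xs @ [r \<odot>\<^bsub>M\<^esub> x] @ ys) \<ominus>\<^bsub>P\<^esub> (r \<odot>\<^bsub>P\<^esub> v (xs @ [x] @ ys)) \<in> K"
    and alt: "\<And>xs x ys. length xs + 2 + length ys = n \<Longrightarrow> set xs \<union> {x} \<union> set ys \<subseteq> carrier M \<Longrightarrow>
      v (xs @ [x, x] @ ys) \<in> K"
    and t: "t \<in> ext_relations R M n"
  shows "f t \<in> K"
proof (rule linear_map_span[OF f tuple_module_module P K ext_generators_closed[OF M] _
      t[unfolded ext_relations_eq]])
  interpret M: module R M by fact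
  interpret T: module R "tuple_module R M n" by (rule tuple_module_module)
  note T = tuple_basis_closed and lin = linear_mapD(2,3)[OF f] linear_map_minus[OF f tuple_module_module P]
  fix g assume "g \<in> ext_generators R M n"
  then show "f g \<in> K"
    unfolding ext_generators_def
  proof (elim UnE CollectE exE conjE)
    fix xs x y ys
    assume g: "g = basis_vec R (xs @ [x \<oplus>\<^bsub>M\<^esub> y] @ ys) \<ominus>\<^bsub>tuple_module R M n\<^esub>
        (basis_vec R (xs @ [x] @ ys) \<oplus>\<^bsub>tuple_module R M n\<^esub> basis_vec R (xs @ [y] @ ys))"
      and len: "length xs + 1 + length ys = n" and mem: "set xs \<union> {x, y} \<union> set ys \<subseteq> carrier M"
    have c: "basis_vec R (xs @ [z] @ ys) \<in> carrier (tuple_module R M n)"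
      "f (basis_vec R (xs @ [z] @ ys)) = v (xs @ [z] @ ys)" if "z \<in> carrier M" for z
      using len mem that by (auto intro!: T v)
    have xy: "x \<in> carrier M" "y \<in> carrier M" "x \<oplus>\<^bsub>M\<^esub> y \<in> carrier M" using mem by auto
    show ?thesis
      using add[OF len mem] g c[OF xy(1)] c[OF xy(2)] c[OF xy(3)] lin by simp
  next
    fix xs r x ys
    assume g: "g = basis_vec R (xs @ [r \<odot>\<^bsub>M\<^esub> x] @ ys) \<ominus>\<^bsub>tuple_module R M n\<^esub>
        (r \<odot>\<^bsub>tuple_module R M n\<^esub> basis_vec R (xs @ [x] @ ys))"
      and len: "length xs + 1 + length ys = n" and r: "r \<in> carrier R"
      and mem: "set xs \<union> {x} \<union> set ys \<subseteq> carrier M"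
    have c: "basis_vec R (xs @ [z] @ ys) \<in> carrier (tuple_module R M n)"
      "f (basis_vec R (xs @ [z] @ ys)) = v (xs @ [z] @ ys)" if "z \<in> carrier M" for z
      using len mem that by (auto intro!: T v)
    have xy: "x \<in> carrier M" "r \<odot>\<^bsub>M\<^esub> x \<in> carrier M" using mem r by auto
    show ?thesis
      using smult[OF len r mem] r g c[OF xy(1)] c[OF xy(2)] lin by simp
  next
    fix xs x ys
    assume g: "g = basis_vec R (xs @ [x, x] @ ys)"
      and len: "length xs + 2 + length ys = n" and mem: "set xs \<union> {x} \<union> set ys \<subseteq> carrier M"
    then have "f g = v (xs @ [x, x] @ ys)" using v[of "xs @ [x, x] @ ys"] by simp
    then show ?thesis using alt[OF len mem] by simp
  qed
qed

lemma ext_relations_map: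
  assumes M: "module R M" and M': "module R M'" and u: "linear_map R M M' u"
    and t: "t \<in> ext_relations R M n"
  shows "lin_ext R (tuple_module R M' n) (\<lambda>xs. basis_vec R (map u xs)) t \<in> ext_relations R M' n"
proof (rule ext_relations_induced[OF M tuple_module_module ext_relations_submodule[OF M'] _ _ _ _ _ t])
  note u' = linear_mapD[OF u]
  have mem: "set (map u xs) \<subseteq> carrier M'" if "set xs \<subseteq> carrier M" for xs
    using u' that by auto
  show "linear_map R (tuple_module R M n) (tuple_module R M' n)
      (lin_ext R (tuple_module R M' n) (\<lambda>xs. basis_vec R (map u xs)))"
    unfolding tuple_module_def[of R M]
    by (intro lin_ext_linear tuple_module_module) (auto intro!: tuple_basis_closed u')
  show "lin_ext R (tuple_module R M' n) (\<lambda>xs. basis_vec R (map u xs)) (basis_vec R xs)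
      = basis_vec R (map u xs)" if "length xs = n" "set xs \<subseteq> carrier M" for xs
    using that by (intro lin_ext_basis tuple_module_module) (auto intro!: tuple_basis_closed u')
  fix xs x ys
  { fix y assume a: "length xs + 1 + length ys = n" "set xs \<union> {x, y} \<union> set ys \<subseteq> carrier M"
    show "basis_vec R (map u (xs @ [x \<oplus>\<^bsub>M\<^esub> y] @ ys)) \<ominus>\<^bsub>tuple_module R M' n\<^esub>
        (basis_vec R (map u (xs @ [x] @ ys)) \<oplus>\<^bsub>tuple_module R M' n\<^esub>
         basis_vec R (map u (xs @ [y] @ ys))) \<in> ext_relations R M' n"
      using ext_relations_add[of "map u xs" "map u ys" n "u x" "u y" M'] a mem[of xs] mem[of ys] u'
      by auto }
  { fix r assume a: "length xs + 1 + length ys = n" "r \<in> carrier R" "set xs \<union> {x} \<union> set ys \<subseteq> carrier M"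
    show "basis_vec R (map u (xs @ [r \<odot>\<^bsub>M\<^esub> x] @ ys)) \<ominus>\<^bsub>tuple_module R M' n\<^esub>
        (r \<odot>\<^bsub>tuple_module R M' n\<^esub> basis_vec R (map u (xs @ [x] @ ys))) \<in> ext_relations R M' n"
      using ext_relations_smult[of "map u xs" "map u ys" n r "u x" M'] a mem[of xs] mem[of ys] u'
      by auto }
  assume a: "length xs + 2 + length ys = n" "set xs \<union> {x} \<union> set ys \<subseteq> carrier M"
  show "basis_vec R (map u (xs @ [x, x] @ ys)) \<in> ext_relations R M' n"
    using ext_relations_alt[of "map u xs" "map u ys" n "u x" M'] a mem[of xs] mem[of ys] u'
    by auto
qed

lemma tuple_concat_bilinear:
  assumes "carrier M \<subseteq> carrier L" "carrier M' \<subseteq> carrier L"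
  shows "bilinear_map R (tuple_module R M m) (tuple_module R M' n) (tuple_module R L (m + n))
    (concat_mult R (tuple_module R L (m + n)))"
  unfolding tuple_module_def using assms by (intro concat_mult_bilinear) auto

lemma tuple_concat_basis:
  assumes "length xs + length ys = n" "set xs \<subseteq> carrier L" "set ys \<subseteq> carrier L"
  shows "concat_mult R (tuple_module R L n) (basis_vec R xs) (basis_vec R ys) = basis_vec R (xs @ ys)"
  unfolding tuple_module_def using assms by (intro concat_mult_basis) auto

text \<open>
  A generator remains a generator of the same kind when entries are added at either end. This makes
  the relations a two-sided ideal of the tensor algebra.
\<close>

lemma ext_relations_append:
  assumes M: "module R M" and L: "module R L" and incl: "linear_map R M L (\<lambda>x. x)"
    and ys: "length ys = n" "set ys \<subseteq> carrier L" and t: "t \<in> ext_relations R M m"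
  shows "concat_mult R (tuple_module R L (m + n)) t (basis_vec R ys) \<in> ext_relations R L (m + n)"
    "concat_mult R (tuple_module R L (n + m)) (basis_vec R ys) t \<in> ext_relations R L (n + m)"
proof -
  note i = linear_mapD[OF incl]
  have sub: "carrier M \<subseteq> carrier L" using i by auto
  have subL: "set zs \<subseteq> carrier L" if "set zs \<subseteq> carrier M" for zs using sub that by blast
  note ysc = tuple_basis_closed[OF ys]
  show "concat_mult R (tuple_module R L (m + n)) t (basis_vec R ys) \<in> ext_relations R L (m + n)"
  proof (rule ext_relations_induced[OF M tuple_module_module ext_relations_submodule[OF L] _ _ _ _ _ t])
    show "linear_map R (tuple_module R M m) (tuple_module R L (m + n))
      (\<lambda>t. concat_mult R (tuple_module R L (m + n)) t (basis_vec R ys))"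
      by (rule bilinear_mapD(2)[OF tuple_concat_bilinear[OF sub subset_refl] ysc])
    show "concat_mult R (tuple_module R L (m + n)) (basis_vec R xs) (basis_vec R ys)
      = basis_vec R (xs @ ys)" if "length xs = m" "set xs \<subseteq> carrier M" for xs
      using that ys sub by (intro tuple_concat_basis) auto
    fix xs x zs
    { fix y assume "length xs + 1 + length zs = m" "set xs \<union> {x, y} \<union> set zs \<subseteq> carrier M"
      then show "basis_vec R ((xs @ [x \<oplus>\<^bsub>M\<^esub> y] @ zs) @ ys) \<ominus>\<^bsub>tuple_module R L (m + n)\<^esub>
        (basis_vec R ((xs @ [x] @ zs) @ ys) \<oplus>\<^bsub>tuple_module R L (m + n)\<^esub>
         basis_vec R ((xs @ [y] @ zs) @ ys)) \<in> ext_relations R L (m + n)"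
        using ext_relations_add[of xs "zs @ ys" "m + n" x y L] subL[of xs] subL[of zs] sub ys i by auto }
    { fix r assume "length xs + 1 + length zs = m" "r \<in> carrier R" "set xs \<union> {x} \<union> set zs \<subseteq> carrier M"
      then show "basis_vec R ((xs @ [r \<odot>\<^bsub>M\<^esub> x] @ zs) @ ys) \<ominus>\<^bsub>tuple_module R L (m + n)\<^esub>
        (r \<odot>\<^bsub>tuple_module R L (m + n)\<^esub> basis_vec R ((xs @ [x] @ zs) @ ys)) \<in> ext_relations R L (m + n)"
        using ext_relations_smult[of xs "zs @ ys" "m + n" r x L] subL[of xs] subL[of zs] sub ys i by auto }
    assume "length xs + 2 + length zs = m" "set xs \<union> {x} \<union> set zs \<subseteq> carrier M"
    then show "basis_vec R ((xs @ [x, x] @ zs) @ ys) \<in> ext_relations R L (m + n)"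
      using ext_relations_alt[of xs "zs @ ys" "m + n" x L] subL[of xs] subL[of zs] sub ys by auto
  qed
  show "concat_mult R (tuple_module R L (n + m)) (basis_vec R ys) t \<in> ext_relations R L (n + m)"
  proof (rule ext_relations_induced[OF M tuple_module_module ext_relations_submodule[OF L] _ _ _ _ _ t])
    show "linear_map R (tuple_module R M m) (tuple_module R L (n + m))
      (\<lambda>t. concat_mult R (tuple_module R L (n + m)) (basis_vec R ys) t)"
      by (rule bilinear_mapD(1)[OF tuple_concat_bilinear[OF subset_refl sub] ysc])
    show "concat_mult R (tuple_module R L (n + m)) (basis_vec R ys) (basis_vec R xs)
      = basis_vec R (ys @ xs)" if "length xs = m" "set xs \<subseteq> carrier M" for xs
      using that ys sub by (intro tuple_concat_basis) auto
    fix xs x zs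
    { fix y assume "length xs + 1 + length zs = m" "set xs \<union> {x, y} \<union> set zs \<subseteq> carrier M"
      then show "basis_vec R (ys @ xs @ [x \<oplus>\<^bsub>M\<^esub> y] @ zs) \<ominus>\<^bsub>tuple_module R L (n + m)\<^esub>
        (basis_vec R (ys @ xs @ [x] @ zs) \<oplus>\<^bsub>tuple_module R L (n + m)\<^esub>
         basis_vec R (ys @ xs @ [y] @ zs)) \<in> ext_relations R L (n + m)"
        using ext_relations_add[of "ys @ xs" zs "n + m" x y L] subL[of xs] subL[of zs] sub ys i by auto }
    { fix r assume "length xs + 1 + length zs = m" "r \<in> carrier R" "set xs \<union> {x} \<union> set zs \<subseteq> carrier M"
      then show "basis_vec R (ys @ xs @ [r \<odot>\<^bsub>M\<^esub> x] @ zs) \<ominus>\<^bsub>tuple_module R L (n + m)\<^esub>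
        (r \<odot>\<^bsub>tuple_module R L (n + m)\<^esub> basis_vec R (ys @ xs @ [x] @ zs)) \<in> ext_relations R L (n + m)"
        using ext_relations_smult[of "ys @ xs" zs "n + m" r x L] subL[of xs] subL[of zs] sub ys i by auto }
    assume "length xs + 2 + length zs = m" "set xs \<union> {x} \<union> set zs \<subseteq> carrier M"
    then show "basis_vec R (ys @ xs @ [x, x] @ zs) \<in> ext_relations R L (n + m)"
      using ext_relations_alt[of "ys @ xs" zs "n + m" x L] subL[of xs] subL[of zs] sub ys by auto
  qed
qed


section \<open>The presentation of the signed exponential species\<close>

abbreviation vec_map :: "'i set \<Rightarrow> ('i \<Rightarrow> 'i) \<Rightarrow> ('i \<Rightarrow> 'a) \<Rightarrow> 'i \<Rightarrow> 'a" where
  "vec_map I \<sigma> \<equiv> lin_ext R (free_module R (\<sigma> ` I)) (\<lambda>i. basis_vec R (\<sigma> i))"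

lemma vec_map_linear: "linear_map R (free_module R I) (free_module R (\<sigma> ` I)) (vec_map I \<sigma>)"
  by (intro lin_ext_linear free_module_module) (auto intro: basis_vec_closed)

lemma vec_map_basis: "i \<in> I \<Longrightarrow> vec_map I \<sigma> (basis_vec R i) = basis_vec R (\<sigma> i)"
  by (intro lin_ext_basis free_module_module) (auto intro: basis_vec_closed)

lemma free_module_inclusion:
  "S \<subseteq> I \<Longrightarrow> linear_map R (free_module R S) (free_module R I) (\<lambda>x. x)"
  by (intro linear_mapI) (auto simp: free_module_simps intro: free_module_mono)

text \<open>
  The sums that define the two sides are formed in different modules, so they are compared on the
  basis instead of by definition.
\<close>

lemma vec_map_restrict:
  assumes "S \<subseteq> I" "v \<in> carrier (free_module R S)"
  shows "vec_map I \<sigma> v = vec_map S \<sigma> v"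
proof (rule linear_map_eq_on_basis[OF _ _ free_module_module _ assms(2)])
  show "linear_map R (free_module R S) (free_module R (\<sigma> ` I)) (vec_map I \<sigma>)"
    by (rule linear_map_comp[OF free_module_inclusion[OF assms(1)] vec_map_linear])
  show "linear_map R (free_module R S) (free_module R (\<sigma> ` I)) (vec_map S \<sigma>)"
    by (rule linear_map_comp[OF vec_map_linear free_module_inclusion]) (use assms in auto)
qed (use assms in \<open>auto simp: vec_map_basis subset_iff\<close>)

lemma vec_map_cong:
  assumes "\<And>i. i \<in> I \<Longrightarrow> \<sigma> i = \<tau> i" "v \<in> carrier (free_module R I)"
  shows "vec_map I \<sigma> v = vec_map I \<tau> v"
proof -
  have "\<sigma> ` I = \<tau> ` I" using assms(1) by (auto cong: image_cong)
  then have "linear_map R (free_module R I) (free_module R (\<sigma> ` I)) (vec_map I \<tau>)"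
    using vec_map_linear[of I \<tau>] by simp
  then show ?thesis
  proof (rule linear_map_eq_on_basis[OF vec_map_linear _ free_module_module _ assms(2)])
    show "vec_map I \<sigma> (basis_vec R i) = vec_map I \<tau> (basis_vec R i)" if "i \<in> I" for i
      using vec_map_basis[OF that, of \<sigma>] vec_map_basis[OF that, of \<tau>] assms(1)[OF that]
      by (simp only:)
  qed
qed

lemma vec_map_id:
  assumes "v \<in> carrier (free_module R I)"
  shows "vec_map I id v = v"
proof (rule linear_map_eq_on_basis[OF _ free_module_inclusion[OF subset_refl] free_module_module _ assms])
  show "linear_map R (free_module R I) (free_module R I) (vec_map I id)"
    using vec_map_linear[of I id] by simp
  show "vec_map I id (basis_vec R i) = basis_vec R i" if "i \<in> I" for i
    using vec_map_basis[OF that, of id] by simp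
qed

lemma vec_map_comp:
  assumes "v \<in> carrier (free_module R I)"
  shows "vec_map I (\<tau> \<circ> \<sigma>) v = vec_map (\<sigma> ` I) \<tau> (vec_map I \<sigma> v)"
proof (rule linear_map_eq_on_basis[OF _ linear_map_comp[OF vec_map_linear vec_map_linear]
      free_module_module _ assms])
  show "linear_map R (free_module R I) (free_module R (\<tau> ` \<sigma> ` I)) (vec_map I (\<tau> \<circ> \<sigma>))"
    using vec_map_linear[of I "\<tau> \<circ> \<sigma>"] by (simp add: image_comp)
  fix i assume "i \<in> I"
  then show "vec_map I (\<tau> \<circ> \<sigma>) (basis_vec R i) = vec_map (\<sigma> ` I) \<tau> (vec_map I \<sigma> (basis_vec R i))"
    using vec_map_basis[of i I \<sigma>] vec_map_basis[of i I "\<tau> \<circ> \<sigma>"] vec_map_basis[of "\<sigma> i" "\<sigma> ` I" \<tau>]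
    by (metis comp_apply imageI)
qed

definition tuples :: "'i set \<Rightarrow> ('i \<Rightarrow> 'a) list set" where
  "tuples I = {xs. length xs = card I \<and> set xs \<subseteq> carrier (free_module R I)}"

lemma tuple_module_eq: "free_module R (tuples I) = tuple_module R (free_module R I) (card I)"
  by (simp add: tuples_def tuple_module_def)

text \<open>
  Extension by zero is the identity on functions, so the inclusion of vectors on \<open>S\<close> into vectors
  on \<open>S \<union> T\<close> does not show in the words, and concatenation alone describes the exterior product.
\<close>

lemma tuples_presentation:
  "word_presentation R tuples (\<lambda>I. ext_relations R (free_module R I) (card I)) vec_map"
proof (intro word_presentation.intro word_presentation_axioms.intro is_cring)
  fix I S T :: "'i set" and \<sigma> \<tau> :: "'i \<Rightarrow> 'i" and F G b x
  show "[] \<in> tuples {}" by (simp add: tuples_def)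
  { assume "finite S" "finite T" "S \<inter> T = {}" "F \<in> tuples S" "G \<in> tuples T"
    then show "F @ G \<in> tuples (S \<union> T)"
      by (auto simp: tuples_def card_Un_disjoint intro: free_module_mono[of S "S \<union> T"]
          free_module_mono[of T "S \<union> T"]) }
  { assume "finite I" "inj_on \<sigma> I" "F \<in> tuples I"
    then show "map (vec_map I \<sigma>) F \<in> tuples (\<sigma> ` I)"
      using linear_mapD(1)[OF vec_map_linear[of I \<sigma>]] by (auto simp: tuples_def card_image) }
  { assume "finite I" "inj_on \<sigma> I" "\<And>i. i \<in> I \<Longrightarrow> \<sigma> i = \<tau> i" "F \<in> tuples I" "b \<in> set F"
    then show "vec_map I \<sigma> b = vec_map I \<tau> b" by (intro vec_map_cong) (auto simp: tuples_def) }
  { assume "finite I" "F \<in> tuples I" "b \<in> set F"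
    then show "vec_map I id b = b" by (intro vec_map_id) (auto simp: tuples_def) }
  { assume "finite I" "inj_on \<sigma> I" "inj_on \<tau> (\<sigma> ` I)" "F \<in> tuples I" "b \<in> set F"
    then show "vec_map I (\<tau> \<circ> \<sigma>) b = vec_map (\<sigma> ` I) \<tau> (vec_map I \<sigma> b)"
      by (intro vec_map_comp) (auto simp: tuples_def) }
  { assume "finite I" "inj_on \<sigma> I" "S \<subseteq> I" "F \<in> tuples S" "b \<in> set F"
    then show "vec_map I \<sigma> b = vec_map S \<sigma> b" by (intro vec_map_restrict) (auto simp: tuples_def) }
  show "submodule (ext_relations R (free_module R I) (card I)) R (free_module R (tuples I))"
    unfolding tuple_module_eq by (intro ext_relations_submodule free_module_module)
  { assume fin: "finite S" "finite T" "S \<inter> T = {}"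
    { assume x: "x \<in> ext_relations R (free_module R S) (card S)" and G: "G \<in> tuples T"
      show "concat_mult R (free_module R (tuples (S \<union> T))) x (basis_vec R G)
        \<in> ext_relations R (free_module R (S \<union> T)) (card (S \<union> T))"
        unfolding tuple_module_eq card_Un_disjoint[OF fin] using G
        by (intro ext_relations_append(1)[OF free_module_module free_module_module free_module_inclusion _ _ x])
          (auto simp: tuples_def intro: free_module_mono[of T "S \<union> T"]) }
    { assume x: "x \<in> ext_relations R (free_module R T) (card T)" and F: "F \<in> tuples S"
      show "concat_mult R (free_module R (tuples (S \<union> T))) (basis_vec R F) x
        \<in> ext_relations R (free_module R (S \<union> T)) (card (S \<union> T))"
        unfolding tuple_module_eq card_Un_disjoint[OF fin] using F
        by (intro ext_relations_append(2)[OF free_module_module free_module_module free_module_inclusion _ _ x])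
          (auto simp: tuples_def intro: free_module_mono[of S "S \<union> T"]) } }
  { assume "finite I" and \<sigma>: "inj_on \<sigma> I" and x: "x \<in> ext_relations R (free_module R I) (card I)"
    show "lin_ext R (free_module R (tuples (\<sigma> ` I))) (\<lambda>F. basis_vec R (map (vec_map I \<sigma>) F)) x
      \<in> ext_relations R (free_module R (\<sigma> ` I)) (card (\<sigma> ` I))"
      unfolding tuple_module_eq card_image[OF \<sigma>]
      by (rule ext_relations_map[OF free_module_module free_module_module vec_map_linear x]) }
qed

lemma signed_exp_presented:
  "presented_algebra R tuples (\<lambda>I. ext_relations R (free_module R I) (card I)) vec_map
    (desuspension (signed_exp R))"
proof -
  interpret W: word_presentation R tuples "\<lambda>I. ext_relations R (free_module R I) (card I)" vec_map
    by (rule tuples_presentation)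
  show ?thesis
  proof (intro presented_algebra.intro tuples_presentation presented_algebra_axioms.intro)
    fix I S T :: "'i set" and \<sigma> :: "'i \<Rightarrow> 'i" and m n x y
    let ?X = "desuspension (signed_exp R)"
    show obj_eq: "obj ?X I n = concentrated (int (card I)) (W.Q I) n" for I :: "'i set" and n
      by (simp add: desuspension_def signed_exp_def concentrated_def ext_power_def tuple_module_eq)
    show "act ?X I n \<sigma> x = W.qrelabel I \<sigma> x" if "inj_on \<sigma> I"
      using that
      by (simp add: desuspension_def signed_exp_def ext_map_def tuple_module_eq card_image)
    show "unit ?X = ext_relations R (free_module R {}) (card {}) +>\<^bsub>W.P {}\<^esub> basis_vec R []"
      by (simp add: desuspension_def signed_exp_def tuple_module_eq)
    assume fin: "finite S" "finite T" "S \<inter> T = {}"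
      and x: "x \<in> carrier (obj ?X S m)" and y: "y \<in> carrier (obj ?X T n)"
    define z where "z = W.qmult S T x y"
    define k where "k = m - int (card S) + (n - int (card T))"
    have "mul ?X S T m n x y = (if even ((m - int (card S)) * int (card T)) then z
        else \<ominus>\<^bsub>concentrated 0 (W.Q (S \<union> T)) k\<^esub> z)"
      by (simp add: desuspension_def signed_exp_def ext_product_def tuple_module_eq
          card_Un_disjoint[OF fin] z_def k_def ext_power_def Let_def)
    moreover have "\<ominus>\<^bsub>concentrated 0 (W.Q (S \<union> T)) k\<^esub> z = z" if "m \<noteq> int (card S)"
    proof -
      \<comment> \<open>Off degree \<open>|S|\<close> the factor \<open>x\<close> vanishes, and the Koszul sign is applied to zero.\<close>
      have fU: "finite (S \<union> T)" using fin by simp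
      have "x = \<zero>\<^bsub>W.Q S\<^esub>" using x that by (simp add: obj_eq concentrated_def)
      moreover have "y \<in> carrier (W.Q T)"
        using y concentrated_subset[OF W.Q_module[OF fin(2)]] by (auto simp: obj_eq)
      ultimately have "z = \<zero>\<^bsub>W.Q (S \<union> T)\<^esub>"
        using bilinear_map_zero(2)[OF W.qmult_bilinear[OF fin] W.Q_module W.Q_module W.Q_module]
          fin fU unfolding z_def by blast
      then have z: "z = \<zero>\<^bsub>concentrated 0 (W.Q (S \<union> T)) k\<^esub>" by (simp add: concentrated_simps)
      interpret C: abelian_group "concentrated 0 (W.Q (S \<union> T)) k"
        by (rule module.axioms(2)[OF concentrated_module[OF W.Q_module[OF fU]]])
      show ?thesis unfolding z by (rule C.minus_equality) simp_all
    qed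
    ultimately show "mul ?X S T m n x y = W.qmult S T x y" unfolding z_def by (cases "m = int (card S)") simp_all
  qed
qed

end


section \<open>Compositions into singletons\<close>

lemma compositions_iff:
  "F \<in> compositions I \<longleftrightarrow> {} \<notin> set F \<and> sorted_wrt (\<lambda>A B. A \<inter> B = {}) F \<and> \<Union>(set F) = I"
proof -
  have "(\<forall>i<length F. \<forall>j<length F. i \<noteq> j \<longrightarrow> F ! i \<inter> F ! j = {}) \<longleftrightarrow>
    sorted_wrt (\<lambda>A B. A \<inter> B = {}) F"
    unfolding sorted_wrt_iff_nth_less
  proof (intro iffI allI impI)
    fix i j assume *: "\<forall>i j. i < j \<longrightarrow> j < length F \<longrightarrow> F ! i \<inter> F ! j = {}"
      and "i < length F" "j < length F" "i \<noteq> j"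
    then show "F ! i \<inter> F ! j = {}"
      using *[rule_format, of i j] *[rule_format, of j i] by (cases i j rule: linorder_cases) auto
  qed auto
  then show ?thesis unfolding compositions_def by auto
qed

lemma compositions_Nil: "[] \<in> compositions I \<longleftrightarrow> I = {}"
  by (auto simp: compositions_iff)

lemma compositions_Cons:
  "A # F \<in> compositions I \<longleftrightarrow> A \<noteq> {} \<and> A \<subseteq> I \<and> F \<in> compositions (I - A)"
  by (auto simp: compositions_iff)

lemma compositions_split_block:
  assumes "F @ [C] @ G \<in> compositions I" "(A, B) \<in> splittings C"
  shows "F @ [A, B] @ G \<in> compositions I"
  using assms by (auto simp: compositions_iff splittings_def sorted_wrt_append)

lemma compositions_append:
  assumes "S \<inter> T = {}" "F \<in> compositions S" "G \<in> compositions T"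
  shows "F @ G \<in> compositions (S \<union> T)"
  using assms by (auto simp: compositions_iff sorted_wrt_append)

definition orders :: "'a set \<Rightarrow> 'a list set" where
  "orders I = {is. distinct is \<and> set is = I}"

abbreviation singletons :: "'a list \<Rightarrow> 'a set list" where
  "singletons \<equiv> map (\<lambda>i. {i})"

lemma singletons_compositions: "singletons is \<in> compositions I \<longleftrightarrow> is \<in> orders I"
proof (induction "is" arbitrary: I)
  case (Cons i "is")
  have "is \<in> orders (I - {i}) \<and> i \<in> I \<longleftrightarrow> i # is \<in> orders I" by (auto simp: orders_def)
  then show ?case using Cons by (auto simp: compositions_Cons)
qed (auto simp: compositions_Nil orders_def)

lemma orders_length: "is \<in> orders I \<Longrightarrow> length is = card I"
  by (auto simp: orders_def distinct_card)

lemma composition_card_Cons: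
  assumes "finite I" "A # F \<in> compositions I"
  shows "card I = card A + card (I - A)" "card A > 0"
proof -
  have A: "A \<subseteq> I" "A \<noteq> {}" using assms by (auto simp: compositions_Cons)
  then have fA: "finite A" using assms finite_subset by blast
  show "card A > 0" using A fA by (simp add: card_gt_0_iff)
  show "card I = card A + card (I - A)"
    using A fA assms card_mono[OF assms(1) A(1)] by (simp add: card_Diff_subset)
qed

lemma compositions_length_le:
  assumes "finite I" "F \<in> compositions I"
  shows "length F \<le> card I"
  using assms
proof (induction F arbitrary: I)
  case (Cons A F)
  have "length F \<le> card (I - A)" using Cons by (simp add: compositions_Cons)
  then show ?case using composition_card_Cons[OF Cons.prems] by simp
qed simp

lemma compositions_length_eq:
  assumes "finite I" "F \<in> compositions I" "length F = card I"
  obtains "is" where "is \<in> orders I" "F = singletons is"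
proof -
  have "\<exists>is. F = singletons is"
    using assms
  proof (induction F arbitrary: I)
    case (Cons A F)
    have F: "F \<in> compositions (I - A)" using Cons.prems by (simp add: compositions_Cons)
    note c = composition_card_Cons[OF Cons.prems(1,2)]
    have "length F \<le> card (I - A)" using compositions_length_le[OF _ F] Cons.prems by simp
    then have "card A = 1" "length F = card (I - A)" using c Cons.prems(3) by auto
    moreover then obtain "is" where "F = singletons is" using Cons.IH[of "I - A"] F Cons.prems by auto
    moreover obtain a where "A = {a}" using \<open>card A = 1\<close> card_1_singletonE by blast
    ultimately have "A # F = singletons (a # is)" by simp
    then show ?case by (rule exI)
  qed simp
  then show thesis using that assms(2) singletons_compositions by blast
qed

text \<open>
  The blocks have \<open>|I|\<close> elements altogether and number \<open>|I| - 1\<close>, so one block has size two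
  and the others have size one.
\<close>

lemma compositions_length_Suc:
  assumes "finite I" "F \<in> compositions I" "Suc (length F) = card I"
  obtains xs a b ys where "xs @ a # b # ys \<in> orders I"
    "F = singletons xs @ [{a, b}] @ singletons ys"
proof -
  have "\<exists>xs a b ys. xs @ a # b # ys \<in> orders I \<and> F = singletons xs @ [{a, b}] @ singletons ys"
    using assms
  proof (induction F arbitrary: I)
    case Nil
    then show ?case by (simp add: compositions_Nil)
  next
    case (Cons A F)
    have F: "F \<in> compositions (I - A)" and A: "A \<subseteq> I" using Cons.prems by (auto simp: compositions_Cons)
    note c = composition_card_Cons[OF Cons.prems(1,2)]
    have fin: "finite (I - A)" using Cons.prems by simp
    have le: "length F \<le> card (I - A)" by (rule compositions_length_le[OF fin F])
    show ?case
    proof (cases "card A = 1")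
      case True
      then obtain i where i: "A = {i}" by (rule card_1_singletonE)
      obtain xs a b ys where *: "xs @ a # b # ys \<in> orders (I - A)"
        "F = singletons xs @ [{a, b}] @ singletons ys"
        using Cons.IH[OF fin F] c Cons.prems(3) True by auto
      then have "(i # xs) @ a # b # ys \<in> orders I" "A # F = singletons (i # xs) @ [{a, b}] @ singletons ys"
        using A i by (auto simp: orders_def)
      then show ?thesis by blast
    next
      case False
      then have "card A = 2" "length F = card (I - A)" using c Cons.prems(3) le by auto
      then obtain a b where ab: "A = {a, b}" "a \<noteq> b" by (auto simp: card_2_iff)
      obtain ys where ys: "ys \<in> orders (I - A)" "F = singletons ys"
        by (rule compositions_length_eq[OF fin F \<open>length F = card (I - A)\<close>])
      then have "[] @ a # b # ys \<in> orders I" "A # F = singletons [] @ [{a, b}] @ singletons ys"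
        using ab A by (auto simp: orders_def)
      then show ?thesis by blast
    qed
  qed
  then show thesis using that by blast
qed

lemma pair_block_composition:
  assumes "xs @ a # b # ys \<in> orders I"
  shows "singletons xs @ [{a, b}] @ singletons ys \<in> compositions I"
  using assms
proof (induction xs arbitrary: I)
  case Nil
  then show ?case
    using singletons_compositions[of ys "I - {a, b}"] by (auto simp: compositions_Cons orders_def)
next
  case (Cons i xs)
  then have "xs @ a # b # ys \<in> orders (I - {i})" by (auto simp: orders_def)
  then show ?case using Cons by (auto simp: compositions_Cons orders_def)
qed

lemma splittings_singleton: "splittings {i} = {}"
proof -
  have False if AB: "A \<noteq> {}" "B \<noteq> {}" "A \<inter> B = {}" "A \<union> B = {i}" for A B
  proof -
    obtain x y where xy: "x \<in> A" "y \<in> B" using AB by blast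
    then have "x \<in> {i}" "y \<in> {i}" unfolding AB(4)[symmetric] by blast+
    then show False using xy AB(3) by auto
  qed
  then show ?thesis unfolding splittings_def by blast
qed

lemma splittings_pair:
  assumes "a \<noteq> b"
  shows "splittings {a, b} = {({a}, {b}), ({b}, {a})}"
proof
  show "splittings {a, b} \<subseteq> {({a}, {b}), ({b}, {a})}"
  proof
    fix p assume "p \<in> splittings {a, b}"
    then obtain A B where p: "p = (A, B)" "A \<noteq> {}" "B \<noteq> {}" "A \<inter> B = {}" "A \<union> B = {a, b}"
      by (auto simp: splittings_def)
    then have "A \<subseteq> {a, b}" by blast
    then have "A \<in> {{}, {a}, {b}, {a, b}}" by blast
    then show "p \<in> {({a}, {b}), ({b}, {a})}" using p assms by auto
  qed
qed (use assms in \<open>auto simp: splittings_def\<close>)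

definition singleton_compositions :: "'a set \<Rightarrow> 'a set list set" where
  "singleton_compositions I = {F \<in> compositions I. int (length F) - int (card I) = 0}"

lemma singleton_compositions_iff:
  assumes "finite I"
  shows "F \<in> singleton_compositions I \<longleftrightarrow> (\<exists>is\<in>orders I. F = singletons is)"
proof
  assume "F \<in> singleton_compositions I"
  then have "F \<in> compositions I" "length F = card I" by (auto simp: singleton_compositions_def)
  then show "\<exists>is\<in>orders I. F = singletons is" using compositions_length_eq[OF assms] by blast
next
  assume "\<exists>is\<in>orders I. F = singletons is"
  then show "F \<in> singleton_compositions I"
    by (auto simp: singleton_compositions_def singletons_compositions orders_length)
qed


section \<open>The relations of the Koszul dual algebra\<close>

abbreviation cobar_diff where "cobar_diff R \<equiv> diff (cobar_exp R)"

text \<open>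
  The sum is written with values instead of the addition of a free module, whose record would
  have to name a basis.
\<close>

definition swap_relators :: "('k, 'r) ring_scheme \<Rightarrow> 'a set \<Rightarrow> ('a set list \<Rightarrow> 'k) set" where
  "swap_relators R I = {\<lambda>F. basis_vec R (singletons (xs @ a # b # ys)) F
      \<oplus>\<^bsub>R\<^esub> basis_vec R (singletons (xs @ b # a # ys)) F | xs a b ys. xs @ a # b # ys \<in> orders I}"

context cring begin

lemma cobar_obj_module: "module R (cobar_obj R I n)"
  unfolding cobar_obj_def by (rule free_module_module)

lemma cobar_diff_def: "cobar_diff R I n = lin_ext R (cobar_obj R I (n + 1))
        (\<lambda>F. \<Oplus>\<^bsub>cobar_obj R I (n + 1)\<^esub>i\<in>{1..length F}.
           ((\<ominus> \<one>) [^] i) \<odot>\<^bsub>cobar_obj R I (n + 1)\<^esub>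
             (\<Oplus>\<^bsub>cobar_obj R I (n + 1)\<^esub>p\<in>splittings (F ! (i - 1)).
                basis_vec R (take (i - 1) F @ [fst p, snd p] @ drop i F)))"
  by (simp add: cobar_exp_def)

lemma split_block_closed:
  assumes F: "F \<in> compositions I" "int (length F) - int (card I) = n"
    and i: "i \<in> {1..length F}" and p: "p \<in> splittings (F ! (i - 1))"
  shows "basis_vec R (take (i - 1) F @ [fst p, snd p] @ drop i F) \<in> carrier (cobar_obj R I (n + 1))"
proof -
  have "i - 1 < length F" "Suc (i - 1) = i" using i by auto
  then have "F = take (i - 1) F @ [F ! (i - 1)] @ drop i F"
    using id_take_nth_drop[of "i - 1" F] by simp
  then have "take (i - 1) F @ [fst p, snd p] @ drop i F \<in> compositions I"
    using compositions_split_block[of "take (i - 1) F" "F ! (i - 1)" "drop i F" I "fst p" "snd p"] F p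
    by simp
  then show ?thesis
    unfolding cobar_obj_def using F i by (intro basis_vec_closed) auto
qed

lemma cobar_diff_values_closed:
  assumes F: "F \<in> compositions I" "int (length F) - int (card I) = n"
  shows "(\<Oplus>\<^bsub>cobar_obj R I (n + 1)\<^esub>i\<in>{1..length F}.
           ((\<ominus> \<one>) [^] i) \<odot>\<^bsub>cobar_obj R I (n + 1)\<^esub>
             (\<Oplus>\<^bsub>cobar_obj R I (n + 1)\<^esub>p\<in>splittings (F ! (i - 1)).
                basis_vec R (take (i - 1) F @ [fst p, snd p] @ drop i F)))
      \<in> carrier (cobar_obj R I (n + 1))"
proof -
  interpret C: module R "cobar_obj R I (n + 1)" by (rule cobar_obj_module)
  show ?thesis
    using split_block_closed[OF F] by (intro C.finsum_closed C.smult_closed Pi_I) auto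
qed

lemma cobar_diff_linear:
  "linear_map R (cobar_obj R I n) (cobar_obj R I (n + 1)) (cobar_diff R I n)"
  unfolding cobar_diff_def cobar_obj_def[of R I n]
  by (intro lin_ext_linear cobar_obj_module Pi_I cobar_diff_values_closed) auto

text \<open>
  A singleton has no splittings, so the sum over the blocks reduces to the block \<open>{a, b}\<close>. Its two
  splittings come with the same sign, which is determined by the position of the block.
\<close>

lemma cobar_diff_pair_block:
  assumes o: "xs @ a # b # ys \<in> orders I"
  shows "cobar_diff R I (-1) (basis_vec R (singletons xs @ [{a, b}] @ singletons ys))
    = ((\<ominus> \<one>) [^] Suc (length xs)) \<odot>\<^bsub>cobar_obj R I 0\<^esub>
        (\<lambda>F. basis_vec R (singletons (xs @ a # b # ys)) F \<oplus> basis_vec R (singletons (xs @ b # a # ys)) F)"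
proof -
  let ?F = "singletons xs @ [{a, b}] @ singletons ys" and ?C = "cobar_obj R I 0"
  interpret C: module R ?C by (rule cobar_obj_module)
  have F: "?F \<in> compositions I" by (rule pair_block_composition[OF o])
  have deg: "int (length ?F) - int (card I) = -1" using orders_length[OF o] by simp
  have ab: "a \<noteq> b" using o by (auto simp: orders_def)
  have o': "xs @ b # a # ys \<in> orders I" using o by (auto simp: orders_def)
  have bc: "basis_vec R (singletons is) \<in> carrier ?C" if "is \<in> orders I" for "is"
    unfolding cobar_obj_def using that orders_length[OF that] singletons_compositions[of "is" I]
    by (intro basis_vec_closed) auto
  \<comment> \<open>Blocks are counted from one, so \<open>{a, b}\<close> is block number \<open>k\<close>.\<close>
  define k where "k = Suc (length xs)"
  define g where "g = (\<lambda>i. ((\<ominus> \<one>) [^] i) \<odot>\<^bsub>?C\<^esub> (\<Oplus>\<^bsub>?C\<^esub>p\<in>splittings (?F ! (i - 1)).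
                basis_vec R (take (i - 1) ?F @ [fst p, snd p] @ drop i ?F)))"
  have g_closed: "g i \<in> carrier ?C" if "i \<in> {1..length ?F}" for i
    unfolding g_def using split_block_closed[OF F deg that]
    by (intro C.smult_closed C.finsum_closed Pi_I) auto
  have "cobar_diff R I (-1) (basis_vec R ?F) = (\<Oplus>\<^bsub>?C\<^esub>i\<in>{1..length ?F}. g i)"
    unfolding cobar_diff_def g_def
    using cobar_diff_values_closed[OF F deg] by (subst lin_ext_basis[OF cobar_obj_module]) simp_all
  also have "\<dots> = (\<Oplus>\<^bsub>?C\<^esub>i\<in>{1..length ?F}. if k = i then g i else \<zero>\<^bsub>?C\<^esub>)"
  proof (rule C.M.finsum_cong')
    fix i assume i: "i \<in> {1..length ?F}"
    show "g i = (if k = i then g i else \<zero>\<^bsub>?C\<^esub>)"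
    proof (cases "k = i")
      case False
      have "\<exists>j. ?F ! (i - 1) = {j}"
      proof (cases "i - 1 < length xs")
        case False
        then have "i - 1 - length xs > 0" "i - 1 - length xs - 1 < length ys"
          using \<open>k \<noteq> i\<close> i by (auto simp: k_def)
        then show ?thesis using False by (auto simp: nth_append nth_Cons split: nat.splits)
      qed (simp add: nth_append)
      then have "splittings (?F ! (i - 1)) = {}" by (metis splittings_singleton)
      then have "g i = \<zero>\<^bsub>?C\<^esub>" unfolding g_def by simp
      then show ?thesis using False by simp
    qed simp
  qed (use g_closed in auto)
  also have "\<dots> = g k"
    by (rule C.M.finsum_singleton) (use g_closed in \<open>auto simp: k_def\<close>)
  also have "g k = ((\<ominus> \<one>) [^] k) \<odot>\<^bsub>?C\<^esub> (\<Oplus>\<^bsub>?C\<^esub>p\<in>{({a}, {b}), ({b}, {a})}.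
      basis_vec R (singletons xs @ [fst p, snd p] @ singletons ys))"
    using splittings_pair[OF ab] unfolding g_def k_def by (simp add: nth_append)
  also have "(\<Oplus>\<^bsub>?C\<^esub>p\<in>{({a}, {b}), ({b}, {a})}.
      basis_vec R (singletons xs @ [fst p, snd p] @ singletons ys))
    = basis_vec R (singletons (xs @ a # b # ys)) \<oplus>\<^bsub>?C\<^esub> basis_vec R (singletons (xs @ b # a # ys))"
    using ab bc[OF o] bc[OF o'] by (subst C.M.finsum_insert) (auto simp: C.M.finsum_insert)
  finally show ?thesis by (simp add: k_def cobar_obj_def free_module_simps)
qed

lemma sign_square: "((\<ominus> \<one>) [^] (k::nat)) \<otimes> ((\<ominus> \<one>) [^] k) = \<one>"
proof (induction k)
  case (Suc k)
  have "((\<ominus> \<one>) [^] Suc k) \<otimes> ((\<ominus> \<one>) [^] Suc k)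
      = ((\<ominus> \<one>) [^] k \<otimes> (\<ominus> \<one>) [^] k) \<otimes> ((\<ominus> \<one>) \<otimes> (\<ominus> \<one>))"
    by (simp add: m_ac)
  then show ?case using Suc by (simp add: l_minus r_minus)
qed simp

abbreviation koszul_relations :: "'i set \<Rightarrow> ('i set list \<Rightarrow> 'a) set" where
  "koszul_relations I \<equiv> coboundaries (cobar_exp R) I 0"

lemma cobar_obj_0: "cobar_obj R I 0 = free_module R (singleton_compositions I)"
  by (simp add: cobar_obj_def singleton_compositions_def)

lemma singletons_closed:
  "is \<in> orders I \<Longrightarrow> basis_vec R (singletons is) \<in> carrier (free_module R (singleton_compositions I))"
  using orders_length[of "is" I] singletons_compositions[of "is" I]
  by (intro basis_vec_closed) (simp add: singleton_compositions_def)

lemma swap_relators_closed: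
  "swap_relators R I \<subseteq> carrier (free_module R (singleton_compositions I))"
proof
  fix g assume "g \<in> swap_relators R I"
  then obtain xs a b ys where o: "xs @ a # b # ys \<in> orders I"
    and g: "g = (\<lambda>F. basis_vec R (singletons (xs @ a # b # ys)) F \<oplus> basis_vec R (singletons (xs @ b # a # ys)) F)"
    unfolding swap_relators_def by blast
  have o': "xs @ b # a # ys \<in> orders I" using o by (auto simp: orders_def)
  show "g \<in> carrier (free_module R (singleton_compositions I))"
    using abelian_monoid.a_closed[OF abelian_group.axioms(1)[OF module.axioms(2)[OF free_module_module]]
        singletons_closed[OF o] singletons_closed[OF o']] g by (simp add: free_module_simps)
qed

text \<open>
  The differential of a composition with one block of two elements is a sign times a swap
  relator. Signs are units, so these differentials and the swap relators span the same submodule.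
\<close>

lemma koszul_relations_eq:
  assumes I: "finite I"
  shows "koszul_relations I
    = submodule_span R (free_module R (singleton_compositions I)) (swap_relators R I)"
proof
  let ?P = "free_module R (singleton_compositions I)"
  let ?G = "\<lambda>xs a b ys F. basis_vec R (singletons (xs @ a # b # ys)) F
    \<oplus> basis_vec R (singletons (xs @ b # a # ys)) F"
  note P = free_module_module[of "singleton_compositions I"]
  have lin: "linear_map R (cobar_obj R I (-1)) ?P (cobar_diff R I (-1))"
    using cobar_diff_linear[of I "-1"] by (simp add: cobar_obj_0)
  have eq: "koszul_relations I = cobar_diff R I (-1) ` carrier (cobar_obj R I (-1))"
    by (simp add: coboundaries_def cobar_exp_def)
  have span: "submodule (submodule_span R ?P (swap_relators R I)) R ?P"
    by (rule submodule_span_submodule[OF P swap_relators_closed])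
  show "koszul_relations I \<subseteq> submodule_span R ?P (swap_relators R I)"
  proof
    fix y assume "y \<in> koszul_relations I"
    then obtain x where x: "x \<in> carrier (cobar_obj R I (-1))" "y = cobar_diff R I (-1) x"
      unfolding eq by blast
    have "x \<in> {x \<in> carrier (cobar_obj R I (-1)). cobar_diff R I (-1) x \<in> submodule_span R ?P (swap_relators R I)}"
    proof (rule free_module_induct[OF linear_map_vimage_submodule[OF lin cobar_obj_module P span,
            unfolded cobar_obj_def] _ x(1)[unfolded cobar_obj_def], folded cobar_obj_def])
      fix F assume F: "F \<in> {F \<in> compositions I. int (length F) - int (card I) = - 1}"
      then have c: "F \<in> compositions I" "Suc (length F) = card I" by auto
      obtain xs a b ys where o: "xs @ a # b # ys \<in> orders I"
        and Fe: "F = singletons xs @ [{a, b}] @ singletons ys"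
        by (rule compositions_length_Suc[OF I c])
      have "?G xs a b ys \<in> submodule_span R ?P (swap_relators R I)"
        using o by (intro subsetD[OF submodule_span_superset]) (auto simp: swap_relators_def)
      then have "cobar_diff R I (-1) (basis_vec R F) \<in> submodule_span R ?P (swap_relators R I)"
        unfolding Fe cobar_diff_pair_block[OF o] cobar_obj_0
        by (intro submoduleD(6)[OF span P]) simp_all
      moreover have "basis_vec R F \<in> carrier (cobar_obj R I (-1))"
        unfolding cobar_obj_def by (rule basis_vec_closed[OF F])
      ultimately show "basis_vec R F \<in> {x \<in> carrier (cobar_obj R I (-1)).
          cobar_diff R I (-1) x \<in> submodule_span R ?P (swap_relators R I)}" by simp
    qed
    then show "y \<in> submodule_span R ?P (swap_relators R I)" using x by simp
  qed
  have sub: "submodule (koszul_relations I) R ?P"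
    unfolding eq by (rule linear_map_image_submodule[OF lin cobar_obj_module P])
  show "submodule_span R ?P (swap_relators R I) \<subseteq> koszul_relations I"
  proof (rule submodule_span_least[OF sub subsetI])
    fix g assume gs: "g \<in> swap_relators R I"
    then obtain xs a b ys where o: "xs @ a # b # ys \<in> orders I" and g: "g = ?G xs a b ys"
      unfolding swap_relators_def by blast
    let ?F = "singletons xs @ [{a, b}] @ singletons ys"
    let ?s = "(\<ominus> \<one>) [^] Suc (length xs)"
    have s: "?s \<in> carrier R" by simp
    have "basis_vec R ?F \<in> carrier (cobar_obj R I (-1))"
      unfolding cobar_obj_def using pair_block_composition[OF o] orders_length[OF o]
      by (intro basis_vec_closed) simp
    then have "?s \<odot>\<^bsub>?P\<^esub> g \<in> koszul_relations I"
      unfolding eq g cobar_obj_0[symmetric] cobar_diff_pair_block[OF o, symmetric] by (rule imageI)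
    \<comment> \<open>The sign is its own inverse; multiplying by it once more recovers the relator.\<close>
    then have "?s \<odot>\<^bsub>?P\<^esub> (?s \<odot>\<^bsub>?P\<^esub> g) \<in> koszul_relations I"
      by (rule submoduleD(6)[OF sub P s])
    moreover have "?s \<odot>\<^bsub>?P\<^esub> (?s \<odot>\<^bsub>?P\<^esub> g) = g"
    proof -
      have gc: "g \<in> carrier ?P" using swap_relators_closed gs by blast
      have "?s \<odot>\<^bsub>?P\<^esub> (?s \<odot>\<^bsub>?P\<^esub> g) = (?s \<otimes> ?s) \<odot>\<^bsub>?P\<^esub> g"
        by (rule module.smult_assoc1[OF P s s gc, symmetric])
      also have "\<dots> = g" unfolding sign_square by (rule module.smult_one[OF P gc])
      finally show ?thesis .
    qed
    ultimately show "g \<in> koszul_relations I" by simp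
  qed
qed

lemma koszul_relations_submodule:
  assumes "finite I"
  shows "submodule (koszul_relations I) R (free_module R (singleton_compositions I))"
  unfolding koszul_relations_eq[OF assms]
  by (rule submodule_span_submodule[OF free_module_module swap_relators_closed])

lemma swap_in_koszul_relations:
  assumes "finite I" "xs @ a # b # ys \<in> orders I"
  shows "basis_vec R (singletons (xs @ a # b # ys)) \<oplus>\<^bsub>free_module R (singleton_compositions I)\<^esub>
    basis_vec R (singletons (xs @ b # a # ys)) \<in> koszul_relations I"
  unfolding koszul_relations_eq[OF assms(1)] free_module_simps
  using assms(2) by (intro subsetD[OF submodule_span_superset]) (auto simp: swap_relators_def)

lemma koszul_relations_induced:
  assumes I: "finite I" and P: "module R P" and K: "submodule K R P"
    and f: "linear_map R (free_module R (singleton_compositions I)) P f"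
    and v: "\<And>is. is \<in> orders I \<Longrightarrow> f (basis_vec R (singletons is)) = v is"
    and swap: "\<And>xs a b ys. xs @ a # b # ys \<in> orders I \<Longrightarrow>
      v (xs @ a # b # ys) \<oplus>\<^bsub>P\<^esub> v (xs @ b # a # ys) \<in> K"
    and t: "t \<in> koszul_relations I"
  shows "f t \<in> K"
proof (rule linear_map_span[OF f free_module_module P K swap_relators_closed _
      t[unfolded koszul_relations_eq[OF I]]])
  fix g assume "g \<in> swap_relators R I"
  then obtain xs a b ys where o: "xs @ a # b # ys \<in> orders I"
    and g: "g = basis_vec R (singletons (xs @ a # b # ys)) \<oplus>\<^bsub>free_module R (singleton_compositions I)\<^esub>
      basis_vec R (singletons (xs @ b # a # ys))"
    unfolding swap_relators_def free_module_simps by blast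
  have o': "xs @ b # a # ys \<in> orders I" using o by (auto simp: orders_def)
  show "f g \<in> K"
    using linear_mapD(2)[OF f singletons_closed[OF o] singletons_closed[OF o']] swap[OF o] v[OF o] v[OF o'] g
    by simp
qed

lemma orders_append:
  "S \<inter> T = {} \<Longrightarrow> is \<in> orders S \<Longrightarrow> js \<in> orders T \<Longrightarrow> is @ js \<in> orders (S \<union> T)"
  by (auto simp: orders_def)

lemma orders_map: "inj_on \<sigma> I \<Longrightarrow> is \<in> orders I \<Longrightarrow> map \<sigma> is \<in> orders (\<sigma> ` I)"
  by (auto simp: orders_def distinct_map)

lemma singletons_map: "map ((`) \<sigma>) (singletons is) = singletons (map \<sigma> is)"
  by simp

lemma singleton_compositions_append:
  assumes "finite S" "finite T" "S \<inter> T = {}" "F \<in> singleton_compositions S" "G \<in> singleton_compositions T"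
  shows "F @ G \<in> singleton_compositions (S \<union> T)"
  using assms compositions_append[of S T F G]
  by (auto simp: singleton_compositions_def card_Un_disjoint)

lemma singleton_compositions_map:
  assumes "finite I" "inj_on \<sigma> I" "F \<in> singleton_compositions I"
  shows "map ((`) \<sigma>) F \<in> singleton_compositions (\<sigma> ` I)"
proof -
  obtain "is" where o: "is \<in> orders I" and F: "F = singletons is"
    using assms singleton_compositions_iff by blast
  have "finite (\<sigma> ` I)" using assms by simp
  then show ?thesis
    using orders_map[OF assms(2) o] singleton_compositions_iff[of "\<sigma> ` I"]
    unfolding F singletons_map by blast
qed

lemma koszul_presentation:
  "word_presentation R singleton_compositions koszul_relations (\<lambda>I. (`))"
proof (intro word_presentation.intro word_presentation_axioms.intro is_cring)
  fix I S T :: "'i set" and \<sigma> \<tau> :: "'i \<Rightarrow> 'i" and F G b x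
  show "[] \<in> singleton_compositions {}" by (simp add: singleton_compositions_def compositions_Nil)
  have sub: "b \<subseteq> I" if "F \<in> singleton_compositions I" "b \<in> set F" for F b and I :: "'i set"
    using that by (auto simp: singleton_compositions_def compositions_iff)
  { assume "finite I" "inj_on \<sigma> I" "\<And>i. i \<in> I \<Longrightarrow> \<sigma> i = \<tau> i" "F \<in> singleton_compositions I" "b \<in> set F"
    then show "\<sigma> ` b = \<tau> ` b" using sub[of F I b] by (intro image_cong) auto }
  { assume "finite S" "finite T" "S \<inter> T = {}" "F \<in> singleton_compositions S" "G \<in> singleton_compositions T"
    then show "F @ G \<in> singleton_compositions (S \<union> T)" by (rule singleton_compositions_append) }
  { assume "finite I" "inj_on \<sigma> I" "F \<in> singleton_compositions I"
    then show "map ((`) \<sigma>) F \<in> singleton_compositions (\<sigma> ` I)" by (rule singleton_compositions_map) }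
  { assume "finite I"
    then show "submodule (koszul_relations I) R (free_module R (singleton_compositions I))"
      by (rule koszul_relations_submodule) }
  { assume fin: "finite S" "finite T" "S \<inter> T = {}"
    then have finU: "finite (S \<union> T)" by simp
    let ?P = "\<lambda>I. free_module R (singleton_compositions I)"
    have bil: "bilinear_map R (?P S) (?P T) (?P (S \<union> T)) (concat_mult R (?P (S \<union> T)))"
      using fin by (intro concat_mult_bilinear singleton_compositions_append)
    have mult: "concat_mult R (?P (S \<union> T)) (basis_vec R (singletons is)) (basis_vec R (singletons js))
        = basis_vec R (singletons (is @ js))" if "is \<in> orders S" "js \<in> orders T" for "is" js
      unfolding map_append using that fin
      by (intro concat_mult_basis singleton_compositions_append) (auto simp: singleton_compositions_iff)
    { assume x: "x \<in> koszul_relations S" and G: "G \<in> singleton_compositions T"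
      obtain zs where zs: "zs \<in> orders T" "G = singletons zs"
        using G fin singleton_compositions_iff by blast
      have bG: "basis_vec R G \<in> carrier (?P T)" by (rule basis_vec_closed[OF G])
      show "concat_mult R (?P (S \<union> T)) x (basis_vec R G) \<in> koszul_relations (S \<union> T)"
      proof (rule koszul_relations_induced[OF fin(1) free_module_module koszul_relations_submodule[OF finU]
            bilinear_mapD(2)[OF bil bG] _ _ x])
        show "concat_mult R (?P (S \<union> T)) (basis_vec R (singletons is)) (basis_vec R G)
          = basis_vec R (singletons (is @ zs))" if "is \<in> orders S" for "is"
          unfolding zs(2) by (rule mult[OF that zs(1)])
        fix xs a b ys assume "xs @ a # b # ys \<in> orders S"
        then show "basis_vec R (singletons ((xs @ a # b # ys) @ zs)) \<oplus>\<^bsub>?P (S \<union> T)\<^esub>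
            basis_vec R (singletons ((xs @ b # a # ys) @ zs)) \<in> koszul_relations (S \<union> T)"
          using swap_in_koszul_relations[OF finU, of xs a b "ys @ zs"]
            orders_append[OF fin(3) _ zs(1), of "xs @ a # b # ys"] by simp
      qed }
    { assume x: "x \<in> koszul_relations T" and F: "F \<in> singleton_compositions S"
      obtain zs where zs: "zs \<in> orders S" "F = singletons zs"
        using F fin singleton_compositions_iff by blast
      have bF: "basis_vec R F \<in> carrier (?P S)" by (rule basis_vec_closed[OF F])
      show "concat_mult R (?P (S \<union> T)) (basis_vec R F) x \<in> koszul_relations (S \<union> T)"
      proof (rule koszul_relations_induced[OF fin(2) free_module_module koszul_relations_submodule[OF finU]
            bilinear_mapD(1)[OF bil bF] _ _ x])
        show "concat_mult R (?P (S \<union> T)) (basis_vec R F) (basis_vec R (singletons is))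
          = basis_vec R (singletons (zs @ is))" if "is \<in> orders T" for "is"
          unfolding zs(2) by (rule mult[OF zs(1) that])
        fix xs a b ys assume "xs @ a # b # ys \<in> orders T"
        then show "basis_vec R (singletons (zs @ xs @ a # b # ys)) \<oplus>\<^bsub>?P (S \<union> T)\<^esub>
            basis_vec R (singletons (zs @ xs @ b # a # ys)) \<in> koszul_relations (S \<union> T)"
          using swap_in_koszul_relations[OF finU, of "zs @ xs" a b ys] orders_append[OF fin(3) zs(1)]
          by auto
      qed } }
  { assume I: "finite I" and \<sigma>: "inj_on \<sigma> I" and x: "x \<in> koszul_relations I"
    let ?P = "free_module R (singleton_compositions (\<sigma> ` I))"
    have I': "finite (\<sigma> ` I)" using I by simp
    show "lin_ext R ?P (\<lambda>F. basis_vec R (map ((`) \<sigma>) F)) x \<in> koszul_relations (\<sigma> ` I)"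
    proof (rule koszul_relations_induced[OF I free_module_module koszul_relations_submodule[OF I'] _ _ _ x])
      show "linear_map R (free_module R (singleton_compositions I)) ?P
          (lin_ext R ?P (\<lambda>F. basis_vec R (map ((`) \<sigma>) F)))"
        using singleton_compositions_map[OF I \<sigma>]
        by (intro lin_ext_linear free_module_module) (auto intro: basis_vec_closed)
      fix "is" assume "is \<in> orders I"
      then show "lin_ext R ?P (\<lambda>F. basis_vec R (map ((`) \<sigma>) F)) (basis_vec R (singletons is))
          = basis_vec R (singletons (map \<sigma> is))"
        using singletons_closed[OF orders_map[OF \<sigma>]]
        unfolding singletons_map[symmetric] by (intro lin_ext_basis free_module_module)
    next
      fix xs a b ys assume "xs @ a # b # ys \<in> orders I"
      then show "basis_vec R (singletons (map \<sigma> (xs @ a # b # ys))) \<oplus>\<^bsub>?P\<^esub>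
          basis_vec R (singletons (map \<sigma> (xs @ b # a # ys))) \<in> koszul_relations (\<sigma> ` I)"
        using swap_in_koszul_relations[OF I', of "map \<sigma> xs" "\<sigma> a" "\<sigma> b" "map \<sigma> ys"] orders_map[OF \<sigma>, of "xs @ a # b # ys"]
        by auto
    qed }
qed (simp_all add: image_comp)

text \<open>
  The next cochain module is zero: a composition cannot have more than \<open>|I|\<close> blocks.
\<close>

lemma cocycles_0:
  assumes I: "finite I"
  shows "cocycles (cobar_exp R) I 0 = carrier (cobar_obj R I 0)"
proof -
  have "{F \<in> compositions I. int (length F) - int (card I) = 1} = {}"
    using compositions_length_le[OF I] by fastforce
  then have z: "cobar_obj R I 1 = free_module R {}" by (simp only: cobar_obj_def)
  have "cobar_diff R I 0 x = \<zero>\<^bsub>cobar_obj R I 1\<^esub>" if "x \<in> carrier (cobar_obj R I 0)" for x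
    using linear_mapD(1)[OF cobar_diff_linear[of I 0] that]
    by (auto simp: z free_module_carrier free_module_simps)
  then show ?thesis by (auto simp: cocycles_def cobar_exp_def)
qed

text \<open>
  All degree-zero cochains are cocycles, hence passing to cohomology only divides by the
  coboundaries.
\<close>

lemma koszul_dual_presented:
  "presented_algebra R singleton_compositions koszul_relations (\<lambda>I. (`)) (koszul_dual_exp R)"
proof -
  interpret W: word_presentation R singleton_compositions koszul_relations "\<lambda>I. (`)"
    by (rule koszul_presentation)
  have o: "obj (cobar_exp R) = cobar_obj R" by (simp add: cobar_exp_def)
  have carrier_eq: "M\<lparr>carrier := carrier M\<rparr> = M" for M :: "('a, 'i set list \<Rightarrow> 'a) module" by simp
  show ?thesis
  proof (intro presented_algebra.intro koszul_presentation presented_algebra_axioms.intro)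
    fix I S T :: "'i set" and \<sigma> :: "'i \<Rightarrow> 'i" and m n x y
    show "obj (koszul_dual_exp R) I n = concentrated (int (card I)) (W.Q I) n" if "finite I"
      by (simp add: koszul_dual_exp_def cohomology_def Let_def o cocycles_0[OF that] cobar_obj_0)
    show "act (koszul_dual_exp R) I n \<sigma> x = W.qrelabel I \<sigma> x"
      by (simp add: koszul_dual_exp_def cohomology_def Let_def o cobar_obj_0)
        (simp add: cobar_exp_def cobar_obj_0)
    show "mul (koszul_dual_exp R) S T m n x y = W.qmult S T x y"
      by (simp add: koszul_dual_exp_def cohomology_def Let_def o cobar_obj_0)
        (simp add: cobar_exp_def cobar_obj_0)
    show "unit (koszul_dual_exp R) = koszul_relations {} +>\<^bsub>W.P {}\<^esub> basis_vec R []"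
      by (simp add: koszul_dual_exp_def cohomology_def Let_def o cobar_obj_0)
        (simp add: cobar_exp_def cobar_obj_0)
  qed
qed


section \<open>Spanning tuples of the top exterior power\<close>


text \<open>
  With \<open>s = x + y\<close>, expanding the square \<open>b s s\<close> in both slots gives \<open>b x x + b x y + b y x + b y y\<close>
  up to relations, and all squares in this identity are relations themselves.
\<close>

lemma ext_relations_swap:
  assumes M: "module R M" and len: "length xs + 2 + length ys = n"
    and mem: "set xs \<union> {x, y} \<union> set ys \<subseteq> carrier M"
  shows "basis_vec R (xs @ [x, y] @ ys) \<oplus>\<^bsub>tuple_module R M n\<^esub> basis_vec R (xs @ [y, x] @ ys)
    \<in> ext_relations R M n"
proof -
  let ?T = "tuple_module R M n" and ?K = "ext_relations R M n"
  interpret M: module R M by fact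
  interpret T: module R ?T by (rule tuple_module_module)
  note K = submoduleD[OF ext_relations_submodule[OF M] tuple_module_module]
  define b where "b u v = basis_vec R (xs @ [u, v] @ ys)" for u v
  have c: "b u v \<in> carrier ?T" if "u \<in> carrier M" "v \<in> carrier M" for u v
    unfolding b_def using that len mem by (intro tuple_basis_closed) auto
  have alt: "b u u \<in> ?K" if "u \<in> carrier M" for u
    unfolding b_def using that len mem by (intro ext_relations_alt) auto
  have l: "b (u \<oplus>\<^bsub>M\<^esub> u') v \<ominus>\<^bsub>?T\<^esub> (b u v \<oplus>\<^bsub>?T\<^esub> b u' v) \<in> ?K"
    if "u \<in> carrier M" "u' \<in> carrier M" "v \<in> carrier M" for u u' v
    using ext_relations_add[of xs "v # ys" n u u' M] that len mem by (simp add: b_def)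
  have r: "b u (v \<oplus>\<^bsub>M\<^esub> v') \<ominus>\<^bsub>?T\<^esub> (b u v \<oplus>\<^bsub>?T\<^esub> b u v') \<in> ?K"
    if "u \<in> carrier M" "v \<in> carrier M" "v' \<in> carrier M" for u v v'
    using ext_relations_add[of "xs @ [u]" ys n v v' M] that len mem by (simp add: b_def)
  have x: "x \<in> carrier M" and y: "y \<in> carrier M" using mem by auto
  define s where "s = x \<oplus>\<^bsub>M\<^esub> y"
  have s: "s \<in> carrier M" using x y by (simp add: s_def)
  have cancel: "v \<in> ?K" if "u \<ominus>\<^bsub>?T\<^esub> v \<in> ?K" "u \<in> ?K" "v \<in> carrier ?T" for u v
  proof -
    have "u \<ominus>\<^bsub>?T\<^esub> (u \<ominus>\<^bsub>?T\<^esub> v) \<in> ?K" using K(5) that by blast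
    moreover have "u \<ominus>\<^bsub>?T\<^esub> (u \<ominus>\<^bsub>?T\<^esub> v) = v"
      using K(1)[OF that(2)] that(3)
      by (simp add: a_minus_def T.minus_add T.minus_minus T.a_assoc[symmetric] T.r_neg)
    ultimately show ?thesis by simp
  qed
  have "b x s \<oplus>\<^bsub>?T\<^esub> b y s \<in> ?K"
    by (rule cancel[OF l[OF x y s, folded s_def] alt[OF s]]) (use c x y s in auto)
  moreover have "(b x s \<ominus>\<^bsub>?T\<^esub> (b x x \<oplus>\<^bsub>?T\<^esub> b x y)) \<oplus>\<^bsub>?T\<^esub> (b y s \<ominus>\<^bsub>?T\<^esub> (b y x \<oplus>\<^bsub>?T\<^esub> b y y)) \<in> ?K"
    using K(4) r[OF x x y, folded s_def] r[OF y x y, folded s_def] by blast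
  moreover have "(b x s \<ominus>\<^bsub>?T\<^esub> (b x x \<oplus>\<^bsub>?T\<^esub> b x y)) \<oplus>\<^bsub>?T\<^esub> (b y s \<ominus>\<^bsub>?T\<^esub> (b y x \<oplus>\<^bsub>?T\<^esub> b y y))
    = (b x s \<oplus>\<^bsub>?T\<^esub> b y s) \<ominus>\<^bsub>?T\<^esub> ((b x x \<oplus>\<^bsub>?T\<^esub> b y y) \<oplus>\<^bsub>?T\<^esub> (b x y \<oplus>\<^bsub>?T\<^esub> b y x))"
    using c x y s by (simp add: a_minus_def T.minus_add T.a_ac)
  ultimately have "(b x x \<oplus>\<^bsub>?T\<^esub> b y y) \<oplus>\<^bsub>?T\<^esub> (b x y \<oplus>\<^bsub>?T\<^esub> b y x) \<in> ?K"
    using cancel[of "b x s \<oplus>\<^bsub>?T\<^esub> b y s"] c x y s by simp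
  then have "((b x x \<oplus>\<^bsub>?T\<^esub> b y y) \<oplus>\<^bsub>?T\<^esub> (b x y \<oplus>\<^bsub>?T\<^esub> b y x)) \<ominus>\<^bsub>?T\<^esub> (b x x \<oplus>\<^bsub>?T\<^esub> b y y) \<in> ?K"
    using K(4,5) alt x y by blast
  moreover have "((b x x \<oplus>\<^bsub>?T\<^esub> b y y) \<oplus>\<^bsub>?T\<^esub> (b x y \<oplus>\<^bsub>?T\<^esub> b y x)) \<ominus>\<^bsub>?T\<^esub> (b x x \<oplus>\<^bsub>?T\<^esub> b y y)
    = b x y \<oplus>\<^bsub>?T\<^esub> b y x"
  proof -
    have "(p \<oplus>\<^bsub>?T\<^esub> q) \<ominus>\<^bsub>?T\<^esub> p = q" if "p \<in> carrier ?T" "q \<in> carrier ?T" for p q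
      using that T.a_comm[of p q] by (simp add: a_minus_def T.a_assoc T.r_neg)
    then show ?thesis using c x y by simp
  qed
  ultimately show ?thesis by (simp add: b_def)
qed

text \<open>
  Swapping the first of two equal entries past its right neighbour, one step at a time, makes the
  two entries adjacent.
\<close>

lemma ext_relations_repeat:
  assumes M: "module R M"
  shows "length xs + length ys + length zs + 2 = n \<Longrightarrow>
    set xs \<union> {x} \<union> set ys \<union> set zs \<subseteq> carrier M \<Longrightarrow>
    basis_vec R (xs @ [x] @ ys @ [x] @ zs) \<in> ext_relations R M n"
proof (induction ys arbitrary: xs)
  case Nil
  then show ?case using ext_relations_alt[of xs zs n x M] by simp
next
  case (Cons y ys)
  let ?T = "tuple_module R M n"
  interpret T: module R ?T by (rule tuple_module_module)
  let ?u = "basis_vec R (xs @ [x, y] @ ys @ [x] @ zs)" and ?v = "basis_vec R (xs @ [y, x] @ ys @ [x] @ zs)"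
  note K = submoduleD[OF ext_relations_submodule[OF M] tuple_module_module]
  have c: "?u \<in> carrier ?T" "?v \<in> carrier ?T" using Cons.prems by (auto intro!: tuple_basis_closed)
  have "?v \<in> ext_relations R M n" using Cons.IH[of "xs @ [y]"] Cons.prems by simp
  moreover have "?u \<oplus>\<^bsub>?T\<^esub> ?v \<in> ext_relations R M n"
    using Cons.prems by (intro ext_relations_swap[OF M]) auto
  ultimately have "(?u \<oplus>\<^bsub>?T\<^esub> ?v) \<ominus>\<^bsub>?T\<^esub> ?v \<in> ext_relations R M n" using K(5) by blast
  moreover have "(?u \<oplus>\<^bsub>?T\<^esub> ?v) \<ominus>\<^bsub>?T\<^esub> ?v = ?u"
    using c by (simp only: a_minus_def T.a_assoc T.r_neg T.a_inv_closed T.r_zero)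
  ultimately show ?case by simp
qed

text \<open>
  Multilinear expansion, from left to right: once the entries before a slot are basis vectors, the
  vectors that may stand in this slot form a submodule of the free module on \<open>I\<close>. It contains the
  basis by induction on the number of entries after the slot, so it is everything.
\<close>

lemma tuple_module_spanned_by_basis_tuples:
  assumes H: "submodule H R (tuple_module R (free_module R I) n)"
    and rel: "ext_relations R (free_module R I) n \<subseteq> H"
    and basis: "\<And>is. length is = n \<Longrightarrow> set is \<subseteq> I \<Longrightarrow> basis_vec R (map (basis_vec R) is) \<in> H"
    and t: "t \<in> carrier (tuple_module R (free_module R I) n)"
  shows "t \<in> H"
proof -
  let ?M = "free_module R I" and ?T = "tuple_module R (free_module R I) n"
  interpret M: module R ?M by (rule free_module_module)
  interpret T: module R ?T by (rule tuple_module_module)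
  note H' = submoduleD[OF H tuple_module_module]
  have uncancel: "u \<in> H" if "u \<ominus>\<^bsub>?T\<^esub> v \<in> H" "v \<in> H" "u \<in> carrier ?T" for u v
  proof -
    have "(u \<ominus>\<^bsub>?T\<^esub> v) \<oplus>\<^bsub>?T\<^esub> v \<in> H" using H'(4) that by blast
    then show ?thesis
      using that H'(1)[OF that(2)] by (simp add: a_minus_def T.a_assoc T.l_neg)
  qed
  have "basis_vec R (map (basis_vec R) is @ ys) \<in> H"
    if "length is + length ys = n" "set is \<subseteq> I" "set ys \<subseteq> carrier ?M" for "is" ys
    using that
  proof (induction ys arbitrary: "is")
    case Nil
    then show ?case using basis by simp
  next
    case (Cons y ys)
    let ?xs = "map (basis_vec R) is"
    define b where "b z = basis_vec R (?xs @ [z] @ ys)" for z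
    have xs: "set ?xs \<subseteq> carrier ?M" using Cons.prems basis_vec_closed[of _ I] by auto
    have c: "b z \<in> carrier ?T" if "z \<in> carrier ?M" for z
      unfolding b_def using that Cons.prems xs by (intro tuple_basis_closed) auto
    have add: "b (u \<oplus>\<^bsub>?M\<^esub> v) \<in> H" if "u \<in> carrier ?M" "v \<in> carrier ?M" "b u \<in> H" "b v \<in> H" for u v
    proof (rule uncancel)
      show "b (u \<oplus>\<^bsub>?M\<^esub> v) \<ominus>\<^bsub>?T\<^esub> (b u \<oplus>\<^bsub>?T\<^esub> b v) \<in> H"
        unfolding b_def using that Cons.prems xs by (intro subsetD[OF rel] ext_relations_add) auto
    qed (use that H' c in auto)
    have smult: "b (r \<odot>\<^bsub>?M\<^esub> u) \<in> H" if "r \<in> carrier R" "u \<in> carrier ?M" "b u \<in> H" for r u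
    proof (rule uncancel)
      show "b (r \<odot>\<^bsub>?M\<^esub> u) \<ominus>\<^bsub>?T\<^esub> (r \<odot>\<^bsub>?T\<^esub> b u) \<in> H"
        unfolding b_def using that Cons.prems xs by (intro subsetD[OF rel] ext_relations_smult) auto
    qed (use that H' c in auto)
    \<comment> \<open>Homogeneity with the scalar zero, applied to the zero vector.\<close>
    have zero: "b \<zero>\<^bsub>?M\<^esub> \<in> H"
    proof (rule uncancel)
      have "\<zero> \<odot>\<^bsub>?M\<^esub> \<zero>\<^bsub>?M\<^esub> = \<zero>\<^bsub>?M\<^esub>" by simp
      then show "b \<zero>\<^bsub>?M\<^esub> \<ominus>\<^bsub>?T\<^esub> (\<zero> \<odot>\<^bsub>?T\<^esub> b \<zero>\<^bsub>?M\<^esub>) \<in> H"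
        using ext_relations_smult[of ?xs ys n \<zero> "\<zero>\<^bsub>?M\<^esub>" ?M] Cons.prems xs subsetD[OF rel]
        by (simp add: b_def)
      show "\<zero> \<odot>\<^bsub>?T\<^esub> b \<zero>\<^bsub>?M\<^esub> \<in> H" using c[OF M.M.zero_closed] H'(2) by simp
    qed (rule c[OF M.M.zero_closed])
    have "submodule {z \<in> carrier ?M. b z \<in> H} R ?M"
    proof (rule M.submoduleI)
      fix z assume z: "z \<in> {z \<in> carrier ?M. b z \<in> H}"
      have "\<ominus>\<^bsub>?M\<^esub> z = (\<ominus> \<one>) \<odot>\<^bsub>?M\<^esub> z" using z M.smult_l_minus[of \<one> z] by simp
      then show "\<ominus>\<^bsub>?M\<^esub> z \<in> {z \<in> carrier ?M. b z \<in> H}" using smult[of "\<ominus> \<one>" z] z by simp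
    qed (use add smult zero in auto)
    moreover have "basis_vec R i \<in> {z \<in> carrier ?M. b z \<in> H}" if "i \<in> I" for i
      using that Cons.IH[of "is @ [i]"] Cons.prems by (simp add: b_def basis_vec_closed)
    ultimately have "y \<in> {z \<in> carrier ?M. b z \<in> H}"
      using free_module_induct[of "{z \<in> carrier ?M. b z \<in> H}" I y] Cons.prems by simp
    then show ?case by (simp add: b_def)
  qed
  from this[of "[]"] show ?thesis
    using t H unfolding tuple_module_def by (intro free_module_induct[OF _ _ t[unfolded tuple_module_def]]) auto
qed


section \<open>Coefficients along the orders\<close>

text \<open>
  The coefficient of \<open>e\<^bsub>i\<^sub>1\<^esub> \<otimes> \<dots> \<otimes> e\<^bsub>i\<^sub>n\<^esub>\<close> in \<open>v\<^sub>1 \<otimes> \<dots> \<otimes> v\<^sub>n\<close>. It is meaningful only for lists of the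
  same length: on a shorter list of indices, \<open>hd []\<close> is an arbitrary index.
\<close>

primrec tensor_coeff :: "('i \<Rightarrow> 'a) list \<Rightarrow> 'i list \<Rightarrow> 'a" where
  "tensor_coeff [] is = \<one>"
| "tensor_coeff (v # vs) is = v (hd is) \<otimes> tensor_coeff vs (tl is)"

lemma tensor_coeff_closed:
  "set vs \<subseteq> carrier (free_module R I) \<Longrightarrow> tensor_coeff vs is \<in> carrier R"
  by (induction vs arbitrary: "is") (auto simp: free_module_carrier)

lemma tensor_coeff_append:
  assumes "length xs = length is" "set xs \<subseteq> carrier (free_module R I)" "set ys \<subseteq> carrier (free_module R I)"
  shows "tensor_coeff (xs @ ys) (is @ js) = tensor_coeff xs is \<otimes> tensor_coeff ys js"
  using assms
proof (induction xs "is" rule: list_induct2)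
  case (Cons x xs i "is")
  then show ?case
    using tensor_coeff_closed[of xs I "is"] tensor_coeff_closed[of ys I js]
    by (auto simp: free_module_carrier m_assoc)
qed (auto simp: tensor_coeff_closed)

lemma tensor_coeff_basis:
  "length js = length is \<Longrightarrow>
    tensor_coeff (map (basis_vec R) is) js = (if js = is then \<one> else \<zero>)"
proof (induction js "is" rule: list_induct2)
  case (Cons j js i "is")
  then show ?case by (auto simp: basis_vec_def)
qed simp

text \<open>
  For \<open>n = |I|\<close>, this is the part of \<open>v\<^sub>1 \<otimes> \<dots> \<otimes> v\<^sub>n\<close> supported on tuples of distinct basis vectors,
  read as a combination of orders. Modulo the swap relators it is the determinant of the \<open>v\<^sub>j\<close> times
  any one of the orders, up to sign.
\<close>

definition order_coeffs :: "'i set \<Rightarrow> ('i \<Rightarrow> 'a) list \<Rightarrow> 'i set list \<Rightarrow> 'a" where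
  "order_coeffs I vs = (\<lambda>F. if F \<in> singleton_compositions I then tensor_coeff vs (map the_elem F) else \<zero>)"

lemma finite_singleton_compositions: "finite I \<Longrightarrow> finite (singleton_compositions I)"
  by (rule finite_subset[of _ "{F. set F \<subseteq> Pow I \<and> length F = card I}"])
    (auto simp: singleton_compositions_def compositions_iff finite_lists_length_eq)

lemma order_coeffs_closed:
  assumes "finite I" "set vs \<subseteq> carrier (free_module R I)"
  shows "order_coeffs I vs \<in> carrier (free_module R (singleton_compositions I))"
  using assms tensor_coeff_closed
  by (intro free_moduleI[of "singleton_compositions I"]) (auto simp: finite_singleton_compositions order_coeffs_def)

lemma the_elem_singletons: "map the_elem (singletons is) = is"
  by (induction "is") auto

lemma order_coeffs_basis:
  assumes I: "finite I" and o: "is \<in> orders I"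
  shows "order_coeffs I (map (basis_vec R) is) = basis_vec R (singletons is)"
proof
  fix F
  show "order_coeffs I (map (basis_vec R) is) F = basis_vec R (singletons is) F"
  proof (cases "F \<in> singleton_compositions I")
    case True
    then obtain js where js: "js \<in> orders I" "F = singletons js"
      using singleton_compositions_iff[OF I] by blast
    have "length js = length is" using js o orders_length by metis
    moreover have "singletons js = singletons is \<longleftrightarrow> js = is"
      by (metis the_elem_singletons)
    ultimately show ?thesis
      using True tensor_coeff_basis[of js "is"] unfolding js(2) order_coeffs_def the_elem_singletons basis_vec_def
      by simp
  next
    case False
    then have "F \<noteq> singletons is" using o singleton_compositions_iff[OF I] by blast
    then show ?thesis using False by (simp add: order_coeffs_def basis_vec_def)
  qed
qed

text \<open>
  The support splits into orbits \<open>{F, s F}\<close>, and each contributes a multiple of the relator of \<open>F\<close>.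
  Orbits are removed one at a time, which makes the support smaller; no halving is involved, so
  the characteristic is arbitrary.
\<close>

lemma invariant_function_in_submodule:
  assumes H: "submodule H R (free_module R B)"
    and s_mem: "\<And>F. F \<in> B \<Longrightarrow> s F \<in> B" and s_inv: "\<And>F. F \<in> B \<Longrightarrow> s (s F) = F"
    and s_free: "\<And>F. F \<in> B \<Longrightarrow> s F \<noteq> F"
    and relator: "\<And>F. F \<in> B \<Longrightarrow> basis_vec R F \<oplus>\<^bsub>free_module R B\<^esub> basis_vec R (s F) \<in> H"
    and f: "f \<in> carrier (free_module R B)" and f_inv: "\<And>F. F \<in> B \<Longrightarrow> f (s F) = f F"
  shows "f \<in> H"
  using f f_inv
proof (induction "card {F. f F \<noteq> \<zero>}" arbitrary: f rule: less_induct)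
  case less
  let ?P = "free_module R B"
  note H' = submoduleD[OF H free_module_module]
  have fin: "finite {F. f F \<noteq> \<zero>}" and fB: "{F. f F \<noteq> \<zero>} \<subseteq> B" and fc: "\<And>F. f F \<in> carrier R"
    using less.prems(1) by (auto simp: free_module_carrier)
  show ?case
  proof (cases "{F. f F \<noteq> \<zero>} = {}")
    case True
    then have "f = \<zero>\<^bsub>?P\<^esub>" by (auto simp: free_module_simps)
    then show ?thesis using H'(2) by simp
  next
    case False
    then obtain F where F: "f F \<noteq> \<zero>" by blast
    then have FB: "F \<in> B" using fB by blast
    let ?r = "f F \<odot>\<^bsub>?P\<^esub> (basis_vec R F \<oplus>\<^bsub>?P\<^esub> basis_vec R (s F))"
    let ?g = "\<lambda>G. if G = F \<or> G = s F then \<zero> else f G"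
    have r: "?r \<in> H" by (rule H'(6)[OF fc relator[OF FB]])
    have g: "?g \<in> carrier ?P"
      using fc fB by (intro free_moduleI[OF fin]) auto
    have "{G. ?g G \<noteq> \<zero>} \<subset> {F. f F \<noteq> \<zero>}" using F by auto
    then have "card {G. ?g G \<noteq> \<zero>} < card {F. f F \<noteq> \<zero>}" using fin psubset_card_mono by blast
    moreover have "?g (s G) = ?g G" if "G \<in> B" for G
      using less.prems(2)[OF that] s_inv[OF that] s_inv[OF FB] by metis
    ultimately have gH: "?g \<in> H" by (intro less.hyps g)
    have decomp: "f = ?g \<oplus>\<^bsub>?P\<^esub> ?r"
      using s_free[OF FB] less.prems(2)[OF FB] fc by (auto simp: free_module_simps basis_vec_def fun_eq_iff)
    show ?thesis by (subst decomp) (rule H'(4)[OF gH r])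
  qed
qed

text \<open>
  Exchanging the places \<open>k\<close> and \<open>k + 1\<close> of an order is an involution \<open>s\<close> of the orders without fixed
  points. The entries of the tuple in these places agree, so the coefficients are constant on the
  orbits of \<open>s\<close>, and the sum over an orbit is a swap relator.
\<close>

lemma order_coeffs_alternating:
  fixes I :: "'i set"
  assumes I: "finite I" and len: "length xs + 2 + length ys = card I"
    and mem: "set xs \<union> {x} \<union> set ys \<subseteq> carrier (free_module R I)"
  shows "order_coeffs I (xs @ [x, x] @ ys) \<in> koszul_relations I"
proof -
  define k where "k = length xs"
  define s :: "'i set list \<Rightarrow> 'i set list" where "s F = take k F @ [F ! Suc k, F ! k] @ drop (Suc (Suc k)) F" for F
  have split: "\<exists>p a b q. p @ a # b # q \<in> orders I \<and> length p = k \<and> F = singletons (p @ a # b # q)"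
    if F: "F \<in> singleton_compositions I" for F
  proof -
    obtain "is" where o: "is \<in> orders I" "F = singletons is"
      using F singleton_compositions_iff[OF I] by blast
    have k: "Suc k < length is" using orders_length[OF o(1)] len by (simp add: k_def)
    then have "is = take k is @ is ! k # is ! Suc k # drop (Suc (Suc k)) is"
      by (simp add: Cons_nth_drop_Suc)
    then have "take k is @ is ! k # is ! Suc k # drop (Suc (Suc k)) is \<in> orders I \<and> length (take k is) = k
      \<and> F = singletons (take k is @ is ! k # is ! Suc k # drop (Suc (Suc k)) is)"
      using o k by simp
    then show ?thesis by blast
  qed
  have s: "s (singletons (p @ a # b # q)) = singletons (p @ b # a # q)" if "length p = k" for p a b q
    unfolding s_def using that by (simp add: nth_append)
  have flip: "p @ b # a # q \<in> orders I" if "p @ a # b # q \<in> orders I" for p a b q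
    using that by (auto simp: orders_def)
  have mem_iff: "singletons is \<in> singleton_compositions I" if "is \<in> orders I" for "is"
    using that singleton_compositions_iff[OF I] by blast
  show ?thesis
  proof (rule invariant_function_in_submodule[OF koszul_relations_submodule[OF I], where s = s])
    show "order_coeffs I (xs @ [x, x] @ ys) \<in> carrier (free_module R (singleton_compositions I))"
      using mem by (intro order_coeffs_closed[OF I]) auto
    fix F assume F: "F \<in> singleton_compositions I"
    obtain p a b q where o: "p @ a # b # q \<in> orders I" and p: "length p = k"
      and Fe: "F = singletons (p @ a # b # q)" using split[OF F] by blast
    show "s F \<in> singleton_compositions I" unfolding Fe s[OF p] by (rule mem_iff[OF flip[OF o]])
    show "s (s F) = F" unfolding Fe s[OF p] ..
    show "s F \<noteq> F" unfolding Fe s[OF p] using o by (auto simp: orders_def)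
    show "basis_vec R F \<oplus>\<^bsub>free_module R (singleton_compositions I)\<^esub> basis_vec R (s F) \<in> koszul_relations I"
      unfolding Fe s[OF p] by (rule swap_in_koszul_relations[OF I o])
    have "tensor_coeff (xs @ [x, x] @ ys) (p @ [b, a] @ q) = tensor_coeff (xs @ [x, x] @ ys) (p @ [a, b] @ q)"
    proof -
      have d: "tensor_coeff (xs @ [x, x] @ ys) (p @ [c, e] @ q)
          = tensor_coeff xs p \<otimes> ((x c \<otimes> x e) \<otimes> tensor_coeff ys q)" for c e
      proof -
        have "tensor_coeff (xs @ [x, x] @ ys) (p @ [c, e] @ q)
          = tensor_coeff xs p \<otimes> tensor_coeff ([x, x] @ ys) ([c, e] @ q)"
          using mem p by (intro tensor_coeff_append[where I = I]) (auto simp: k_def)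
        also have "tensor_coeff ([x, x] @ ys) ([c, e] @ q) = tensor_coeff [x, x] [c, e] \<otimes> tensor_coeff ys q"
          using mem by (intro tensor_coeff_append[where I = I]) auto
        also have "tensor_coeff [x, x] [c, e] = x c \<otimes> x e"
          using mem by (auto simp: free_module_carrier)
        finally show ?thesis .
      qed
      have "x a \<otimes> x b = x b \<otimes> x a" using mem by (auto simp: free_module_carrier m_comm)
      then show ?thesis unfolding d by simp
    qed
    then show "order_coeffs I (xs @ [x, x] @ ys) (s F) = order_coeffs I (xs @ [x, x] @ ys) F"
      using mem_iff[OF o] mem_iff[OF flip[OF o]]
      unfolding Fe s[OF p] order_coeffs_def the_elem_singletons by simp
  qed
qed

text \<open>
  In each coefficient, the vector in a fixed slot enters through one of its coordinates, multiplied
  by a scalar that depends only on the other slots.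
\<close>

lemma order_coeffs_multilinear:
  assumes I: "finite I" and len: "length xs + 1 + length ys = card I"
    and mem: "set xs \<union> {x, y} \<union> set ys \<subseteq> carrier (free_module R I)" and r: "r \<in> carrier R"
  shows "order_coeffs I (xs @ [x \<oplus>\<^bsub>free_module R I\<^esub> y] @ ys) =
      order_coeffs I (xs @ [x] @ ys) \<oplus>\<^bsub>free_module R (singleton_compositions I)\<^esub> order_coeffs I (xs @ [y] @ ys)"
    and "order_coeffs I (xs @ [r \<odot>\<^bsub>free_module R I\<^esub> x] @ ys) =
      r \<odot>\<^bsub>free_module R (singleton_compositions I)\<^esub> order_coeffs I (xs @ [x] @ ys)"
proof -
  interpret M: module R "free_module R I" by (rule free_module_module)
  have d: "\<exists>c\<in>carrier R. \<exists>i. \<forall>z\<in>carrier (free_module R I). tensor_coeff (xs @ [z] @ ys) (map the_elem F) = c \<otimes> z i"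
    if "F \<in> singleton_compositions I" for F
  proof -
    let ?is = "map the_elem F"
    have "length ?is = card I" using that by (simp add: singleton_compositions_def)
    then have k: "length xs < length ?is" using len by simp
    let ?p = "take (length xs) ?is" and ?i = "?is ! length xs" and ?q = "drop (Suc (length xs)) ?is"
    have "?is = ?p @ [?i] @ ?q" using id_take_nth_drop[OF k] by simp
    moreover have "tensor_coeff (xs @ [z] @ ys) (?p @ [?i] @ ?q)
        = (tensor_coeff xs ?p \<otimes> tensor_coeff ys ?q) \<otimes> z ?i" if z: "z \<in> carrier (free_module R I)" for z
    proof -
      have "tensor_coeff (xs @ [z] @ ys) (?p @ [?i] @ ?q)
        = tensor_coeff xs ?p \<otimes> tensor_coeff ([z] @ ys) ([?i] @ ?q)"
        using mem z k by (intro tensor_coeff_append[where I = I]) auto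
      then show ?thesis
        using mem z tensor_coeff_closed[of xs I ?p] tensor_coeff_closed[of ys I ?q]
        by (auto simp: free_module_carrier m_ac)
    qed
    ultimately show ?thesis
      using mem tensor_coeff_closed[of xs I ?p] tensor_coeff_closed[of ys I ?q] by (metis Un_subset_iff m_closed)
  qed
  have x: "x \<in> carrier (free_module R I)" and y: "y \<in> carrier (free_module R I)" using mem by auto
  have xy: "x \<oplus>\<^bsub>free_module R I\<^esub> y \<in> carrier (free_module R I)"
    and rx: "r \<odot>\<^bsub>free_module R I\<^esub> x \<in> carrier (free_module R I)"
    using x y r by (auto intro: M.M.a_closed)
  have xi: "x i \<in> carrier R" "y i \<in> carrier R" for i using x y by (auto simp: free_module_carrier)
  show "order_coeffs I (xs @ [x \<oplus>\<^bsub>free_module R I\<^esub> y] @ ys) =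
      order_coeffs I (xs @ [x] @ ys) \<oplus>\<^bsub>free_module R (singleton_compositions I)\<^esub> order_coeffs I (xs @ [y] @ ys)"
  proof
    fix F
    show "order_coeffs I (xs @ [x \<oplus>\<^bsub>free_module R I\<^esub> y] @ ys) F =
      (order_coeffs I (xs @ [x] @ ys) \<oplus>\<^bsub>free_module R (singleton_compositions I)\<^esub> order_coeffs I (xs @ [y] @ ys)) F"
    proof (cases "F \<in> singleton_compositions I")
      case True
      obtain c i where c: "c \<in> carrier R" "\<And>z. z \<in> carrier (free_module R I) \<Longrightarrow>
          tensor_coeff (xs @ [z] @ ys) (map the_elem F) = c \<otimes> z i" using d[OF True] by blast
      show ?thesis
        using True c(1) xi by (simp only: order_coeffs_def c(2)[OF x] c(2)[OF y] c(2)[OF xy[unfolded free_module_simps]] free_module_simps if_True r_distr)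
    qed (simp add: order_coeffs_def free_module_simps)
  qed
  show "order_coeffs I (xs @ [r \<odot>\<^bsub>free_module R I\<^esub> x] @ ys) =
      r \<odot>\<^bsub>free_module R (singleton_compositions I)\<^esub> order_coeffs I (xs @ [x] @ ys)"
  proof
    fix F
    show "order_coeffs I (xs @ [r \<odot>\<^bsub>free_module R I\<^esub> x] @ ys) F =
      (r \<odot>\<^bsub>free_module R (singleton_compositions I)\<^esub> order_coeffs I (xs @ [x] @ ys)) F"
    proof (cases "F \<in> singleton_compositions I")
      case True
      obtain c i where c: "c \<in> carrier R" "\<And>z. z \<in> carrier (free_module R I) \<Longrightarrow>
          tensor_coeff (xs @ [z] @ ys) (map the_elem F) = c \<otimes> z i" using d[OF True] by blast
      show ?thesis
        using True c(1) xi r m_lcomm by (simp only: order_coeffs_def c(2)[OF x] c(2)[OF rx[unfolded free_module_simps]] free_module_simps if_True)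
    qed (use r in \<open>simp add: order_coeffs_def free_module_simps\<close>)
  qed
qed

lemma order_coeffs_relations:
  assumes I: "finite I" and t: "t \<in> ext_relations R (free_module R I) (card I)"
  shows "lin_ext R (free_module R (singleton_compositions I)) (order_coeffs I) t \<in> koszul_relations I"
proof (rule ext_relations_induced[OF free_module_module free_module_module koszul_relations_submodule[OF I]
      _ _ _ _ _ t, where v = "order_coeffs I"])
  let ?P = "free_module R (singleton_compositions I)" and ?M = "free_module R I"
  interpret P: module R ?P by (rule free_module_module)
  interpret M: module R ?M by (rule free_module_module)
  have self: "u \<ominus>\<^bsub>?P\<^esub> u \<in> koszul_relations I" if "u \<in> carrier ?P" for u
    using submoduleD(2)[OF koszul_relations_submodule[OF I] free_module_module] that P.M.r_neg[OF that]
    by (simp add: a_minus_def)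
  show "linear_map R (tuple_module R ?M (card I)) ?P (lin_ext R ?P (order_coeffs I))"
    unfolding tuple_module_def by (intro lin_ext_linear free_module_module) (auto intro!: order_coeffs_closed[OF I])
  show "lin_ext R ?P (order_coeffs I) (basis_vec R xs) = order_coeffs I xs"
    if "length xs = card I" "set xs \<subseteq> carrier ?M" for xs
    using that by (intro lin_ext_basis free_module_module order_coeffs_closed[OF I])
  fix xs x ys
  { fix y assume a: "length xs + 1 + length ys = card I" "set xs \<union> {x, y} \<union> set ys \<subseteq> carrier ?M"
    have "order_coeffs I (xs @ [x \<oplus>\<^bsub>?M\<^esub> y] @ ys) \<in> carrier ?P"
      using a by (intro order_coeffs_closed[OF I]) (auto intro: M.M.a_closed)
    then show "order_coeffs I (xs @ [x \<oplus>\<^bsub>?M\<^esub> y] @ ys) \<ominus>\<^bsub>?P\<^esub>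
        (order_coeffs I (xs @ [x] @ ys) \<oplus>\<^bsub>?P\<^esub> order_coeffs I (xs @ [y] @ ys)) \<in> koszul_relations I"
      unfolding order_coeffs_multilinear(1)[OF I a zero_closed] by (rule self) }
  { fix r assume a: "length xs + 1 + length ys = card I" "r \<in> carrier R" "set xs \<union> {x} \<union> set ys \<subseteq> carrier ?M"
    have "order_coeffs I (xs @ [r \<odot>\<^bsub>?M\<^esub> x] @ ys) \<in> carrier ?P"
      using a by (intro order_coeffs_closed[OF I]) auto
    moreover have "set xs \<union> {x, x} \<union> set ys \<subseteq> carrier ?M" using a by simp
    ultimately show "order_coeffs I (xs @ [r \<odot>\<^bsub>?M\<^esub> x] @ ys) \<ominus>\<^bsub>?P\<^esub>
        (r \<odot>\<^bsub>?P\<^esub> order_coeffs I (xs @ [x] @ ys)) \<in> koszul_relations I"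
      using order_coeffs_multilinear(2)[OF I a(1) _ a(2), of x x] self by simp }
  assume "length xs + 2 + length ys = card I" "set xs \<union> {x} \<union> set ys \<subseteq> carrier ?M"
  then show "order_coeffs I (xs @ [x, x] @ ys) \<in> koszul_relations I" by (rule order_coeffs_alternating[OF I])
qed


section \<open>The isomorphism\<close>

abbreviation letter :: "'i set \<Rightarrow> 'i \<Rightarrow> 'a" where
  "letter A \<equiv> basis_vec R (the_elem A)"

text \<open>
  On orders, this is \<open>i\<^sub>1 \<dots> i\<^sub>n \<mapsto> e\<^bsub>i\<^sub>1\<^esub> \<and> \<dots> \<and> e\<^bsub>i\<^sub>n\<^esub>\<close> before the relations of the exterior power are imposed.
\<close>

abbreviation wedge :: "'i set \<Rightarrow> ('i set list \<Rightarrow> 'a) \<Rightarrow> ('i \<Rightarrow> 'a) list \<Rightarrow> 'a" where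
  "wedge I \<equiv> lin_ext R (free_module R (tuples I)) (\<lambda>F. basis_vec R (map letter F))"

lemma letter_singletons: "map letter (singletons is) = map (basis_vec R) is"
  by simp

lemma letters_tuples:
  assumes "finite I" "F \<in> singleton_compositions I"
  shows "map letter F \<in> tuples I"
proof -
  obtain "is" where o: "is \<in> orders I" "F = singletons is"
    using assms singleton_compositions_iff by blast
  show ?thesis
    unfolding o(2) letter_singletons using o(1) orders_length[OF o(1)]
    by (auto simp: tuples_def orders_def intro: basis_vec_closed)
qed

lemma wedge_linear:
  assumes "finite I"
  shows "linear_map R (free_module R (singleton_compositions I)) (free_module R (tuples I)) (wedge I)"
  using letters_tuples[OF assms] by (intro lin_ext_linear free_module_module Pi_I basis_vec_closed)

lemma wedge_basis:
  assumes "finite I" "is \<in> orders I"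
  shows "wedge I (basis_vec R (singletons is)) = basis_vec R (map (basis_vec R) is)"
proof -
  have "singletons is \<in> singleton_compositions I" using assms singleton_compositions_iff by blast
  then have "basis_vec R (map letter (singletons is)) \<in> carrier (free_module R (tuples I))"
    by (intro basis_vec_closed letters_tuples[OF assms(1)])
  then have "wedge I (basis_vec R (singletons is)) = basis_vec R (map letter (singletons is))"
    by (intro lin_ext_basis free_module_module)
  then show ?thesis by (simp only: letter_singletons)
qed

text \<open>
  Among all orders, only \<open>i\<^sub>1 \<dots> i\<^sub>n\<close> itself has a nonzero coefficient in \<open>e\<^bsub>i\<^sub>1\<^esub> \<otimes> \<dots> \<otimes> e\<^bsub>i\<^sub>n\<^esub>\<close>.
\<close>

lemma order_coeffs_wedge:
  assumes I: "finite I" and x: "x \<in> carrier (free_module R (singleton_compositions I))"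
  shows "lin_ext R (free_module R (singleton_compositions I)) (order_coeffs I) (wedge I x) = x"
proof (rule linear_map_eq_on_basis[OF _ _ free_module_module _ x])
  let ?P = "free_module R (singleton_compositions I)"
  have lin: "linear_map R (free_module R (tuples I)) ?P (lin_ext R ?P (order_coeffs I))"
    by (intro lin_ext_linear free_module_module) (auto simp: tuples_def intro!: order_coeffs_closed[OF I])
  show "linear_map R ?P ?P (\<lambda>x. lin_ext R ?P (order_coeffs I) (wedge I x))"
    by (rule linear_map_comp[OF wedge_linear[OF I] lin])
  show "linear_map R ?P ?P (\<lambda>x. x)" by (simp add: linear_map_def)
  fix F assume "F \<in> singleton_compositions I"
  then obtain "is" where o: "is \<in> orders I" "F = singletons is"
    using I singleton_compositions_iff by blast
  have "set (map (basis_vec R) is) \<subseteq> carrier (free_module R I)"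
    using o by (auto simp: orders_def intro: basis_vec_closed)
  then have "lin_ext R ?P (order_coeffs I) (basis_vec R (map (basis_vec R) is)) = order_coeffs I (map (basis_vec R) is)"
    by (intro lin_ext_basis free_module_module order_coeffs_closed[OF I])
  then show "lin_ext R ?P (order_coeffs I) (wedge I (basis_vec R F)) = basis_vec R F"
    by (simp only: o(2) wedge_basis[OF I o(1)] order_coeffs_basis[OF I o(1)])
qed

text \<open>
  One direction is that neighbours anticommute in the exterior power. The other applies the left
  inverse \<open>order_coeffs\<close>, which takes relations to relations.
\<close>

lemma wedge_relations:
  assumes I: "finite I" and x: "x \<in> carrier (free_module R (singleton_compositions I))"
  shows "wedge I x \<in> ext_relations R (free_module R I) (card I) \<longleftrightarrow> x \<in> koszul_relations I"
proof
  assume "wedge I x \<in> ext_relations R (free_module R I) (card I)"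
  from order_coeffs_relations[OF I this] show "x \<in> koszul_relations I" by (simp only: order_coeffs_wedge[OF I x])
next
  assume k: "x \<in> koszul_relations I"
  have sub: "submodule (ext_relations R (free_module R I) (card I)) R (free_module R (tuples I))"
    unfolding tuple_module_eq by (intro ext_relations_submodule free_module_module)
  show "wedge I x \<in> ext_relations R (free_module R I) (card I)"
  proof (rule koszul_relations_induced[OF I free_module_module sub wedge_linear[OF I] wedge_basis[OF I] _ k])
    fix xs a b ys assume o: "xs @ a # b # ys \<in> orders I"
    have "basis_vec R (map (basis_vec R) xs @ [basis_vec R a, basis_vec R b] @ map (basis_vec R) ys)
        \<oplus>\<^bsub>tuple_module R (free_module R I) (card I)\<^esub>
        basis_vec R (map (basis_vec R) xs @ [basis_vec R b, basis_vec R a] @ map (basis_vec R) ys)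
        \<in> ext_relations R (free_module R I) (card I)"
      using o orders_length[OF o]
      by (intro ext_relations_swap free_module_module) (auto simp: orders_def intro: basis_vec_closed)
    then show "basis_vec R (map (basis_vec R) (xs @ a # b # ys)) \<oplus>\<^bsub>free_module R (tuples I)\<^esub>
        basis_vec R (map (basis_vec R) (xs @ b # a # ys)) \<in> ext_relations R (free_module R I) (card I)"
      by (simp add: tuple_module_eq)
  qed
qed

text \<open>
  The elements that are congruent to one in the image of \<open>wedge\<close> form a submodule containing the
  relations, so only tuples of basis vectors have to be examined. A tuple of \<open>|I|\<close> distinct ones is
  the image of an order; one with a repetition is a relation.
\<close>

lemma wedge_generates:
  assumes I: "finite I" and y: "y \<in> carrier (free_module R (tuples I))"
  shows "\<exists>x\<in>carrier (free_module R (singleton_compositions I)).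
    y \<ominus>\<^bsub>free_module R (tuples I)\<^esub> wedge I x \<in> ext_relations R (free_module R I) (card I)"
proof -
  let ?T = "free_module R (tuples I)" and ?P = "free_module R (singleton_compositions I)"
  let ?K = "ext_relations R (free_module R I) (card I)"
  interpret T: module R ?T by (rule free_module_module)
  interpret P: module R ?P by (rule free_module_module)
  have K: "submodule ?K R ?T" unfolding tuple_module_eq by (intro ext_relations_submodule free_module_module)
  note K' = submoduleD[OF K free_module_module]
  note w = linear_mapD[OF wedge_linear[OF I]]
  have proj: "linear_map R ?T (quot_module ?T ?K) (\<lambda>y. ?K +>\<^bsub>?T\<^esub> y)"
    by (intro linear_mapI)
      (auto simp: quot_module_carrier quot_module_add[OF K free_module_module] quot_module_smult[OF K free_module_module])
  note Q = quot_module_module[OF K free_module_module]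
  \<comment> \<open>As the preimage of an image under linear maps, this set is a submodule.\<close>
  let ?H = "{y \<in> carrier ?T. ?K +>\<^bsub>?T\<^esub> y \<in> (\<lambda>x. ?K +>\<^bsub>?T\<^esub> wedge I x) ` carrier ?P}"
  have H: "submodule ?H R ?T"
    by (intro linear_map_vimage_submodule[OF proj] linear_map_image_submodule linear_map_comp[OF wedge_linear[OF I] proj]
        free_module_module Q)
  have zero: "k \<in> ?H" if "k \<in> ?K" for k
  proof -
    have "wedge I \<zero>\<^bsub>?P\<^esub> = \<zero>\<^bsub>?T\<^esub>"
      by (rule linear_map_zero[OF wedge_linear[OF I] free_module_module free_module_module])
    then have "?K +>\<^bsub>?T\<^esub> k = ?K +>\<^bsub>?T\<^esub> wedge I \<zero>\<^bsub>?P\<^esub>"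
      using coset_zero[OF K free_module_module] that K'(2) by simp
    then show ?thesis using K'(1)[OF that] P.M.zero_closed by blast
  qed
  have "y \<in> ?H"
  proof (rule tuple_module_spanned_by_basis_tuples[OF H[unfolded tuple_module_eq], folded tuple_module_eq])
    show "?K \<subseteq> ?H" using zero by blast
    show "y \<in> carrier ?T" by (rule y)
    fix "is" assume "is": "length is = card I" "set is \<subseteq> I"
    show "basis_vec R (map (basis_vec R) is) \<in> ?H"
    proof (cases "distinct is")
      case True
      then have "is \<in> orders I" using "is" I by (simp add: orders_def distinct_card card_subset_eq)
      then have o: "basis_vec R (singletons is) \<in> carrier ?P"
        "wedge I (basis_vec R (singletons is)) = basis_vec R (map (basis_vec R) is)"
        using singletons_closed wedge_basis[OF I] by auto
      then show ?thesis
        using w(1)[OF o(1)] by (intro CollectI conjI image_eqI[OF _ o(1)]) simp_all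
    next
      case False
      then obtain xs i ys zs where d: "is = xs @ [i] @ ys @ [i] @ zs" using not_distinct_decomp by blast
      have "basis_vec R (map (basis_vec R) xs @ [basis_vec R i] @ map (basis_vec R) ys @ [basis_vec R i] @
          map (basis_vec R) zs) \<in> ?K"
        using "is" unfolding d
        by (intro ext_relations_repeat free_module_module) (auto intro: basis_vec_closed)
      then show ?thesis by (intro zero) (simp add: d)
    qed
  qed
  then obtain x where "x \<in> carrier ?P" "?K +>\<^bsub>?T\<^esub> y = ?K +>\<^bsub>?T\<^esub> wedge I x" by auto
  then show ?thesis using coset_eq_iff[OF K free_module_module y w(1)] by blast
qed

end

theorem corollary3p1:
  fixes R :: "('k, 'r) ring_scheme"
  assumes "cring R"
  shows "isomorphic_species_algebras R
    (koszul_dual_exp R :: ('k, 'a, ('a set list \<Rightarrow> 'k) set) species_algebra)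
    (desuspension (signed_exp R))"
proof -
  interpret cring R by fact
  show ?thesis
  proof (rule presented_algebras_isomorphic[OF koszul_dual_presented signed_exp_presented, where b = letter])
    fix I :: "'a set" and F assume I: "finite I"
    { assume F: "F \<in> singleton_compositions I"
      then show "map letter F \<in> tuples I" by (rule letters_tuples[OF I])
      fix \<sigma> :: "'a \<Rightarrow> 'a" and c assume "inj_on \<sigma> I" "c \<in> set F"
      then obtain i where "i \<in> I" "c = {i}"
        using F singleton_compositions_iff[OF I] by (auto simp: orders_def)
      then show "letter (\<sigma> ` c) = vec_map I \<sigma> (letter c)" using vec_map_basis[of i I \<sigma>] by simp }
  qed (rule wedge_relations wedge_generates; assumption)+
qed


end
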